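(* Let $s\in(0,1)$ and let $n\ge 1$ be an integer with $n>2s$. Then $$\mathcal S^{\rm R}_s(\mathbb{R}^n_+)<2^{-\frac{2s}{n}}\,\mathcal S_s ,$$ and the infimum $\mathcal S^{\rm R}_s(\mathbb{R}^n_+)$ is achieved, i.e. there is $u\in\mathcal D^s_{\rm R}(\mathbb{R}^n_+)$, $u\neq 0$, with $\mathcal E_s(u;\mathbb{R}^n_+\times\mathbb{R}^n_+)=\mathcal S^{\rm R}_s(\mathbb{R}^n_+)\,\|u\|^2_{L^{2^*_s}(\mathbb{R}^n_+)}$.
   Context: Notation: $\mathbb{R}^n_+=\{x=(x_1,x')\in\mathbb{R}\times\mathbb{R}^{n-1}: x_1>0\}$, $2^*_s=\frac{2n}{n-2s}$, $C_{n,s}=\frac{s2^{2s}\Gamma(\frac n2+s)}{\pi^{n/2}\Gamma(1-s)}$, and for measurable $Z\subseteq\mathbb{R}^n\times\mathbb{R}^n$ $$\mathcal E_s(u;Z)=\frac{C_{n,s}}{2}\iint_Z\frac{(u(x)-u(y))^2}{|x-y|^{n+2s}}\,dx\,dy .$$ Dirichlet (whole space) case: $\mathcal D^s(\mathbb{R}^n)=\{u\in L^{2^*_s}(\mathbb{R}^n): \mathcal E_s(u;\mathbb{R}^n\times\mathbb{R}^n)<\infty\}$ and $$\mathcal S_s=\inf_{u\in\mathcal D^s(\mathbb{R}^n),\,u\neq0}\frac{\mathcal E_s(u;\mathbb{R}^n\times\mathbb{R}^n)}{\|u\|^2_{L^{2^*_s}(\mathbb{R}^n)}}.$$ Restricted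 (regional) case: $\mathcal D^s_{\rm R}(\mathbb{R}^n_+)=\{u\in L^{2^*_s}(\mathbb{R}^n_+): \mathcal E_s(u;\mathbb{R}^n_+\times\mathbb{R}^n_+)<\infty\}$ and $$\mathcal S^{\rm R}_s(\mathbb{R}^n_+)=\inf_{u\in\mathcal D^s_{\rm R}(\mathbb{R}^n_+),\,u\neq0}\frac{\mathcal E_s(u;\mathbb{R}^n_+\times\mathbb{R}^n_+)}{\|u\|^2_{L^{2^*_s}(\mathbb{R}^n_+)}}.$$ *)

theory Defs
  imports "HOL-Analysis.Analysis"
begin

text \<open>
  \<open>\<real>\<^sup>n\<close> is rendered as \<open>real ^ 'n\<close> with \<open>n = CARD('n)\<close>; the index \<open>k\<close> in \<open>half_space k\<close> plays the
  role of the first coordinate. A function on \<open>\<Omega> \<subseteq> \<real>\<^sup>n\<close> is represented by a total function of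
  which only the values on \<open>\<Omega>\<close> matter. No quotient by almost-everywhere equality is taken:
  \<open>u = 0\<close> in \<open>L\<^sup>p(\<Omega>)\<close> is the predicate \<open>zero_ae \<Omega> u\<close>.
\<close>

definition half_space :: "'n::finite \<Rightarrow> (real ^ 'n) set" where
  "half_space k = {x. 0 < x $ k}"

definition crit_exp :: "nat \<Rightarrow> real \<Rightarrow> real" where
  "crit_exp n s = 2 * real n / (real n - 2 * s)"

definition frac_const :: "nat \<Rightarrow> real \<Rightarrow> real" where
  "frac_const n s =
     s * 2 powr (2 * s) * Gamma (real n / 2 + s) / (pi powr (real n / 2) * Gamma (1 - s))"

text \<open>
  The energy takes values in \<open>[0, \<infinity>]\<close>. On the diagonal \<open>x = y\<close>, a null set, the
  integrand is \<open>0 / 0 = 0\<close>.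
\<close>
definition frac_energy ::
  "real \<Rightarrow> (real ^ 'n::finite \<Rightarrow> real) \<Rightarrow> ((real ^ 'n) \<times> (real ^ 'n)) set \<Rightarrow> ennreal" where
  "frac_energy s u Z =
     ennreal (frac_const CARD('n) s / 2) *
     (\<integral>\<^sup>+ (x, y) \<in> Z. ennreal ((u x - u y)\<^sup>2 / norm (x - y) powr (real CARD('n) + 2 * s)) \<partial>lebesgue)"

definition Lp_space :: "real \<Rightarrow> (real ^ 'n::finite) set \<Rightarrow> (real ^ 'n \<Rightarrow> real) set" where
  "Lp_space p \<Omega> =
     {u \<in> borel_measurable (lebesgue_on \<Omega>). integrable (lebesgue_on \<Omega>) (\<lambda>x. \<bar>u x\<bar> powr p)}"

definition Lp_norm :: "real \<Rightarrow> (real ^ 'n::finite) set \<Rightarrow> (real ^ 'n \<Rightarrow> real) \<Rightarrow> real" where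
  "Lp_norm p \<Omega> u = (LINT x|lebesgue_on \<Omega>. \<bar>u x\<bar> powr p) powr (1 / p)"

definition zero_ae :: "(real ^ 'n::finite) set \<Rightarrow> (real ^ 'n \<Rightarrow> real) \<Rightarrow> bool" where
  "zero_ae \<Omega> u \<longleftrightarrow> (AE x in lebesgue_on \<Omega>. u x = 0)"

text \<open>
  For \<open>\<Omega> = UNIV\<close> the next two definitions give \<open>\<D>\<^sup>s(\<real>\<^sup>n)\<close> and \<open>\<S>\<^sub>s\<close>;
  for \<open>\<Omega> = half_space k\<close> they give the restricted (regional) versions.
\<close>
definition frac_space :: "real \<Rightarrow> (real ^ 'n::finite) set \<Rightarrow> (real ^ 'n \<Rightarrow> real) set" where
  "frac_space s \<Omega> =
     {u \<in> Lp_space (crit_exp CARD('n) s) \<Omega>. frac_energy s u (\<Omega> \<times> \<Omega>) < \<infinity>}"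

definition sobolev_const :: "real \<Rightarrow> (real ^ 'n::finite) set \<Rightarrow> ennreal" where
  "sobolev_const s \<Omega> =
     (INF u \<in> {u \<in> frac_space s \<Omega>. \<not> zero_ae \<Omega> u}.
        frac_energy s u (\<Omega> \<times> \<Omega>) / ennreal ((Lp_norm (crit_exp CARD('n) s) \<Omega> u)\<^sup>2))"

end

theory Submission
  imports Defs "HOL-Complex_Analysis.Great_Picard"
begin

text \<open>
  Both infima are attained for the same reason, and the strict inequality follows by cutting a
  whole-space minimizer in two.

  Normalize functions to have critical mass \<open>\<integral> \<bar>u\<bar> powr p = 1\<close>. The quotient is then the energy, and it is
  invariant under translations and dilations that preserve the domain, so a minimizing sequence may
  lose compactness by spreading, by concentrating or by running away; it has to be rescaled around a
  suitable cube. That cube is found through a refined Sobolev inequality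
  (\<open>mass_le_average_gagliardo\<close>): the mass is at most a constant times the energy times a positive
  power of the supremum of \<open>r powr (n / 2 - s)\<close> times the absolute average of the function over a cube
  of side \<open>r\<close>. A bounded energy therefore forces some cube to carry
  a substantial average, and rescaling that cube to the unit cube yields a new minimizing sequence
  whose averages over the unit cube stay away from \<open>0\<close> (\<open>normalized_minimizing_sequence\<close>). Bounded
  energy gives local compactness in \<open>L\<^sup>2\<close> (\<open>gagliardo_compactness\<close>), so a subsequence converges almost
  everywhere to a nonzero profile \<open>w\<close>.

  By the Brezis-Lieb lemma, mass and energy split asymptotically between \<open>w\<close> and the remainder
  (\<open>profile_splitting\<close>). If \<open>a\<close> is the mass of \<open>w\<close> and \<open>L\<close> the infimum, then
  \<open>E(w) + L (1 - a) powr (2 / p) \<le> L\<close>, while \<open>E(w) \<ge> L a powr (2 / p)\<close>. Since \<open>2 / p < 1\<close> and \<open>a > 0\<close>, strict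
  concavity leaves only \<open>a = 1\<close>, and \<open>w\<close> is a minimizer. On the whole space this is the entire
  argument.

  Translate a whole-space minimizer until a hyperplane bisects its mass. Its energy is the sum of the
  energies of the two halves and of an interaction term. The interaction is positive, since without it
  the function would be a nonzero constant, which is not \<open>p\<close>-integrable. So one half has less than
  half of the energy and exactly half of the mass, which is the strict inequality
  (\<open>best_constant_half_space_less\<close>).

  On the half-space, rescaling moves the boundary: the domains become \<open>{x. - t\<^sub>j < x $ k}\<close> with
  \<open>t\<^sub>j\<close> a natural number, because the distinguished cubes have integer corners after rescaling. If some
  value of \<open>t\<^sub>j\<close> recurs, the argument above applies on a fixed translated half-space. Otherwise
  \<open>t\<^sub>j\<close> tends to infinity, and the profile lives on the whole space, where \<open>E(w) \<ge> S a powr (2 / p)\<close> with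
  \<open>S > L\<close> by the strict inequality; this contradicts the splitting (\<open>half_space_minimizer\<close>).

  All of this is carried out for Borel functions and without the constant in front of the double
  integral; \<open>sobolev_const_eq_best_constant\<close> transfers it to Lebesgue measurable functions and
  restores the constant.
\<close>

section \<open>The Brezis-Lieb lemma\<close>

lemma powr_add_le:
  fixes a b q :: real
  assumes "0 < q"
  shows "\<bar>a + b\<bar> powr q \<le> 2 powr q * (\<bar>a\<bar> powr q + \<bar>b\<bar> powr q)"
proof -
  have "\<bar>a + b\<bar> powr q \<le> (2 * max \<bar>a\<bar> \<bar>b\<bar>) powr q"
    by (rule powr_mono2) (use assms in auto)
  also have "\<dots> = 2 powr q * (max \<bar>a\<bar> \<bar>b\<bar>) powr q" by (simp add: powr_mult)
  also have "\<dots> \<le> 2 powr q * (\<bar>a\<bar> powr q + \<bar>b\<bar> powr q)"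
    by (intro mult_left_mono) (auto simp: max_def)
  finally show ?thesis .
qed

text \<open>
  By homogeneity only the ratio \<open>t = b / a\<close> matters. For small \<open>t\<close> the left-hand side is a small
  multiple of \<open>\<bar>a\<bar> powr q\<close> by continuity of \<open>\<bar>1 + t\<bar> powr q\<close> at \<open>0\<close>; for large \<open>t\<close> everything is dominated
  by \<open>\<bar>b\<bar> powr q\<close>.
\<close>
lemma powr_perturbation:
  fixes q \<epsilon> :: real
  assumes q: "0 < q" and e: "0 < \<epsilon>"
  obtains C where "0 \<le> C"
    "\<And>a b. \<bar>\<bar>a + b\<bar> powr q - \<bar>a\<bar> powr q\<bar> \<le> \<epsilon> * \<bar>a\<bar> powr q + C * \<bar>b\<bar> powr q"
proof -
  have "((\<lambda>t. \<bar>1 + t\<bar> powr q) \<longlongrightarrow> \<bar>1 + 0\<bar> powr q) (at (0::real))"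
    by (intro tendsto_intros) auto
  then have "eventually (\<lambda>t. dist (\<bar>1 + t\<bar> powr q) 1 < \<epsilon>) (at (0::real))"
    using e by (auto simp: tendsto_iff)
  then obtain d where d: "d > 0" and dd: "\<And>t. t \<noteq> 0 \<Longrightarrow> \<bar>t\<bar> < d \<Longrightarrow> \<bar>\<bar>1 + t\<bar> powr q - 1\<bar> < \<epsilon>"
    by (auto simp: eventually_at dist_real_def)
  have dd': "\<bar>\<bar>1 + t\<bar> powr q - 1\<bar> \<le> \<epsilon>" if "\<bar>t\<bar> < d" for t
    using dd[OF _ that] e by (cases "t = 0") (auto intro: less_imp_le)
  define C where "C = (1 + 1 / d) powr q + (1 / d) powr q"
  show ?thesis
  proof
    show "0 \<le> C" by (simp add: C_def)
    fix a b :: real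
    show "\<bar>\<bar>a + b\<bar> powr q - \<bar>a\<bar> powr q\<bar> \<le> \<epsilon> * \<bar>a\<bar> powr q + C * \<bar>b\<bar> powr q"
    proof (cases "\<bar>b\<bar> < d * \<bar>a\<bar>")
      case True
      then have a0: "a \<noteq> 0" using d by auto
      have "\<bar>b / a\<bar> < d" using True a0 by (simp add: abs_divide field_simps)
      from dd'[OF this] have *: "\<bar>\<bar>1 + b / a\<bar> powr q - 1\<bar> \<le> \<epsilon>" .
      have "\<bar>a + b\<bar> = \<bar>a\<bar> * \<bar>1 + b / a\<bar>" using a0
        by (simp add: abs_mult[symmetric] field_simps)
      then have "\<bar>a + b\<bar> powr q - \<bar>a\<bar> powr q = \<bar>a\<bar> powr q * (\<bar>1 + b / a\<bar> powr q - 1)"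
        by (simp only: powr_mult) (simp add: algebra_simps)
      then have "\<bar>\<bar>a + b\<bar> powr q - \<bar>a\<bar> powr q\<bar> = \<bar>a\<bar> powr q * \<bar>\<bar>1 + b / a\<bar> powr q - 1\<bar>"
        by (simp only: abs_mult) simp
      also have "\<dots> \<le> \<bar>a\<bar> powr q * \<epsilon>" by (intro mult_left_mono *) auto
      also have "\<dots> \<le> \<epsilon> * \<bar>a\<bar> powr q + C * \<bar>b\<bar> powr q" by (simp add: \<open>0 \<le> C\<close>)
      finally show ?thesis .
    next
      case False
      then have ab: "\<bar>a\<bar> \<le> (1 / d) * \<bar>b\<bar>" using d by (simp add: field_simps)
      have 1: "\<bar>a\<bar> powr q \<le> (1 / d) powr q * \<bar>b\<bar> powr q"
        using powr_mono2[OF _ _ ab, of q] q by (simp only: powr_mult[of "1 / d"])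
      have "\<bar>a + b\<bar> \<le> (1 + 1 / d) * \<bar>b\<bar>" using ab by (simp add: algebra_simps)
      from powr_mono2[OF _ _ this, of q] have 2: "\<bar>a + b\<bar> powr q \<le> (1 + 1 / d) powr q * \<bar>b\<bar> powr q"
        using q d by (simp add: powr_mult)
      have "\<bar>\<bar>a + b\<bar> powr q - \<bar>a\<bar> powr q\<bar> \<le> \<bar>a + b\<bar> powr q + \<bar>a\<bar> powr q"
        using powr_ge_zero[of "\<bar>a + b\<bar>" q] powr_ge_zero[of "\<bar>a\<bar>" q] by linarith
      also have "\<dots> \<le> C * \<bar>b\<bar> powr q" using 1 2 by (simp add: C_def algebra_simps)
      also have "\<dots> \<le> \<epsilon> * \<bar>a\<bar> powr q + C * \<bar>b\<bar> powr q" using e by simp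
      finally show ?thesis .
    qed
  qed
qed

text \<open>
  The defect \<open>\<bar>f\<^sub>j\<bar> powr q - \<bar>f\<^sub>j - g\<bar> powr q - \<bar>g\<bar> powr q\<close> tends to \<open>0\<close> almost everywhere, but it has no integrable
  majorant. By \<open>powr_perturbation\<close> it exceeds \<open>\<epsilon> \<bar>f\<^sub>j - g\<bar> powr q\<close> by at most a multiple of
  \<open>\<bar>g\<bar> powr q\<close>; dominated convergence removes this excess, and the integrals of \<open>\<bar>f\<^sub>j - g\<bar> powr q\<close> are
  bounded.
\<close>
lemma brezis_lieb:
  fixes f :: "nat \<Rightarrow> 'a \<Rightarrow> real" and g :: "'a \<Rightarrow> real" and q K :: real
  assumes q: "0 < q"
    and fm [measurable]: "\<And>j. f j \<in> borel_measurable M"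
    and gm [measurable]: "g \<in> borel_measurable M"
    and bound: "\<And>j. (\<integral>\<^sup>+x. ennreal (\<bar>f j x\<bar> powr q) \<partial>M) \<le> ennreal K"
    and ae: "AE x in M. (\<lambda>j. f j x) \<longlonglongrightarrow> g x"
  shows "\<And>j. integrable M (\<lambda>x. \<bar>f j x\<bar> powr q)"
    and "integrable M (\<lambda>x. \<bar>g x\<bar> powr q)"
    and "\<And>j. integrable M (\<lambda>x. \<bar>f j x - g x\<bar> powr q)"
    and "(\<lambda>j. (LINT x|M. \<bar>f j x\<bar> powr q) - (LINT x|M. \<bar>f j x - g x\<bar> powr q))
           \<longlonglongrightarrow> (LINT x|M. \<bar>g x\<bar> powr q)"
proof -
  have K: "ennreal K < \<infinity>" by simp
  show if': "integrable M (\<lambda>x. \<bar>f j x\<bar> powr q)" for j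
    using order.strict_trans1[OF bound[of j] K] by (simp add: integrable_iff_bounded)
  have gle: "(\<integral>\<^sup>+x. ennreal (\<bar>g x\<bar> powr q) \<partial>M) \<le> ennreal K"
  proof -
    have "(\<integral>\<^sup>+x. ennreal (\<bar>g x\<bar> powr q) \<partial>M) = (\<integral>\<^sup>+x. liminf (\<lambda>j. ennreal (\<bar>f j x\<bar> powr q)) \<partial>M)"
    proof (rule nn_integral_cong_AE, use ae in eventually_elim)
      case (elim x)
      then have "(\<lambda>j. ennreal (\<bar>f j x\<bar> powr q)) \<longlonglongrightarrow> ennreal (\<bar>g x\<bar> powr q)"
        using q by (intro tendsto_intros) auto
      then show ?case by (intro lim_imp_Liminf[symmetric]) auto
    qed
    also have "\<dots> \<le> liminf (\<lambda>j. (\<integral>\<^sup>+x. ennreal (\<bar>f j x\<bar> powr q) \<partial>M))"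
      by (intro nn_integral_liminf) auto
    also have "\<dots> \<le> ennreal K"
      by (intro Liminf_le) (auto simp: bound)
    finally show ?thesis .
  qed
  show ig: "integrable M (\<lambda>x. \<bar>g x\<bar> powr q)"
    using order.strict_trans1[OF gle K] by (simp add: integrable_iff_bounded)
  have b1: "\<bar>f j x - g x\<bar> powr q \<le> 2 powr q * (\<bar>f j x\<bar> powr q + \<bar>g x\<bar> powr q)" for j x
    using powr_add_le[OF q, of "f j x" "- g x"] by simp
  show id: "integrable M (\<lambda>x. \<bar>f j x - g x\<bar> powr q)" for j
    by (rule Bochner_Integration.integrable_bound[where
          f = "\<lambda>x. 2 powr q * (\<bar>f j x\<bar> powr q + \<bar>g x\<bar> powr q)"])
      (use if' ig b1 in auto)
  define K' where "K' = max K 0"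
  have lf: "(LINT x|M. \<bar>f j x\<bar> powr q) \<le> K'" for j
  proof -
    have "ennreal (LINT x|M. \<bar>f j x\<bar> powr q) \<le> ennreal K"
      using bound[of j] nn_integral_eq_integral[OF if', of j] by simp
    also have "ennreal K \<le> ennreal K'" by (intro ennreal_leI) (simp add: K'_def)
    finally show ?thesis by (subst (asm) ennreal_le_iff) (simp_all add: K'_def)
  qed
  have lg: "(LINT x|M. \<bar>g x\<bar> powr q) \<le> K'"
  proof -
    have "ennreal (LINT x|M. \<bar>g x\<bar> powr q) \<le> ennreal K"
      using gle nn_integral_eq_integral[OF ig] by simp
    also have "ennreal K \<le> ennreal K'" by (intro ennreal_leI) (simp add: K'_def)
    finally show ?thesis by (subst (asm) ennreal_le_iff) (simp_all add: K'_def)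
  qed
  define D where "D = 2 powr q * (K' + K')"
  have D0: "D \<ge> 0" by (simp add: D_def K'_def)
  have ld: "(LINT x|M. \<bar>f j x - g x\<bar> powr q) \<le> D" for j
  proof -
    have "(LINT x|M. \<bar>f j x - g x\<bar> powr q) \<le> (LINT x|M. 2 powr q * (\<bar>f j x\<bar> powr q + \<bar>g x\<bar> powr q))"
      by (rule integral_mono[OF id]) (use if' ig b1 in auto)
    also have "\<dots> = 2 powr q * ((LINT x|M. \<bar>f j x\<bar> powr q) + (LINT x|M. \<bar>g x\<bar> powr q))"
      using if' ig by simp
    also have "\<dots> \<le> D" unfolding D_def by (intro mult_left_mono add_mono lf lg) auto
    finally show ?thesis .
  qed
  define R where "R j x = \<bar>f j x\<bar> powr q - \<bar>f j x - g x\<bar> powr q - \<bar>g x\<bar> powr q" for j x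
  have Rm [measurable]: "R j \<in> borel_measurable M" for j unfolding R_def by measurable
  have iR: "integrable M (R j)" for j unfolding R_def using if' ig id by auto
  have "(\<lambda>j. LINT x|M. R j x) \<longlonglongrightarrow> 0"
  proof (rule LIMSEQ_I)
    fix r :: real assume r: "0 < r"
    define e where "e = r / (2 * (D + 1))"
    have e: "e > 0" using r D0 by (simp add: e_def)
    obtain C where C: "0 \<le> C"
      "\<And>a b. \<bar>\<bar>a + b\<bar> powr q - \<bar>a\<bar> powr q\<bar> \<le> e * \<bar>a\<bar> powr q + C * \<bar>b\<bar> powr q"
      using powr_perturbation[OF q e] by blast
    \<comment> \<open>The excess of the defect over the part that is controlled by the remainder.\<close>
    define W where "W j x = max 0 (\<bar>R j x\<bar> - e * \<bar>f j x - g x\<bar> powr q)" for j x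
    have Wm [measurable]: "W j \<in> borel_measurable M" for j unfolding W_def by measurable
    have Wb: "\<bar>W j x\<bar> \<le> (C + 1) * \<bar>g x\<bar> powr q" for j x
    proof -
      have "\<bar>R j x\<bar> \<le> \<bar>\<bar>(f j x - g x) + g x\<bar> powr q - \<bar>f j x - g x\<bar> powr q\<bar> + \<bar>g x\<bar> powr q"
        using abs_triangle_ineq4[of "\<bar>f j x\<bar> powr q - \<bar>f j x - g x\<bar> powr q" "\<bar>g x\<bar> powr q"]
        by (simp add: R_def)
      also have "\<dots> \<le> e * \<bar>f j x - g x\<bar> powr q + (C + 1) * \<bar>g x\<bar> powr q"
        using C(2)[of "f j x - g x" "g x"] by (simp add: algebra_simps)
      finally show ?thesis using C(1) by (simp add: W_def)
    qed
    have iW: "integrable M (W j)" for j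
      by (rule Bochner_Integration.integrable_bound[where f = "\<lambda>x. (C + 1) * \<bar>g x\<bar> powr q"])
        (use ig Wb C(1) in \<open>auto simp: abs_mult\<close>)
    have "(\<lambda>j. LINT x|M. W j x) \<longlonglongrightarrow> (LINT x|M. 0)"
    proof (rule integral_dominated_convergence[where w = "\<lambda>x. (C + 1) * \<bar>g x\<bar> powr q"])
      show "AE x in M. (\<lambda>j. W j x) \<longlonglongrightarrow> 0"
        using ae
      proof eventually_elim
        case (elim x)
        have "(\<lambda>j. W j x) \<longlonglongrightarrow> max 0 (\<bar>\<bar>g x\<bar> powr q - \<bar>g x - g x\<bar> powr q - \<bar>g x\<bar> powr q\<bar> - e * \<bar>g x - g x\<bar> powr q)"
          unfolding W_def R_def using q elim by (intro tendsto_intros tendsto_powr') auto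
        then show ?case by simp
      qed
    qed (use ig Wb in auto)
    then have "eventually (\<lambda>j. \<bar>LINT x|M. W j x\<bar> < r / 2) sequentially"
      using r by (auto simp: tendsto_iff dist_real_def dest!: spec[of _ "r/2"])
    then obtain N where N: "\<And>j. j \<ge> N \<Longrightarrow> \<bar>LINT x|M. W j x\<bar> < r / 2"
      by (auto simp: eventually_sequentially)
    show "\<exists>no. \<forall>j\<ge>no. norm ((LINT x|M. R j x) - 0) < r"
    proof (intro exI allI impI)
      fix j assume "j \<ge> N"
      have "\<bar>LINT x|M. R j x\<bar> \<le> (LINT x|M. \<bar>R j x\<bar>)" by (rule integral_abs_bound)
      also have "\<dots> \<le> (LINT x|M. W j x + e * \<bar>f j x - g x\<bar> powr q)"
        by (rule integral_mono) (use iR iW id in \<open>auto simp: W_def\<close>)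
      also have "\<dots> = (LINT x|M. W j x) + e * (LINT x|M. \<bar>f j x - g x\<bar> powr q)"
        using iW id by simp
      also have "\<dots> \<le> (LINT x|M. W j x) + e * D"
        using e ld by (intro add_left_mono mult_left_mono) auto
      also have "e * D \<le> r / 2" using r D0 by (simp add: e_def field_simps)
      finally show "norm ((LINT x|M. R j x) - 0) < r" using N[OF \<open>j \<ge> N\<close>] by simp
    qed
  qed
  moreover have "(LINT x|M. R j x) = (LINT x|M. \<bar>f j x\<bar> powr q) - (LINT x|M. \<bar>f j x - g x\<bar> powr q)
      - (LINT x|M. \<bar>g x\<bar> powr q)" for j
    unfolding R_def using if' ig id by simp
  ultimately show "(\<lambda>j. (LINT x|M. \<bar>f j x\<bar> powr q) - (LINT x|M. \<bar>f j x - g x\<bar> powr q))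
           \<longlonglongrightarrow> (LINT x|M. \<bar>g x\<bar> powr q)"
    by (simp add: LIM_zero_iff)
qed

section \<open>Energy, mass and averages over cubes\<close>

definition difference_energy :: "real \<Rightarrow> (real ^ 'n::finite) set \<Rightarrow> (real ^ 'n \<Rightarrow> real) \<Rightarrow> real ^ 'n \<Rightarrow> ennreal"
  where "difference_energy s \<Omega> u x =
    (\<integral>\<^sup>+y\<in>\<Omega>. ennreal ((u x - u y)\<^sup>2 / norm (x - y) powr (real CARD('n) + 2 * s)) \<partial>lborel)"

definition gagliardo :: "real \<Rightarrow> (real ^ 'n::finite) set \<Rightarrow> (real ^ 'n \<Rightarrow> real) \<Rightarrow> ennreal"
  where "gagliardo s \<Omega> u = (\<integral>\<^sup>+x\<in>\<Omega>. difference_energy s \<Omega> u x \<partial>lborel)"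

definition mass :: "real \<Rightarrow> (real ^ 'n::finite) set \<Rightarrow> (real ^ 'n \<Rightarrow> real) \<Rightarrow> ennreal"
  where "mass p \<Omega> u = (\<integral>\<^sup>+x\<in>\<Omega>. ennreal (\<bar>u x\<bar> powr p) \<partial>lborel)"

text \<open>
  The cell that contains \<open>x\<close> of the grid of side \<open>r\<close>. The cells are open on the left and closed on the
  right, so the open half-space is a union of cells at every scale and no boundary cells arise.
\<close>
definition cube :: "real \<Rightarrow> real ^ 'n::finite \<Rightarrow> (real ^ 'n) set"
  where "cube r x = {y. \<forall>i. \<lceil>y $ i / r\<rceil> = \<lceil>x $ i / r\<rceil>}"

definition average :: "real \<Rightarrow> (real ^ 'n::finite \<Rightarrow> real) \<Rightarrow> real ^ 'n \<Rightarrow> real"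
  where "average r u x = (LINT y:cube r x|lborel. u y) / r ^ CARD('n)"

lemma cube_iff:
  assumes "0 < r"
  shows "y \<in> cube r x \<longleftrightarrow>
    (\<forall>i. r * (of_int \<lceil>x $ i / r\<rceil> - 1) < y $ i \<and> y $ i \<le> r * of_int \<lceil>x $ i / r\<rceil>)"
  unfolding cube_def mem_Collect_eq ceiling_eq_iff using assms by (simp add: field_simps)

lemma mem_cube_self [simp]: "x \<in> cube r x"
  by (simp add: cube_def)

lemma cube_eq: "y \<in> cube r x \<Longrightarrow> cube r y = cube r x"
  by (auto simp: cube_def)

lemma borel_measurable_vec_nth [measurable]: "(\<lambda>x. x $ i) \<in> borel_measurable (borel :: (real ^ 'n::finite) measure)"
  by (intro borel_measurable_continuous_onI continuous_intros)

lemma pred_cube [measurable]: "Measurable.pred (borel \<Otimes>\<^sub>M borel) (\<lambda>z. snd z \<in> cube r (fst z))"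
proof -
  have "(\<lambda>z. snd z \<in> cube r (fst z)) =
      (\<lambda>z::(real^'a)\<times>(real^'a). \<forall>i\<in>UNIV. real_of_int \<lceil>snd z $ i / r\<rceil> = real_of_int \<lceil>fst z $ i / r\<rceil>)"
    by (auto simp: cube_def)
  also have "Measurable.pred (borel \<Otimes>\<^sub>M borel) \<dots>"
  proof (intro pred_intros_finite)
    fix i :: 'a
    show "Measurable.pred (borel \<Otimes>\<^sub>M borel) (\<lambda>z::(real^'a)\<times>(real^'a).
        real_of_int \<lceil>snd z $ i / r\<rceil> = real_of_int \<lceil>fst z $ i / r\<rceil>)"
      unfolding pred_def by (rule borel_measurable_eq) measurable
  qed simp
  finally show ?thesis .
qed

lemma cube_borel [measurable]: "cube r x \<in> sets borel"
proof -
  have "cube r x = {y\<in>space borel. \<forall>i\<in>UNIV. real_of_int \<lceil>y $ i / r\<rceil> = real_of_int \<lceil>x $ i / r\<rceil>}"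
    by (auto simp: cube_def)
  also have "\<dots> \<in> sets borel" by measurable
  finally show ?thesis .
qed

lemma emeasure_cube:
  fixes x :: "real ^ 'n::finite"
  assumes r: "0 < r"
  shows "emeasure lborel (cube r x) = ennreal (r ^ CARD('n))"
proof -
  define a b :: "real ^ 'n" where "a = (\<chi> i. r * (of_int \<lceil>x $ i / r\<rceil> - 1))"
    and "b = (\<chi> i. r * of_int \<lceil>x $ i / r\<rceil>)"
  have ba: "b - a = (\<chi> i. r)" by (simp add: a_def b_def vec_eq_iff algebra_simps)
  have inn: "(b - a) \<bullet> e = r" if "e \<in> Basis" for e
    using that unfolding ba by (auto simp: Basis_vec_def inner_axis)
  have le: "a \<bullet> e \<le> b \<bullet> e" if "e \<in> Basis" for e
    using inn[OF that] r by (simp add: inner_diff_left)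
  have pr: "(\<Prod>e\<in>Basis. (b - a) \<bullet> e) = r ^ CARD('n)"
    by (simp add: inn)
  have 1: "box a b \<subseteq> cube r x" "cube r x \<subseteq> cbox a b"
    using r by (auto simp: cube_iff mem_box_cart a_def b_def less_imp_le)
  have "emeasure lborel (box a b) \<le> emeasure lborel (cube r x)"
    by (rule emeasure_mono[OF 1(1)]) auto
  moreover have "emeasure lborel (cube r x) \<le> emeasure lborel (cbox a b)"
    by (rule emeasure_mono[OF 1(2)]) auto
  ultimately show ?thesis
    using le by (simp add: emeasure_lborel_box_eq emeasure_lborel_cbox_eq pr prod_ennreal inner_diff_left[symmetric])
qed

lemma measure_cube:
  fixes x :: "real ^ 'n::finite"
  assumes r: "0 < r"
  shows "measure lborel (cube r x) = r ^ CARD('n)"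
  using emeasure_cube[OF r, of x] r by (simp add: measure_def)

lemma norm_diff_cube_le:
  fixes x :: "real ^ 'n::finite"
  assumes r: "0 < r" and y: "y \<in> cube r x"
  shows "norm (x - y) \<le> real CARD('n) * r"
proof -
  have "\<bar>(x - y) $ i\<bar> \<le> r" for i
  proof -
    have "x \<in> cube r x" by simp
    from this[unfolded cube_iff[OF r], rule_format, of i] y[unfolded cube_iff[OF r], rule_format, of i]
    show ?thesis unfolding vector_minus_component by (auto simp: algebra_simps abs_le_iff)
  qed
  then have "(\<Sum>i\<in>UNIV. \<bar>(x - y) $ i\<bar>) \<le> (\<Sum>i\<in>(UNIV::'n set). r)" by (intro sum_mono)
  with norm_le_l1_cart[of "x - y"] show ?thesis by simp
qed

lemma set_integrable_if_mass_finite: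
  fixes u :: "real ^ 'n::finite \<Rightarrow> real"
  assumes p: "1 \<le> p" and [measurable]: "u \<in> borel_measurable borel" "\<Omega> \<in> sets borel" "A \<in> sets borel"
    and m: "mass p \<Omega> u < \<infinity>" and A: "A \<subseteq> \<Omega>" "emeasure lborel A < \<infinity>"
  shows "set_integrable lborel A u"
    and "set_integrable lborel A (\<lambda>x. \<bar>u x\<bar> powr p)"
proof -
  have "(\<integral>\<^sup>+x. ennreal (\<bar>u x\<bar> powr p) * indicator A x \<partial>lborel) \<le> mass p \<Omega> u"
    unfolding mass_def using A(1) by (intro nn_integral_mono) (auto simp: indicator_def)
  then have fin: "(\<integral>\<^sup>+x. ennreal (\<bar>u x\<bar> powr p) * indicator A x \<partial>lborel) < \<infinity>"
    using m by (rule order.strict_trans1)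
  have *: "(\<integral>\<^sup>+x. ennreal (norm (indicator A x *\<^sub>R (\<bar>u x\<bar> powr p))) \<partial>lborel)
      = (\<integral>\<^sup>+x. ennreal (\<bar>u x\<bar> powr p) * indicator A x \<partial>lborel)"
    by (intro nn_integral_cong) (auto simp: indicator_def)
  show 2: "set_integrable lborel A (\<lambda>x. \<bar>u x\<bar> powr p)"
    unfolding set_integrable_def
  proof (rule integrableI_bounded)
    show "(\<integral>\<^sup>+x. ennreal (norm (indicator A x *\<^sub>R (\<bar>u x\<bar> powr p))) \<partial>lborel) < \<infinity>"
      unfolding * by (rule fin)
  qed measurable
  have iA: "integrable lborel (indicator A :: _ \<Rightarrow> real)"
    using A(2) by (intro integrable_real_indicator) auto
  have b: "\<bar>u x\<bar> \<le> 1 + \<bar>u x\<bar> powr p" for x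
  proof (cases "\<bar>u x\<bar> \<le> 1")
    case False
    then have "\<bar>u x\<bar> powr 1 \<le> \<bar>u x\<bar> powr p" using p by (intro powr_mono) auto
    then show ?thesis using False by auto
  qed (auto intro: add_increasing2)
  show "set_integrable lborel A u"
    unfolding set_integrable_def
    by (rule Bochner_Integration.integrable_bound[OF
          Bochner_Integration.integrable_add[OF iA 2[unfolded set_integrable_def]]])
      (use b in \<open>auto simp: indicator_def intro!: AE_I2\<close>)
qed

text \<open>
  A form of Jensen's inequality with the constant 2: comparing \<open>\<bar>u\<bar>\<close> with a level \<open>l\<close> gives
  \<open>\<bar>u\<bar> \<le> l + l powr (1 - p) * \<bar>u\<bar> powr p\<close>, and \<open>l = r powr (- n / p)\<close> balances the two integrals over the
  cube.
\<close>
lemma average_bound: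
  fixes u :: "real ^ 'n::finite \<Rightarrow> real"
  assumes p: "1 \<le> p" and u[measurable]: "u \<in> borel_measurable borel" and \<Omega>[measurable]: "\<Omega> \<in> sets borel"
    and m: "mass p \<Omega> u \<le> 1" and r: "0 < r" and A: "cube r x \<subseteq> \<Omega>"
  shows "\<bar>average r u x\<bar> \<le> 2 * r powr (- (real CARD('n) / p))"
proof -
  define N where "N = real CARD('n)"
  \<comment> \<open>The level at which the two terms of the comparison have the same integral.\<close>
  define l where "l = r powr (- (N / p))"
  have l: "l > 0" using r by (simp add: l_def)
  have mf: "mass p \<Omega> u < \<infinity>" using m by (rule order.strict_trans1) simp
  have ef: "emeasure lborel (cube r x) < \<infinity>" by (simp add: emeasure_cube[OF r])
  note si = set_integrable_if_mass_finite[OF p u \<Omega> cube_borel mf A ef]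
  have b: "\<bar>u y\<bar> \<le> l + l powr (1 - p) * \<bar>u y\<bar> powr p" for y
  proof (cases "\<bar>u y\<bar> \<le> l")
    case False
    then have u0: "\<bar>u y\<bar> > 0" "l \<le> \<bar>u y\<bar>" using l by auto
    have "\<bar>u y\<bar> powr (1 - p) \<le> l powr (1 - p)"
      using p l u0 by (intro powr_mono2') auto
    then have "\<bar>u y\<bar> powr (1 - p) * \<bar>u y\<bar> powr p \<le> l powr (1 - p) * \<bar>u y\<bar> powr p"
      by (intro mult_right_mono) auto
    then have "\<bar>u y\<bar> \<le> l powr (1 - p) * \<bar>u y\<bar> powr p"
      using u0 by (simp add: powr_add[symmetric])
    then show ?thesis using l by simp
  qed (auto intro: add_increasing2)
  have i1: "set_integrable lborel (cube r x) (\<lambda>y. l)"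
    unfolding set_integrable_def using ef by (intro integrable_scaleR_left integrable_real_indicator) auto
  have e1: "(LINT y:cube r x|lborel. l) = l * r ^ CARD('n)"
    by (simp add: set_lebesgue_integral_def measure_cube[OF r])
  have e2: "(LINT y:cube r x|lborel. \<bar>u y\<bar> powr p) \<le> 1"
  proof -
    have "ennreal (LINT y:cube r x|lborel. \<bar>u y\<bar> powr p)
        = (\<integral>\<^sup>+y. ennreal (indicator (cube r x) y *\<^sub>R \<bar>u y\<bar> powr p) \<partial>lborel)"
      unfolding set_lebesgue_integral_def
      by (rule nn_integral_eq_integral[symmetric]) (use si(2) in \<open>auto simp: set_integrable_def\<close>)
    also have "\<dots> \<le> mass p \<Omega> u"
      unfolding mass_def using A by (intro nn_integral_mono) (auto simp: indicator_def)
    also have "\<dots> \<le> 1" by (rule m)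
    finally show ?thesis by simp
  qed
  have "\<bar>LINT y:cube r x|lborel. u y\<bar> \<le> (LINT y:cube r x|lborel. \<bar>u y\<bar>)"
    unfolding set_lebesgue_integral_def
    by (rule order.trans[OF integral_abs_bound]) (simp add: abs_mult)
  also have "\<dots> \<le> (LINT y:cube r x|lborel. l + l powr (1 - p) * \<bar>u y\<bar> powr p)"
    by (rule set_integral_mono) (use si i1 b in \<open>auto intro!: set_integral_add set_integrable_abs\<close>)
  also have "\<dots> = l * r ^ CARD('n) + l powr (1 - p) * (LINT y:cube r x|lborel. \<bar>u y\<bar> powr p)"
    using si(2) i1 e1 by (subst set_integral_add) auto
  also have "\<dots> \<le> l * r ^ CARD('n) + l powr (1 - p) * 1"
    by (intro add_left_mono mult_left_mono e2) auto
  also have "l powr (1 - p) = l * r ^ CARD('n)"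
  proof -
    have "- (N / p) * (1 - p) = - (N / p) + N" using p by (simp add: field_simps)
    then have "l powr (1 - p) = l * r powr N" by (simp only: l_def powr_powr powr_add)
    then show ?thesis using r by (simp add: N_def powr_realpow)
  qed
  finally have "\<bar>LINT y:cube r x|lborel. u y\<bar> \<le> 2 * l * r ^ CARD('n)" by simp
  then show ?thesis using r by (simp add: average_def abs_divide l_def N_def field_simps)
qed

text \<open>
  The value minus the average is the average of \<open>u x - u y\<close> over the cube; after Cauchy-Schwarz, the
  kernel can be inserted because \<open>\<bar>x - y\<bar> \<le> n r\<close> there.
\<close>
lemma oscillation_le_difference_energy:
  fixes u :: "real ^ 'n::finite \<Rightarrow> real"
  assumes s: "0 < s" and [measurable]: "u \<in> borel_measurable borel" "\<Omega> \<in> sets borel"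
    and i: "set_integrable lborel (cube r x) u" and r: "0 < r" and A: "cube r x \<subseteq> \<Omega>"
  shows "ennreal ((u x - average r u x)\<^sup>2) \<le>
     ennreal (real CARD('n) powr (real CARD('n) + 2 * s) * r powr (2 * s)) * difference_energy s \<Omega> u x"
proof -
  define Q where "Q = cube r x"
  define N where "N = real CARD('n)"
  define c where "c = r ^ CARD('n)"
  have N: "N > 0" unfolding N_def by simp
  have c: "c > 0" using r by (simp add: c_def)
  have [measurable]: "Q \<in> sets borel" by (simp add: Q_def)
  have eQ: "emeasure lborel Q = ennreal c" by (simp add: Q_def c_def emeasure_cube[OF r])
  have i1: "set_integrable lborel Q (\<lambda>y. u x)"
    unfolding set_integrable_def using eQ by (intro integrable_scaleR_left integrable_real_indicator) auto
  have iu: "set_integrable lborel Q u" using i by (simp add: Q_def)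
  have "(LINT y:Q|lborel. u x - u y) = u x * c - (LINT y:Q|lborel. u y)"
    using set_integral_diff(2)[OF i1 iu] measure_cube[OF r, of x]
    by (simp add: set_lebesgue_integral_def Q_def c_def)
  then have e: "u x - average r u x = (LINT y:Q|lborel. u x - u y) / c"
    using c unfolding average_def Q_def[symmetric] c_def[symmetric] by (simp add: field_simps)
  let ?I = "\<integral>\<^sup>+y. ennreal (\<bar>u x - u y\<bar>) * indicator Q y \<partial>lborel"
  let ?J = "ennreal \<bar>LINT y:Q|lborel. u x - u y\<bar>"
  have "?J \<le> ?I"
  proof -
    have "?J \<le> (\<integral>\<^sup>+y. ennreal (norm (indicator Q y *\<^sub>R (u x - u y))) \<partial>lborel)"
      unfolding set_lebesgue_integral_def real_norm_def[symmetric]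
      by (rule integral_norm_bound_ennreal)
        (use set_integral_diff(1)[OF i1 iu] in \<open>simp add: set_integrable_def\<close>)
    also have "\<dots> = ?I"
      by (intro nn_integral_cong) (auto simp: indicator_def)
    finally show ?thesis .
  qed
  then have "(?J)\<^sup>2 \<le> ?I\<^sup>2"
    by (rule power_mono) simp
  also have "?I
      = (\<integral>\<^sup>+y. (ennreal (\<bar>u x - u y\<bar>) * indicator Q y) * indicator Q y \<partial>lborel)"
    by (intro nn_integral_cong) (auto simp: indicator_def)
  also have "(\<dots>)\<^sup>2 \<le> (\<integral>\<^sup>+y. (ennreal (\<bar>u x - u y\<bar>) * indicator Q y)\<^sup>2 \<partial>lborel) * (\<integral>\<^sup>+y. (indicator Q y)\<^sup>2 \<partial>lborel)"
    by (rule Cauchy_Schwarz_nn_integral) auto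
  also have "(\<integral>\<^sup>+y. (indicator Q y)\<^sup>2 \<partial>lborel) = (\<integral>\<^sup>+y. indicator Q y \<partial>lborel)"
    by (intro nn_integral_cong) (auto simp: indicator_def)
  also have "\<dots> = ennreal c" using eQ by simp
  also have "(\<integral>\<^sup>+y. (ennreal (\<bar>u x - u y\<bar>) * indicator Q y)\<^sup>2 \<partial>lborel)
     \<le> (\<integral>\<^sup>+y. ennreal ((N * r) powr (N + 2 * s)) *
          (ennreal ((u x - u y)\<^sup>2 / norm (x - y) powr (N + 2 * s)) * indicator \<Omega> y) \<partial>lborel)"
  proof (intro nn_integral_mono)
    fix y
    show "(ennreal (\<bar>u x - u y\<bar>) * indicator Q y)\<^sup>2 \<le> ennreal ((N * r) powr (N + 2 * s)) *
          (ennreal ((u x - u y)\<^sup>2 / norm (x - y) powr (N + 2 * s)) * indicator \<Omega> y)"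
    proof (cases "y \<in> Q")
      case True
      then have y: "y \<in> \<Omega>" using A by (auto simp: Q_def)
      have "(u x - u y)\<^sup>2 \<le> (N * r) powr (N + 2 * s) * ((u x - u y)\<^sup>2 / norm (x - y) powr (N + 2 * s))"
      proof (cases "x = y")
        case False
        have "norm (x - y) powr (N + 2 * s) \<le> (N * r) powr (N + 2 * s)"
          using norm_diff_cube_le[OF r True[unfolded Q_def]] s N by (intro powr_mono2) (auto simp: N_def)
        then show ?thesis using False by (simp add: field_simps mult_left_mono)
      qed simp
      then have "ennreal ((u x - u y)\<^sup>2) \<le> ennreal ((N * r) powr (N + 2 * s)) * ennreal ((u x - u y)\<^sup>2 / norm (x - y) powr (N + 2 * s))"
        by (subst ennreal_mult[symmetric]) (auto intro: ennreal_leI)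
      then show ?thesis using True y by (simp add: ennreal_power)
    qed simp
  qed
  also have "\<dots> = ennreal ((N * r) powr (N + 2 * s)) * difference_energy s \<Omega> u x"
    unfolding difference_energy_def N_def by (intro nn_integral_cmult) auto
  finally have *: "(?J)\<^sup>2
      \<le> ennreal ((N * r) powr (N + 2 * s)) * difference_energy s \<Omega> u x * ennreal c"
    by (simp add: mult_right_mono)
  have "ennreal ((u x - average r u x)\<^sup>2) = ennreal (1 / c\<^sup>2) * (?J)\<^sup>2"
    using c by (simp add: e ennreal_power power_divide ennreal_mult[symmetric])
  also have "\<dots> \<le> ennreal (1 / c\<^sup>2) * (ennreal ((N * r) powr (N + 2 * s)) * difference_energy s \<Omega> u x * ennreal c)"
    by (intro mult_left_mono *) simp
  also have "\<dots> = ennreal (1 / c\<^sup>2 * (N * r) powr (N + 2 * s) * c) * difference_energy s \<Omega> u x"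
    using c by (subst ennreal_mult, simp, simp, subst ennreal_mult, simp_all add: mult_ac)
  also have "1 / c\<^sup>2 * (N * r) powr (N + 2 * s) * c = N powr (N + 2 * s) * r powr (2 * s)"
  proof -
    have "c = r powr N" using r by (simp add: c_def N_def powr_realpow)
    then show ?thesis using r N c by (simp add: powr_mult powr_add power2_eq_square field_simps)
  qed
  finally show ?thesis by (simp add: N_def)
qed

section \<open>A refined Sobolev inequality\<close>

text \<open>
  Optimization over the scale: at \<open>r = (M / g) powr (1 / (\<alpha> + s))\<close> both terms agree, and their common value
  to the power \<open>p\<close> is \<open>M powr (p - 2) * g\<^sup>2\<close>.
\<close>
lemma powr_le_of_scale_family:
  fixes a g M A s \<alpha> p :: real
  assumes s: "0 < s" and al: "0 < \<alpha>" and A: "0 \<le> A" and a: "0 \<le> a" and g: "0 \<le> g" and M: "0 < M"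
    and p: "p = 2 * (\<alpha> + s) / \<alpha>"
    and h: "\<And>r. 0 < r \<Longrightarrow> a \<le> A * r powr s * g + M * r powr (- \<alpha>)"
  shows "a powr p \<le> (A + 1) powr p * M powr (p - 2) * g\<^sup>2"
proof (cases "g = 0")
  case True
  have "a = 0"
  proof (rule ccontr)
    assume "a \<noteq> 0"
    then have a0: "a > 0" using a by simp
    define r where "r = (a / (2 * M)) powr (- (1 / \<alpha>))"
    have r: "r > 0" using a0 M by (simp add: r_def)
    have "r powr (- \<alpha>) = a / (2 * M)" using al a0 M by (simp add: r_def powr_powr)
    then show False using h[OF r] True a0 M by simp
  qed
  then show ?thesis using True by simp
next
  case False
  then have g0: "g > 0" using g by simp
  define q where "q = M / g"
  have q: "q > 0" using M g0 by (simp add: q_def)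
  define r where "r = q powr (1 / (\<alpha> + s))"
  have r: "r > 0" using q by (simp add: r_def)
  have rs: "r powr (\<alpha> + s) = q" using s al q by (simp add: r_def powr_powr)
  have "r powr s = r powr (\<alpha> + s) * r powr (- \<alpha>)" by (simp add: powr_add[symmetric])
  also have "\<dots> = q * r powr (- \<alpha>)" by (simp only: rs)
  finally have "r powr s * g = M * r powr (- \<alpha>)" using g0 by (simp add: q_def)
  then have "a \<le> (A + 1) * (M * r powr (- \<alpha>))" using h[OF r] by (simp add: algebra_simps)
  moreover have "p > 0" using p s al by simp
  ultimately have "a powr p \<le> ((A + 1) * (M * r powr (- \<alpha>))) powr p"
    using a by (intro powr_mono2) auto
  also have "\<dots> = (A + 1) powr p * (M powr p * r powr (- \<alpha> * p))"
    using M by (simp only: powr_mult powr_powr)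
  also have "r powr (- \<alpha> * p) = q powr (1 / (\<alpha> + s) * (- \<alpha> * p))"
    by (simp only: r_def powr_powr)
  also have "1 / (\<alpha> + s) * (- \<alpha> * p) = - 2"
  proof -
    have "\<alpha> * p = 2 * (\<alpha> + s)" using al by (simp add: p)
    then have "1 / (\<alpha> + s) * (- \<alpha> * p) = - (2 * (\<alpha> + s) / (\<alpha> + s))" by (simp del: distrib_left_numeral)
    also have "\<dots> = - 2" using s al by (simp del: distrib_left_numeral)
    finally show ?thesis .
  qed
  also have "q powr (- 2) = g\<^sup>2 * M powr (- 2)"
    using M g0 by (simp add: q_def powr_minus powr_divide field_simps)
  also have "M powr p * (g\<^sup>2 * M powr (- 2)) = M powr (p - 2) * g\<^sup>2"
  proof -
    have "M powr (p - 2) = M powr p * M powr (- 2)" by (simp add: powr_add[symmetric])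
    then show ?thesis by simp
  qed
  finally show ?thesis by (simp add: mult_ac)
qed

lemma measurable_difference_energy [measurable]:
  assumes [measurable]: "u \<in> borel_measurable borel" "\<Omega> \<in> sets borel"
  shows "difference_energy s \<Omega> u \<in> borel_measurable borel"
  unfolding difference_energy_def by measurable

definition cube_saturated :: "real \<Rightarrow> (real ^ 'n::finite) set \<Rightarrow> bool"
  where "cube_saturated r \<Omega> \<longleftrightarrow> (\<forall>x\<in>\<Omega>. cube r x \<subseteq> \<Omega>)"

lemma crit_exp_facts:
  assumes "0 < s" "2 * s < real n"
  shows "crit_exp n s > 2" "(real n / 2 - s) * crit_exp n s = real n" "real n / 2 - s > 0"
    "real n / crit_exp n s = real n / 2 - s" "crit_exp n s = 2 * ((real n / 2 - s) + s) / (real n / 2 - s)"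
  using assms by (auto simp: crit_exp_def field_simps)

text \<open>
  The refined Sobolev inequality. At a point \<open>x\<close> and every scale \<open>r\<close>, the value \<open>\<bar>u x\<bar>\<close> is at most its
  oscillation, bounded by \<open>r powr s\<close> times the square root of the difference energy at \<open>x\<close>, plus the
  average over the cube of side \<open>r\<close>. Choosing the best \<open>r\<close> for each \<open>x\<close> gives a pointwise inequality,
  which is integrated. With the trivial bound on the averages this is the Sobolev inequality; its
  contrapositive says that bounded energy forces a large average somewhere.
\<close>
theorem mass_le_average_gagliardo:
  fixes \<Omega> :: "(real ^ 'n::finite) set"
  assumes s: "0 < s" and ns: "2 * s < real CARD('n)"
  defines "p \<equiv> crit_exp CARD('n) s"
  defines "A \<equiv> sqrt (real CARD('n) powr (real CARD('n) + 2 * s))"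
  assumes u[measurable]: "u \<in> borel_measurable borel" and \<Omega>[measurable]: "\<Omega> \<in> sets borel"
    and sat: "\<And>r. 0 < r \<Longrightarrow> cube_saturated r \<Omega>"
    and fin: "mass p \<Omega> u < \<infinity>" and M: "0 < M"
    and av: "\<And>r x. 0 < r \<Longrightarrow> x \<in> \<Omega> \<Longrightarrow> \<bar>average r u x\<bar> \<le> M * r powr (- (real CARD('n) / 2 - s))"
  shows "mass p \<Omega> u \<le> ennreal ((A + 1) powr p * M powr (p - 2)) * gagliardo s \<Omega> u"
proof -
  note ce = crit_exp_facts[OF s ns, folded p_def]
  define \<alpha> where "\<alpha> = real CARD('n) / 2 - s"
  define K where "K = (A + 1) powr p * M powr (p - 2)"
  have A0: "A \<ge> 0" by (simp add: A_def)
  have K: "K > 0" using M A0 by (simp add: K_def)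
  have "ennreal (\<bar>u x\<bar> powr p) \<le> ennreal K * difference_energy s \<Omega> u x" if x: "x \<in> \<Omega>" for x
  proof (cases "difference_energy s \<Omega> u x = \<infinity>")
    case True
    then show ?thesis using K by (simp add: ennreal_mult_top)
  next
    case False
    define g where "g = sqrt (enn2real (difference_energy s \<Omega> u x))"
    have g: "g \<ge> 0" by (simp add: g_def)
    have de: "difference_energy s \<Omega> u x = ennreal (g\<^sup>2)"
      using False by (simp add: g_def less_top)
    have "\<bar>u x\<bar> \<le> A * r powr s * g + M * r powr (- \<alpha>)" if r: "0 < r" for r
    proof -
      have sub: "cube r x \<subseteq> \<Omega>" using sat[OF r] x by (auto simp: cube_saturated_def)
      have i: "set_integrable lborel (cube r x) u"
        by (rule set_integrable_if_mass_finite(1)[OF _ u \<Omega> cube_borel fin sub])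
          (use ce(1) emeasure_cube[OF r, of x] in auto)
      from oscillation_le_difference_energy[OF s u \<Omega> i r sub]
      have "ennreal ((u x - average r u x)\<^sup>2)
         \<le> ennreal (real CARD('n) powr (real CARD('n) + 2 * s) * r powr (2 * s)) * ennreal (g\<^sup>2)"
        by (simp only: de)
      also have "\<dots> = ennreal (real CARD('n) powr (real CARD('n) + 2 * s) * r powr (2 * s) * g\<^sup>2)"
        by (rule ennreal_mult[symmetric]) auto
      also have "real CARD('n) powr (real CARD('n) + 2 * s) * r powr (2 * s) * g\<^sup>2 = (A * r powr s * g)\<^sup>2"
        using r by (simp add: A_def power_mult_distrib powr_power mult.commute)
      finally have "(u x - average r u x)\<^sup>2 \<le> (A * r powr s * g)\<^sup>2" by simp
      then have "\<bar>u x - average r u x\<bar> \<le> A * r powr s * g"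
        using A0 g by (intro power2_le_imp_le[of "\<bar>u x - average r u x\<bar>"]) (auto simp only: power2_abs intro!: mult_nonneg_nonneg powr_ge_zero)
      then show ?thesis using av[OF r x] unfolding \<alpha>_def by linarith
    qed
    from powr_le_of_scale_family[OF s _ A0 _ g M _ this, of p] ce
    have "\<bar>u x\<bar> powr p \<le> K * g\<^sup>2" by (auto simp: \<alpha>_def K_def)
    then show ?thesis unfolding de using K by (subst ennreal_mult[symmetric]) (auto intro: ennreal_leI)
  qed
  then have "mass p \<Omega> u \<le> (\<integral>\<^sup>+x. ennreal K * (difference_energy s \<Omega> u x * indicator \<Omega> x) \<partial>lborel)"
    unfolding mass_def by (intro nn_integral_mono) (auto simp: indicator_def)
  also have "\<dots> = ennreal K * gagliardo s \<Omega> u"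
    unfolding gagliardo_def by (intro nn_integral_cmult) auto
  finally show ?thesis by (simp add: K_def)
qed

section \<open>Invariance under affine maps\<close>

lemma nn_integral_lborel_affine:
  fixes f :: "'a::euclidean_space \<Rightarrow> ennreal"
  assumes [measurable]: "f \<in> borel_measurable borel" and c: "c \<noteq> 0"
  shows "(\<integral>\<^sup>+x. f x \<partial>lborel) = ennreal (\<bar>c\<bar> ^ DIM('a)) * (\<integral>\<^sup>+x. f (t + c *\<^sub>R x) \<partial>lborel)"
  by (subst lborel_affine[OF c, of t])
     (simp add: nn_integral_density nn_integral_distr nn_integral_cmult)

lemma integral_lborel_affine:
  fixes f :: "'a::euclidean_space \<Rightarrow> real"
  assumes [measurable]: "f \<in> borel_measurable borel" and c: "c \<noteq> 0"
  shows "(\<integral>x. f x \<partial>lborel) = \<bar>c\<bar> ^ DIM('a) * (\<integral>x. f (t + c *\<^sub>R x) \<partial>lborel)"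
  by (subst lborel_affine[OF c, of t])
     (simp add: integral_density integral_distr)

text \<open>
  The exponent is the one for which both the critical mass and the energy are preserved; \<open>c\<close> may be
  negative, so reflections are included.
\<close>
definition rescale :: "real \<Rightarrow> real ^ 'n::finite \<Rightarrow> real \<Rightarrow> (real ^ 'n \<Rightarrow> real) \<Rightarrow> real ^ 'n \<Rightarrow> real"
  where "rescale s b c u z = \<bar>c\<bar> powr (real CARD('n) / 2 - s) * u (b + c *\<^sub>R z)"

lemma measurable_rescale [measurable]:
  assumes [measurable]: "u \<in> borel_measurable borel"
  shows "rescale s b c u \<in> borel_measurable borel"
  unfolding rescale_def by measurable

lemma mass_rescale:
  fixes u :: "real ^ 'n::finite \<Rightarrow> real"
  assumes s: "0 < s" and ns: "2 * s < real CARD('n)" and c: "c \<noteq> 0"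
    and [measurable]: "u \<in> borel_measurable borel" "\<Omega> \<in> sets borel"
  defines "p \<equiv> crit_exp CARD('n) s"
  shows "mass p {z. b + c *\<^sub>R z \<in> \<Omega>} (rescale s b c u) = mass p \<Omega> u"
proof -
  note ce = crit_exp_facts[OF s ns, folded p_def]
  have "mass p \<Omega> u = ennreal (\<bar>c\<bar> ^ CARD('n)) *
      (\<integral>\<^sup>+x. ennreal (\<bar>u (b + c *\<^sub>R x)\<bar> powr p) * indicator \<Omega> (b + c *\<^sub>R x) \<partial>lborel)"
    unfolding mass_def by (subst nn_integral_lborel_affine[OF _ c, of _ b]) auto
  also have "\<dots> = (\<integral>\<^sup>+x. ennreal (\<bar>c\<bar> ^ CARD('n)) *
      (ennreal (\<bar>u (b + c *\<^sub>R x)\<bar> powr p) * indicator \<Omega> (b + c *\<^sub>R x)) \<partial>lborel)"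
    by (intro nn_integral_cmult[symmetric]) auto
  also have "\<dots> = mass p {z. b + c *\<^sub>R z \<in> \<Omega>} (rescale s b c u)"
    unfolding mass_def
  proof (intro nn_integral_cong)
    fix x
    have "\<bar>rescale s b c u x\<bar> powr p = (\<bar>c\<bar> powr (real CARD('n) / 2 - s)) powr p * \<bar>u (b + c *\<^sub>R x)\<bar> powr p"
      by (simp add: rescale_def abs_mult powr_mult)
    also have "(\<bar>c\<bar> powr (real CARD('n) / 2 - s)) powr p = \<bar>c\<bar> ^ CARD('n)"
      using c by (simp only: powr_powr ce(2)) (simp add: powr_realpow)
    finally show "ennreal (\<bar>c\<bar> ^ CARD('n)) * (ennreal (\<bar>u (b + c *\<^sub>R x)\<bar> powr p) * indicator \<Omega> (b + c *\<^sub>R x))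
      = ennreal (\<bar>rescale s b c u x\<bar> powr p) * indicator {z. b + c *\<^sub>R z \<in> \<Omega>} x"
      by (simp add: ennreal_mult indicator_def)
  qed
  finally show ?thesis ..
qed

lemma gagliardo_rescale:
  fixes u :: "real ^ 'n::finite \<Rightarrow> real"
  assumes c: "c \<noteq> 0"
    and [measurable]: "u \<in> borel_measurable borel" "\<Omega> \<in> sets borel"
  shows "gagliardo s {z. b + c *\<^sub>R z \<in> \<Omega>} (rescale s b c u) = gagliardo s \<Omega> u"
proof -
  define n where "n = CARD('n)"
  define \<Omega>' where "\<Omega>' = {z. b + c *\<^sub>R z \<in> \<Omega>}"
  define v where "v = rescale s b c u"
  have [measurable]: "\<Omega>' \<in> sets borel"
    unfolding \<Omega>'_def by measurable
  have [measurable]: "v \<in> borel_measurable borel" by (simp add: v_def)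
  let ?e = "\<lambda>z w. (u (b + c *\<^sub>R z) - u (b + c *\<^sub>R w))\<^sup>2 / norm ((b + c *\<^sub>R z) - (b + c *\<^sub>R w)) powr (real n + 2 * s)"
  have de: "ennreal (\<bar>c\<bar> ^ n) * difference_energy s \<Omega> u (b + c *\<^sub>R z) = difference_energy s \<Omega>' v z" for z
  proof -
    have "difference_energy s \<Omega> u (b + c *\<^sub>R z) = ennreal (\<bar>c\<bar> ^ n) *
       (\<integral>\<^sup>+w. ennreal (?e z w)
          * indicator \<Omega> (b + c *\<^sub>R w) \<partial>lborel)"
      unfolding difference_energy_def n_def by (subst nn_integral_lborel_affine[OF _ c, of _ b]) auto
    then have "ennreal (\<bar>c\<bar> ^ n) * difference_energy s \<Omega> u (b + c *\<^sub>R z) = ennreal (\<bar>c\<bar> ^ n * \<bar>c\<bar> ^ n) *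
       (\<integral>\<^sup>+w. ennreal (?e z w)
          * indicator \<Omega> (b + c *\<^sub>R w) \<partial>lborel)"
      by (simp add: ennreal_mult mult.assoc)
    also have "\<dots> = (\<integral>\<^sup>+w. ennreal (\<bar>c\<bar> ^ n * \<bar>c\<bar> ^ n) * (ennreal (?e z w)
          * indicator \<Omega> (b + c *\<^sub>R w)) \<partial>lborel)"
      by (intro nn_integral_cmult[symmetric]) auto
    also have "\<dots> = difference_energy s \<Omega>' v z"
      unfolding difference_energy_def n_def[symmetric]
    proof (intro nn_integral_cong)
      fix w
      have "norm ((b + c *\<^sub>R z) - (b + c *\<^sub>R w)) = \<bar>c\<bar> * norm (z - w)"
        by (simp add: algebra_simps flip: scaleR_diff_right norm_scaleR)
      then have "\<bar>c\<bar> ^ n * \<bar>c\<bar> ^ n * (?e z w)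
         = (\<bar>c\<bar> powr n * \<bar>c\<bar> powr n / \<bar>c\<bar> powr (real n + 2 * s)) * ((u (b + c *\<^sub>R z) - u (b + c *\<^sub>R w))\<^sup>2 / norm (z - w) powr (real n + 2 * s))"
        using c by (simp add: powr_mult powr_realpow)
      also have "\<bar>c\<bar> powr n * \<bar>c\<bar> powr n / \<bar>c\<bar> powr (real n + 2 * s) = (\<bar>c\<bar> powr (real n / 2 - s))\<^sup>2"
        using c by (simp add: powr_power powr_add[symmetric] powr_diff[symmetric])
      also have "(\<bar>c\<bar> powr (real n / 2 - s))\<^sup>2 * ((u (b + c *\<^sub>R z) - u (b + c *\<^sub>R w))\<^sup>2 / norm (z - w) powr (real n + 2 * s))
          = (v z - v w)\<^sup>2 / norm (z - w) powr (real n + 2 * s)"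
        unfolding v_def rescale_def n_def by (simp add: power_mult_distrib flip: right_diff_distrib)
      finally show "ennreal (\<bar>c\<bar> ^ n * \<bar>c\<bar> ^ n) * (ennreal (?e z w)
          * indicator \<Omega> (b + c *\<^sub>R w)) = ennreal ((v z - v w)\<^sup>2 / norm (z - w) powr (real n + 2 * s)) * indicator \<Omega>' w"
        unfolding mult.assoc[symmetric] by (subst ennreal_mult[symmetric]) (auto simp: \<Omega>'_def indicator_def)
    qed
    finally show ?thesis .
  qed
  have "gagliardo s \<Omega> u = ennreal (\<bar>c\<bar> ^ n) *
      (\<integral>\<^sup>+z. difference_energy s \<Omega> u (b + c *\<^sub>R z) * indicator \<Omega> (b + c *\<^sub>R z) \<partial>lborel)"
    unfolding gagliardo_def n_def by (subst nn_integral_lborel_affine[OF _ c, of _ b]) auto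
  also have "\<dots> = (\<integral>\<^sup>+z. ennreal (\<bar>c\<bar> ^ n) * (difference_energy s \<Omega> u (b + c *\<^sub>R z) * indicator \<Omega> (b + c *\<^sub>R z)) \<partial>lborel)"
    by (intro nn_integral_cmult[symmetric]) auto
  also have "\<dots> = gagliardo s \<Omega>' v"
    unfolding gagliardo_def
    unfolding mult.assoc[symmetric] de by (intro nn_integral_cong) (simp add: \<Omega>'_def indicator_def)
  finally show ?thesis by (simp add: v_def \<Omega>'_def)
qed

definition lower_corner :: "real \<Rightarrow> real ^ 'n::finite \<Rightarrow> real ^ 'n"
  where "lower_corner r x = (\<chi> i. r * (of_int \<lceil>x $ i / r\<rceil> - 1))"

text \<open>
  The affine map that carries the unit cube \<open>(0, 1]\<^sup>n\<close> to the cube of side \<open>r\<close> around \<open>x\<close> turns averages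
  into integrals over the unit cube, with the weight that occurs in the refined Sobolev inequality.
\<close>
lemma integral_unit_cube_rescale:
  fixes u :: "real ^ 'n::finite \<Rightarrow> real" and x :: "real ^ 'n"
  assumes r: "0 < r" and [measurable]: "u \<in> borel_measurable borel"
  shows "(LINT z:cube 1 1|lborel. rescale s (lower_corner r x) r u z) = r powr (real CARD('n) / 2 - s) * average r u x"
proof -
  define b where "b = lower_corner r x"
  have mem: "b + r *\<^sub>R z \<in> cube r x \<longleftrightarrow> z \<in> cube 1 1" for z
  proof -
    have "(b + r *\<^sub>R z) $ i / r = z $ i + of_int (\<lceil>x $ i / r\<rceil> - 1)" for i
      using r by (simp add: b_def lower_corner_def field_simps)
    then show ?thesis by (simp only: cube_def mem_Collect_eq ceiling_add_of_int) simp
  qed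
  have "(LINT y:cube r x|lborel. u y) = r ^ CARD('n) * (\<integral>z. indicator (cube r x) (b + r *\<^sub>R z) *\<^sub>R u (b + r *\<^sub>R z) \<partial>lborel)"
    unfolding set_lebesgue_integral_def using r by (subst integral_lborel_affine[of _ r b]) auto
  also have "(\<integral>z. indicator (cube r x) (b + r *\<^sub>R z) *\<^sub>R u (b + r *\<^sub>R z) \<partial>lborel) = (LINT z:cube 1 1|lborel. u (b + r *\<^sub>R z))"
    unfolding set_lebesgue_integral_def by (intro Bochner_Integration.integral_cong) (auto simp: indicator_def mem)
  finally have "(LINT z:cube 1 1|lborel. u (b + r *\<^sub>R z)) = average r u x"
    using r by (simp add: average_def)
  then show ?thesis using r by (simp add: rescale_def b_def)
qed

section \<open>Splitting off a profile\<close>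

lemma AE_lborel_pair:
  fixes P :: "'a::euclidean_space \<Rightarrow> bool" and Q :: "'b::euclidean_space \<Rightarrow> bool"
  assumes P: "AE x in lborel. P x" and Q: "AE y in lborel. Q y"
  shows "AE z in lborel \<Otimes>\<^sub>M lborel. P (fst z) \<and> Q (snd z)"
proof -
  obtain A where A: "{x\<in>space lborel. \<not> P x} \<subseteq> A" "emeasure lborel A = 0" "A \<in> sets lborel"
    using AE_E[OF P] by blast
  obtain B where B: "{x\<in>space lborel. \<not> Q x} \<subseteq> B" "emeasure lborel B = 0" "B \<in> sets lborel"
    using AE_E[OF Q] by blast
  have "A \<times> UNIV \<in> null_sets (lborel \<Otimes>\<^sub>M (lborel :: 'b measure))"
    using A by (auto simp: null_sets_def lborel.emeasure_pair_measure_Times)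
  moreover have "UNIV \<times> B \<in> null_sets ((lborel :: 'a measure) \<Otimes>\<^sub>M lborel)"
    using B by (auto simp: null_sets_def lborel.emeasure_pair_measure_Times)
  ultimately have "A \<times> UNIV \<union> UNIV \<times> B \<in> null_sets (lborel \<Otimes>\<^sub>M lborel)"
    by (rule null_sets.Un)
  then show ?thesis
    by (rule AE_I') (use A(1) B(1) in \<open>auto simp: space_pair_measure\<close>)
qed

text \<open>
  The energy is the squared \<open>L\<^sup>2\<close> norm of this function on the product space, which makes the
  Brezis-Lieb lemma with exponent 2 applicable to it.
\<close>
definition difference_quotient ::
  "real \<Rightarrow> (real ^ 'n::finite) set \<Rightarrow> (real ^ 'n \<Rightarrow> real) \<Rightarrow> (real ^ 'n) \<times> (real ^ 'n) \<Rightarrow> real"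
  where "difference_quotient s \<Omega> u z =
    indicator (\<Omega> \<times> \<Omega>) z * (u (fst z) - u (snd z)) / norm (fst z - snd z) powr (real CARD('n) / 2 + s)"

lemma measurable_difference_quotient [measurable]:
  assumes [measurable]: "u \<in> borel_measurable borel" "\<Omega> \<in> sets borel"
  shows "difference_quotient s \<Omega> u \<in> borel_measurable (borel \<Otimes>\<^sub>M borel)"
proof -
  have [measurable]: "\<Omega> \<times> \<Omega> \<in> sets (borel \<Otimes>\<^sub>M borel)" by (intro pair_measureI) auto
  show ?thesis unfolding difference_quotient_def by measurable
qed

lemma gagliardo_eq_difference_quotient:
  fixes u :: "real ^ 'n::finite \<Rightarrow> real"
  assumes [measurable]: "u \<in> borel_measurable borel" "\<Omega> \<in> sets borel"
  shows "gagliardo s \<Omega> u = (\<integral>\<^sup>+z. ennreal (\<bar>difference_quotient s \<Omega> u z\<bar> powr 2) \<partial>(lborel \<Otimes>\<^sub>M lborel))"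
proof -
  have "(\<integral>\<^sup>+z. ennreal (\<bar>difference_quotient s \<Omega> u z\<bar> powr 2) \<partial>(lborel \<Otimes>\<^sub>M lborel))
     = (\<integral>\<^sup>+x. \<integral>\<^sup>+y. ennreal (\<bar>difference_quotient s \<Omega> u (x, y)\<bar> powr 2) \<partial>lborel \<partial>lborel)"
    by (rule lborel.nn_integral_fst[symmetric]) measurable
  also have "\<dots> = (\<integral>\<^sup>+x. \<integral>\<^sup>+y. ennreal ((u x - u y)\<^sup>2 / norm (x - y) powr (real CARD('n) + 2 * s)) * indicator \<Omega> y * indicator \<Omega> x \<partial>lborel \<partial>lborel)"
  proof (intro nn_integral_cong)
    fix x y :: "real ^ 'n"
    have "(norm (x - y) powr (real CARD('n) / 2 + s))\<^sup>2 = norm (x - y) powr (real CARD('n) + 2 * s)"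
      by (simp add: power2_eq_square powr_add[symmetric])
    then show "ennreal (\<bar>difference_quotient s \<Omega> u (x, y)\<bar> powr 2) =
        ennreal ((u x - u y)\<^sup>2 / norm (x - y) powr (real CARD('n) + 2 * s)) * indicator \<Omega> y * indicator \<Omega> x"
      by (auto simp: difference_quotient_def indicator_def power_divide)
  qed
  also have "\<dots> = gagliardo s \<Omega> u"
    unfolding gagliardo_def difference_energy_def
    by (intro nn_integral_cong nn_integral_multc) auto
  finally show ?thesis ..
qed

lemma mass_eq_integral:
  assumes [measurable]: "u \<in> borel_measurable borel" "\<Omega> \<in> sets borel"
  shows "mass p \<Omega> u = (\<integral>\<^sup>+x. ennreal (\<bar>indicator \<Omega> x * u x\<bar> powr p) \<partial>lborel)"
  unfolding mass_def by (intro nn_integral_cong) (auto simp: indicator_def)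

text \<open>
  The Brezis-Lieb lemma is applied twice: with exponent \<open>p\<close> to the functions, which gives mass
  \<open>1 - a\<close> for the remainder \<open>v\<^sub>j - w\<close> in the limit, and with exponent 2 to the difference quotients,
  which gives energy at most \<open>L - E(w)\<close> for the remainder. The Sobolev inequality on \<open>\<Omega>s j\<close>, applied to
  the remainder, compares the two. The domains may grow with \<open>j\<close>, since a half-space that is blown up
  around interior points exhausts the whole space.
\<close>
lemma profile_splitting:
  fixes v :: "nat \<Rightarrow> real ^ 'n::finite \<Rightarrow> real" and w :: "real ^ 'n \<Rightarrow> real"
    and \<Omega>s :: "nat \<Rightarrow> (real ^ 'n) set" and \<Omega> :: "(real ^ 'n) set" and e :: "nat \<Rightarrow> real" and L p :: real
  assumes p: "0 < p"
    and v[measurable]: "\<And>j. v j \<in> borel_measurable borel" and w[measurable]: "w \<in> borel_measurable borel"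
    and \<Omega>s[measurable]: "\<And>j. \<Omega>s j \<in> sets borel" and \<Omega>[measurable]: "\<Omega> \<in> sets borel"
    and sub: "\<And>j. \<Omega>s j \<subseteq> \<Omega>"
    and ev: "\<And>x. x \<in> \<Omega> \<Longrightarrow> eventually (\<lambda>j. x \<in> \<Omega>s j) sequentially"
    and m1: "\<And>j. mass p (\<Omega>s j) (v j) = 1"
    and e0: "\<And>j. 0 \<le> e j" and e: "\<And>j. gagliardo s (\<Omega>s j) (v j) = ennreal (e j)" and eL: "e \<longlonglongrightarrow> L"
    and ae: "AE x in lborel. (\<lambda>j. v j x) \<longlonglongrightarrow> w x"
    and sob: "\<And>j f. f \<in> borel_measurable borel \<Longrightarrow> mass p (\<Omega>s j) f < \<infinity> \<Longrightarrow> gagliardo s (\<Omega>s j) f < \<infinity> \<Longrightarrow>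
        L * enn2real (mass p (\<Omega>s j) f) powr (2 / p) \<le> enn2real (gagliardo s (\<Omega>s j) f)"
  shows "mass p \<Omega> w \<le> 1" and "gagliardo s \<Omega> w < \<infinity>"
    and "enn2real (gagliardo s \<Omega> w) + L * (1 - enn2real (mass p \<Omega> w)) powr (2 / p) \<le> L"
proof -
  have e_bdd: "\<exists>K. \<forall>j. e j \<le> K"
    using convergent_imp_Bseq[OF convergentI[OF eL]] by (auto simp: Bseq_def abs_le_iff)
  then obtain K where K: "\<And>j. e j \<le> K" by blast
  define f where "f j x = indicator (\<Omega>s j) x * v j x" for j x
  define g where "g x = indicator \<Omega> x * w x" for x
  have [measurable]: "f j \<in> borel_measurable borel" "g \<in> borel_measurable borel" for j
    unfolding f_def g_def by measurable
  have ind: "(\<lambda>j. indicator (\<Omega>s j) x :: real) \<longlonglongrightarrow> indicator \<Omega> x" for x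
  proof (rule tendsto_eventually)
    show "\<forall>\<^sub>F j in sequentially. (indicator (\<Omega>s j) x :: real) = indicator \<Omega> x"
    proof (cases "x \<in> \<Omega>")
      case True
      then show ?thesis using ev[OF True] by (auto elim: eventually_mono simp: indicator_def)
    next
      case False
      then show ?thesis using sub by (intro always_eventually) (auto simp: indicator_def)
    qed
  qed
  have fg: "AE x in lborel. (\<lambda>j. f j x) \<longlonglongrightarrow> g x"
    using ae by eventually_elim (auto simp: f_def g_def intro!: tendsto_mult ind)
  have fm: "(\<integral>\<^sup>+x. ennreal (\<bar>f j x\<bar> powr p) \<partial>lborel) = 1" for j
    using m1[of j] unfolding f_def by (subst (asm) mass_eq_integral) auto
  have gm: "mass p \<Omega> w = (\<integral>\<^sup>+x. ennreal (\<bar>g x\<bar> powr p) \<partial>lborel)"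
    unfolding g_def by (rule mass_eq_integral) auto
  have "(\<integral>\<^sup>+x. ennreal (\<bar>f j x\<bar> powr p) \<partial>lborel) \<le> ennreal 1" for j by (simp add: fm)
  note bl = brezis_lieb[OF p _ _ this fg, simplified]
  define a where "a = enn2real (mass p \<Omega> w)"
  have ag: "a = (LINT x|lborel. \<bar>g x\<bar> powr p)"
    unfolding a_def gm by (subst nn_integral_eq_integral[OF bl(2)]) auto
  have ma: "mass p \<Omega> w = ennreal a"
    unfolding ag gm by (rule nn_integral_eq_integral[OF bl(2)]) auto
  have a0: "a \<ge> 0" by (simp add: a_def)
  have f1: "(LINT x|lborel. \<bar>f j x\<bar> powr p) = 1" for j
    using fm[of j] nn_integral_eq_integral[OF bl(1)[of j]] by simp
  have dl: "(\<lambda>j. LINT x|lborel. \<bar>f j x - g x\<bar> powr p) \<longlonglongrightarrow> 1 - a"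
    using tendsto_diff[OF tendsto_const[of 1] bl(4)] by (simp add: f1 ag)
  have a1: "a \<le> 1"
    using LIMSEQ_le_const[OF dl, of 0] by auto
  show "mass p \<Omega> w \<le> 1" using a1 by (simp add: ma)
  \<comment> \<open>The mass of the profile outside the \<open>j\<close>-th domain, which tends to \<open>0\<close>.\<close>
  define h where "h j x = (indicator \<Omega> x - indicator (\<Omega>s j) x) * \<bar>g x\<bar> powr p" for j x
  have [measurable]: "h j \<in> borel_measurable borel" for j unfolding h_def by measurable
  have hb: "\<bar>h j x\<bar> \<le> \<bar>g x\<bar> powr p" for j x
    using sub[of j] by (auto simp: h_def indicator_def)
  have ih: "integrable lborel (h j)" for j
    by (rule Bochner_Integration.integrable_bound[OF bl(2)]) (use hb in auto)
  have h0: "(\<lambda>j. LINT x|lborel. h j x) \<longlonglongrightarrow> (LINT x|(lborel :: (real ^ 'n) measure). (0::real))"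
  proof (rule integral_dominated_convergence[where w = "\<lambda>x. \<bar>g x\<bar> powr p"])
    show "AE x in lborel. (\<lambda>j. h j x) \<longlonglongrightarrow> 0"
    proof (intro always_eventually allI)
      fix x
      have "(\<lambda>j. h j x) \<longlonglongrightarrow> (indicator \<Omega> x - indicator \<Omega> x) * \<bar>g x\<bar> powr p"
        unfolding h_def by (intro tendsto_intros ind)
      then show "(\<lambda>j. h j x) \<longlonglongrightarrow> 0" by simp
    qed
  qed (use bl(2) hb in auto)
  define d where "d j x = v j x - w x" for j x
  have [measurable]: "d j \<in> borel_measurable borel" for j unfolding d_def by measurable
  have deq: "\<bar>indicator (\<Omega>s j) x * d j x\<bar> powr p = \<bar>f j x - g x\<bar> powr p - h j x" for j x
    using sub[of j] by (auto simp: d_def f_def g_def h_def indicator_def)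
  have id: "integrable lborel (\<lambda>x. \<bar>indicator (\<Omega>s j) x * d j x\<bar> powr p)" for j
    unfolding deq by (intro Bochner_Integration.integrable_diff bl(3) ih)
  have md: "mass p (\<Omega>s j) (d j) = ennreal (LINT x|lborel. \<bar>indicator (\<Omega>s j) x * d j x\<bar> powr p)" for j
    by (subst mass_eq_integral) (auto intro!: nn_integral_eq_integral id)
  define m where "m j = enn2real (mass p (\<Omega>s j) (d j))" for j
  have "m j = (LINT x|lborel. \<bar>f j x - g x\<bar> powr p) - (LINT x|lborel. h j x)" for j
  proof -
    have "m j = (LINT x|lborel. \<bar>indicator (\<Omega>s j) x * d j x\<bar> powr p)"
      unfolding m_def md by (intro enn2real_ennreal Bochner_Integration.integral_nonneg) simp
    also have "\<dots> = (LINT x|lborel. \<bar>f j x - g x\<bar> powr p) - (LINT x|lborel. h j x)"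
      unfolding deq by (rule Bochner_Integration.integral_diff[OF bl(3) ih])
    finally show ?thesis .
  qed
  then have "m = (\<lambda>j. (LINT x|lborel. \<bar>f j x - g x\<bar> powr p) - (LINT x|lborel. h j x))" by blast
  then have ml: "m \<longlonglongrightarrow> 1 - a"
    using tendsto_diff[OF dl h0] by simp
  define F where "F j = difference_quotient s (\<Omega>s j) (v j)" for j
  define G where "G = difference_quotient s \<Omega> w"
  have [measurable]: "F j \<in> borel_measurable (borel \<Otimes>\<^sub>M borel)" "G \<in> borel_measurable (borel \<Otimes>\<^sub>M borel)" for j
    unfolding F_def G_def by measurable
  have FG: "AE z in lborel \<Otimes>\<^sub>M lborel. (\<lambda>j. F j z) \<longlonglongrightarrow> G z"
    using AE_lborel_pair[OF ae ae]
  proof eventually_elim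
    case (elim z)
    have i2: "indicator (A \<times> A) z = (indicator A (fst z) * indicator A (snd z) :: real)" for A :: "(real ^ 'n) set"
      by (cases z) (auto simp: indicator_def)
    show ?case
    proof (cases "fst z = snd z")
      case True
      then show ?thesis by (simp add: F_def G_def difference_quotient_def)
    next
      case False
      then show ?thesis unfolding F_def G_def difference_quotient_def i2
        using elim by (intro tendsto_intros ind) auto
    qed
  qed
  have Fe: "(\<integral>\<^sup>+z. ennreal (\<bar>F j z\<bar> powr 2) \<partial>(lborel \<Otimes>\<^sub>M lborel)) = ennreal (e j)" for j
    unfolding F_def by (subst gagliardo_eq_difference_quotient[symmetric]) (auto simp: e)
  have FK: "(\<integral>\<^sup>+z. ennreal (\<bar>F j z\<bar> powr 2) \<partial>(lborel \<Otimes>\<^sub>M lborel)) \<le> ennreal K" for j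
    unfolding Fe by (intro ennreal_leI K)
  have Fm: "F j \<in> borel_measurable (lborel \<Otimes>\<^sub>M lborel)" "G \<in> borel_measurable (lborel \<Otimes>\<^sub>M lborel)" for j
    by measurable
  note bl2 = brezis_lieb[where q = 2, OF _ Fm(1) Fm(2) FK FG]
  have gw: "gagliardo s \<Omega> w = ennreal (LINT z|(lborel \<Otimes>\<^sub>M lborel). \<bar>G z\<bar> powr 2)"
    by (subst gagliardo_eq_difference_quotient)
      (use bl2(2) in \<open>auto simp: G_def[symmetric] intro!: nn_integral_eq_integral\<close>)
  show gfin: "gagliardo s \<Omega> w < \<infinity>" by (simp add: gw)
  define E where "E = enn2real (gagliardo s \<Omega> w)"
  have EG: "E = (LINT z|(lborel \<Otimes>\<^sub>M lborel). \<bar>G z\<bar> powr 2)" by (simp add: E_def gw)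
  have Fe': "(LINT z|(lborel \<Otimes>\<^sub>M lborel). \<bar>F j z\<bar> powr 2) = e j" for j
    using Fe[of j] e0[of j] by (subst (asm) nn_integral_eq_integral) (use bl2(1) in auto)
  let ?R = "\<lambda>j. LINT z|(lborel \<Otimes>\<^sub>M lborel). \<bar>F j z - G z\<bar> powr 2"
  have "(\<lambda>j. e j - ?R j) \<longlonglongrightarrow> E"
    using bl2(4) unfolding Fe' EG by simp
  from tendsto_diff[OF eL this]
  have dF: "(\<lambda>j. ?R j) \<longlonglongrightarrow> L - E" by simp
  have le: "L * m j powr (2 / p) \<le> ?R j" for j
  proof -
    have "gagliardo s (\<Omega>s j) (d j) \<le> (\<integral>\<^sup>+z. ennreal (\<bar>F j z - G z\<bar> powr 2) \<partial>(lborel \<Otimes>\<^sub>M lborel))"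
    proof (subst gagliardo_eq_difference_quotient; (intro nn_integral_mono ennreal_leI)?)
      fix z :: "(real ^ 'n) \<times> (real ^ 'n)"
      show "\<bar>difference_quotient s (\<Omega>s j) (d j) z\<bar> powr 2 \<le> \<bar>F j z - G z\<bar> powr 2"
      proof (cases "z \<in> \<Omega>s j \<times> \<Omega>s j")
        case True
        then have "z \<in> \<Omega> \<times> \<Omega>" using sub by (auto simp: mem_Times_iff)
        then have "difference_quotient s (\<Omega>s j) (d j) z = F j z - G z"
          using True by (simp add: difference_quotient_def F_def G_def d_def diff_divide_distrib)
        then show ?thesis by simp
      qed (simp add: difference_quotient_def)
    qed auto
    also have "\<dots> = ennreal (?R j)"
      by (rule nn_integral_eq_integral) (use bl2(3) in auto)
    finally have *: "gagliardo s (\<Omega>s j) (d j) \<le> ennreal (?R j)" .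
    have "gagliardo s (\<Omega>s j) (d j) < \<infinity>" using order.strict_trans1[OF *] by simp
    from sob[OF _ _ this] have "L * m j powr (2 / p) \<le> enn2real (gagliardo s (\<Omega>s j) (d j))"
      by (simp add: md m_def)
    also have "\<dots> \<le> ?R j"
      using enn2real_mono[OF *] by simp
    finally show ?thesis .
  qed
  have "(\<lambda>j. L * m j powr (2 / p)) \<longlonglongrightarrow> L * (1 - a) powr (2 / p)"
    by (intro tendsto_intros tendsto_powr' ml) (use p in \<open>auto simp: m_def\<close>)
  from LIMSEQ_le[OF this dF] le have "L * (1 - a) powr (2 / p) \<le> L - E" by blast
  then show "enn2real (gagliardo s \<Omega> w) + L * (1 - enn2real (mass p \<Omega> w)) powr (2 / p) \<le> L"
    by (simp add: E_def a_def)
qed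

section \<open>Local compactness\<close>

text \<open>
  Along a fast subsequence the squared increments, weighted by \<open>2 ^ l\<close>, have a finite integral of their
  sum. At almost every point the increments then decay geometrically.
\<close>
lemma AE_convergent_subsequence_of_Cauchy_L2:
  fixes v :: "nat \<Rightarrow> 'a \<Rightarrow> real" and B :: "nat \<Rightarrow> 'a set"
  assumes v[measurable]: "\<And>j. v j \<in> borel_measurable M" and B[measurable]: "\<And>l. B l \<in> sets M"
    and inc: "incseq B" and un: "(\<Union>l. B l) = space M"
    and cauchy: "\<And>l \<epsilon>. 0 < \<epsilon> \<Longrightarrow> \<exists>N. \<forall>i\<ge>N. \<forall>j\<ge>N. (\<integral>\<^sup>+x\<in>B l. ennreal ((v i x - v j x)\<^sup>2) \<partial>M) \<le> ennreal \<epsilon>"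
  shows "\<exists>r. strict_mono (r :: nat \<Rightarrow> nat) \<and> (AE x in M. convergent (\<lambda>j. v (r j) x))"
proof -
  have "\<exists>N. \<forall>i\<ge>N. \<forall>j\<ge>N. (\<integral>\<^sup>+x\<in>B l. ennreal ((v i x - v j x)\<^sup>2) \<partial>M) \<le> ennreal ((1 / 4) ^ l)" for l
    by (rule cauchy) simp
  then obtain N where N: "\<And>l i j. i \<ge> N l \<Longrightarrow> j \<ge> N l \<Longrightarrow>
      (\<integral>\<^sup>+x\<in>B l. ennreal ((v i x - v j x)\<^sup>2) \<partial>M) \<le> ennreal ((1 / 4) ^ l)"
    by metis
  \<comment> \<open>The sum dominates \<open>N l\<close>, and the summand \<open>l\<close> makes the indices strictly increasing.\<close>
  define r where "r l = l + (\<Sum>i\<le>l. N i)" for l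
  have r: "strict_mono r" by (rule strict_mono_Suc_iff[THEN iffD2]) (simp add: r_def)
  have rN: "N l \<le> r l" for l
  proof -
    have "N l \<le> (\<Sum>i\<le>l. N i)" by (rule member_le_sum) auto
    then show ?thesis by (simp add: r_def)
  qed
  have rN': "N l \<le> r (Suc l)" for l
    using rN[of l] strict_mono_less[OF r, of l "Suc l"] by simp
  define q where "q l x = ennreal (2 ^ l) * (ennreal ((v (r (Suc l)) x - v (r l) x)\<^sup>2) * indicator (B l) x)" for l x
  have [measurable]: "q l \<in> borel_measurable M" for l unfolding q_def by measurable
  have "(\<integral>\<^sup>+x. (\<Sum>l. q l x) \<partial>M) = (\<Sum>l. \<integral>\<^sup>+x. q l x \<partial>M)"
    by (rule nn_integral_suminf) auto
  also have "\<dots> \<le> (\<Sum>l. ennreal ((1 / 2) ^ l))"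
  proof (intro suminf_le)
    fix l
    have "(\<integral>\<^sup>+x. q l x \<partial>M) = ennreal (2 ^ l) * (\<integral>\<^sup>+x\<in>B l. ennreal ((v (r (Suc l)) x - v (r l) x)\<^sup>2) \<partial>M)"
      unfolding q_def by (rule nn_integral_cmult) auto
    also have "\<dots> \<le> ennreal (2 ^ l) * ennreal ((1 / 4) ^ l)"
      by (intro mult_left_mono N rN rN') auto
    also have "\<dots> = ennreal ((1 / 2) ^ l)"
      by (subst ennreal_mult[symmetric]) (auto simp flip: power_mult_distrib)
    finally show "(\<integral>\<^sup>+x. q l x \<partial>M) \<le> ennreal ((1 / 2) ^ l)" .
  qed auto
  also have "\<dots> = ennreal 2"
    by (subst suminf_ennreal_eq[of _ 2]) (use geometric_sums[of "1/2::real"] in auto)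
  finally have "(\<integral>\<^sup>+x. (\<Sum>l. q l x) \<partial>M) \<noteq> \<infinity>" by (auto simp: top_unique)
  then have "AE x in M. (\<Sum>l. q l x) \<noteq> \<infinity>" by (intro nn_integral_PInf_AE) auto
  then have "AE x in M. convergent (\<lambda>j. v (r j) x)"
  proof (rule AE_mp, intro AE_I2 impI)
    fix x assume x: "x \<in> space M" and fin: "(\<Sum>l. q l x) \<noteq> \<infinity>"
    define c where "c = enn2real (\<Sum>l. q l x)"
    have c: "(\<Sum>l. q l x) = ennreal c" using fin by (simp add: c_def less_top)
    have c0: "c \<ge> 0" by (simp add: c_def)
    obtain l0 where l0: "x \<in> B l0" using x un by auto
    have xB: "x \<in> B l" if "l \<ge> l0" for l using l0 incseqD[OF inc that] by auto
    define t where "t l = v (r (Suc l)) x - v (r l) x" for l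
    have tb: "norm (t l) \<le> sqrt c * (sqrt (1 / 2)) ^ l" if "l \<ge> l0" for l
    proof -
      have "q l x \<le> (\<Sum>l. q l x)"
        using sum_le_suminf[of "\<lambda>l. q l x" "{l}"] by simp
      then have "ennreal (2 ^ l * (t l)\<^sup>2) \<le> ennreal c"
        unfolding c using xB[OF that] by (simp add: q_def t_def ennreal_mult)
      then have "2 ^ l * (t l)\<^sup>2 \<le> c" using c0 by simp
      then have "(t l)\<^sup>2 \<le> c * (1 / 2) ^ l" by (simp add: field_simps power_one_over)
      then have "sqrt ((t l)\<^sup>2) \<le> sqrt (c * (1 / 2) ^ l)" by (rule real_sqrt_le_mono)
      then show ?thesis unfolding real_sqrt_abs by (simp add: real_sqrt_mult real_sqrt_power)
    qed
    have "summable t"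
    proof (rule summable_comparison_test')
      show "summable (\<lambda>l. sqrt c * (sqrt (1 / 2)) ^ l)"
        by (intro summable_mult summable_geometric) (auto simp: real_sqrt_lt_1_iff)
    qed (use tb in auto)
    then have "(\<lambda>n. \<Sum>l<n. t l) \<longlonglongrightarrow> suminf t" by (rule summable_LIMSEQ)
    moreover have "(\<Sum>l<n. t l) = v (r n) x - v (r 0) x" for n
      unfolding t_def by (rule sum_lessThan_telescope)
    ultimately have "(\<lambda>n. v (r n) x - v (r 0) x) \<longlonglongrightarrow> suminf t" by simp
    from tendsto_add[OF this tendsto_const[of "v (r 0) x"]]
    show "convergent (\<lambda>j. v (r j) x)" by (auto simp: convergent_def)
  qed
  with r show ?thesis by blast
qed

lemma measurable_average [measurable]:
  assumes [measurable]: "u \<in> borel_measurable borel"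
  shows "average r u \<in> borel_measurable borel"
proof -
  have eq: "indicator (cube r x) y = (if snd (x, y) \<in> cube r (fst (x, y)) then 1 else (0::real))" for x y :: "real^'a"
    by (simp add: indicator_def)
  have "(\<lambda>x. LINT y|lborel. (if snd (x, y) \<in> cube r (fst (x, y)) then 1 else 0) *\<^sub>R u y) \<in> borel_measurable borel"
    by (rule lborel.borel_measurable_lebesgue_integral) measurable
  then show ?thesis
    unfolding average_def[abs_def] set_lebesgue_integral_def eq by measurable
qed

lemma square_diff_le:
  fixes a b c :: real
  shows "(a - b)\<^sup>2 \<le> 2 * (a - c)\<^sup>2 + 2 * (c - b)\<^sup>2"
proof -
  have "0 \<le> ((a - c) - (c - b))\<^sup>2" by simp
  then show ?thesis by (simp add: power2_eq_square algebra_simps)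
qed

lemma nn_integral_square_diff_le:
  fixes a b c :: "'a \<Rightarrow> real"
  assumes [measurable]: "a \<in> borel_measurable M" "b \<in> borel_measurable M" "c \<in> borel_measurable M" "B \<in> sets M"
  shows "(\<integral>\<^sup>+x\<in>B. ennreal ((a x - b x)\<^sup>2) \<partial>M)
    \<le> 2 * (\<integral>\<^sup>+x\<in>B. ennreal ((a x - c x)\<^sup>2) \<partial>M) + 2 * (\<integral>\<^sup>+x\<in>B. ennreal ((c x - b x)\<^sup>2) \<partial>M)"
proof -
  have "(\<integral>\<^sup>+x\<in>B. ennreal ((a x - b x)\<^sup>2) \<partial>M)
     \<le> (\<integral>\<^sup>+x. 2 * (ennreal ((a x - c x)\<^sup>2) * indicator B x) + 2 * (ennreal ((c x - b x)\<^sup>2) * indicator B x) \<partial>M)"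
  proof (intro nn_integral_mono)
    fix x
    have "ennreal ((a x - b x)\<^sup>2) \<le> ennreal (2 * (a x - c x)\<^sup>2 + 2 * (c x - b x)\<^sup>2)"
      by (intro ennreal_leI square_diff_le)
    also have "\<dots> = 2 * ennreal ((a x - c x)\<^sup>2) + 2 * ennreal ((c x - b x)\<^sup>2)"
      by (simp add: ennreal_plus ennreal_mult)
    finally show "ennreal ((a x - b x)\<^sup>2) * indicator B x \<le>
        2 * (ennreal ((a x - c x)\<^sup>2) * indicator B x) + 2 * (ennreal ((c x - b x)\<^sup>2) * indicator B x)"
      by (simp add: indicator_def)
  qed
  also have "\<dots> = 2 * (\<integral>\<^sup>+x\<in>B. ennreal ((a x - c x)\<^sup>2) \<partial>M) + 2 * (\<integral>\<^sup>+x\<in>B. ennreal ((c x - b x)\<^sup>2) \<partial>M)"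
    by (subst nn_integral_add) (auto simp: nn_integral_cmult)
  finally show ?thesis .
qed

lemma mass_le_if_vanishing_off:
  assumes "\<And>x. x \<in> \<Omega>' \<Longrightarrow> x \<notin> \<Omega> \<Longrightarrow> u x = 0"
  shows "mass p \<Omega>' u \<le> mass p \<Omega> u"
  unfolding mass_def using assms by (intro nn_integral_mono) (auto simp: indicator_def)

text \<open>
  Off \<open>\<Omega>\<close> both functions vanish, because a cube that meets a saturated set is contained in it. This is
  why saturated sets cause no error at the boundary.
\<close>
lemma L2_distance_average_le:
  fixes u :: "real ^ 'n::finite \<Rightarrow> real"
  assumes s: "0 < s" and p: "1 \<le> p" and u[measurable]: "u \<in> borel_measurable borel"
    and \<Omega>[measurable]: "\<Omega> \<in> sets borel" and sat: "cube_saturated r \<Omega>" and r: "0 < r"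
    and off: "\<And>x. x \<notin> \<Omega> \<Longrightarrow> u x = 0" and m: "mass p \<Omega> u < \<infinity>"
  shows "(\<integral>\<^sup>+x. ennreal ((u x - average r u x)\<^sup>2) \<partial>lborel)
    \<le> ennreal (real CARD('n) powr (real CARD('n) + 2 * s) * r powr (2 * s)) * gagliardo s \<Omega> u"
proof -
  define c where "c = real CARD('n) powr (real CARD('n) + 2 * s) * r powr (2 * s)"
  have "(\<integral>\<^sup>+x. ennreal ((u x - average r u x)\<^sup>2) \<partial>lborel)
      \<le> (\<integral>\<^sup>+x. ennreal c * (difference_energy s \<Omega> u x * indicator \<Omega> x) \<partial>lborel)"
  proof (intro nn_integral_mono)
    fix x
    show "ennreal ((u x - average r u x)\<^sup>2) \<le> ennreal c * (difference_energy s \<Omega> u x * indicator \<Omega> x)"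
    proof (cases "x \<in> \<Omega>")
      case True
      then have A: "cube r x \<subseteq> \<Omega>" using sat by (auto simp: cube_saturated_def)
      have "set_integrable lborel (cube r x) u"
        by (rule set_integrable_if_mass_finite(1)[OF p u \<Omega> _ m A]) (simp_all add: emeasure_cube[OF r])
      from oscillation_le_difference_energy[OF s u \<Omega> this r A] True
      show ?thesis by (simp add: c_def)
    next
      case False
      have "y \<notin> \<Omega>" if "y \<in> cube r x" for y
        using sat False mem_cube_self[of x r] cube_eq[OF that] unfolding cube_saturated_def by blast
      then have z: "indicator (cube r x) y *\<^sub>R u y = 0" for y
        by (auto simp: indicator_def off)
      have "average r u x = 0" unfolding average_def set_lebesgue_integral_def z by simp
      then show ?thesis using False off by simp
    qed
  qed
  also have "\<dots> = ennreal c * gagliardo s \<Omega> u"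
    unfolding gagliardo_def by (rule nn_integral_cmult) auto
  finally show ?thesis by (simp add: c_def)
qed

text \<open>
  At each scale \<open>1 / (k + 1)\<close> there are countably many cubes, and the averages over them are bounded
  uniformly in \<open>j\<close>, so a diagonal argument applies.
\<close>
lemma subsequence_convergent_averages:
  fixes v :: "nat \<Rightarrow> real ^ 'n::finite \<Rightarrow> real"
  assumes p: "1 \<le> p" and v[measurable]: "\<And>j. v j \<in> borel_measurable borel"
    and m: "\<And>j. mass p UNIV (v j) \<le> 1"
  obtains r :: "nat \<Rightarrow> nat" where "strict_mono r"
    "\<And>k x. convergent (\<lambda>j. average (1 / real (Suc k)) (v (r j)) x)"
proof -
  define T where "T k = 2 * (1 / real (Suc k)) powr (- (real CARD('n) / p))" for k
  have T: "T k > 0" for k by (simp add: T_def)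
  \<comment> \<open>The right endpoints of the cells serve as representatives of the countably many cubes.\<close>
  define \<xi> where "\<xi> k q = (\<chi> i. of_int (q $ i) / real (Suc k))" for k and q :: "int ^ 'n"
  define f where "f j kq = average (1 / real (Suc (fst kq))) (v j) (\<xi> (fst kq) (snd kq)) / T (fst kq)" for j kq
  have b: "norm (f j kq) \<le> 1" for j kq
  proof -
    have "\<bar>average (1 / real (Suc (fst kq))) (v j) (\<xi> (fst kq) (snd kq))\<bar> \<le> T (fst kq)"
      unfolding T_def by (rule average_bound[OF p v _ m]) auto
    then show ?thesis using T[of "fst kq"] by (simp add: f_def abs_divide)
  qed
  obtain r where r: "strict_mono (r :: nat \<Rightarrow> nat)"
    and c: "\<And>kq. kq \<in> UNIV \<Longrightarrow> \<exists>l. (\<lambda>j. f (r j) kq) \<longlonglongrightarrow> l"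
    by (rule function_convergent_subsequence[of "UNIV :: (nat \<times> (int ^ 'n)) set" f 1, OF countableI_type b])
      (rule that)
  have "convergent (\<lambda>j. average (1 / real (Suc k)) (v (r j)) x)" for k x
  proof -
    define q :: "int ^ 'n" where "q = (\<chi> i. \<lceil>x $ i / (1 / real (Suc k))\<rceil>)"
    have "\<xi> k q \<in> cube (1 / real (Suc k)) x"
      by (simp add: cube_def \<xi>_def q_def)
    from cube_eq[OF this] have eq: "average (1 / real (Suc k)) u x = average (1 / real (Suc k)) u (\<xi> k q)" for u
      by (simp add: average_def)
    obtain l where "(\<lambda>j. f (r j) (k, q)) \<longlonglongrightarrow> l" using c by blast
    from tendsto_mult[OF this tendsto_const[of "T k"]]
    have "(\<lambda>j. average (1 / real (Suc k)) (v (r j)) x) \<longlonglongrightarrow> l * T k"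
      using T[of k] unfolding eq by (simp add: f_def)
    then show ?thesis by (rule convergentI)
  qed
  with r show ?thesis by (rule that)
qed

text \<open>
  A fractional Rellich theorem. The averages at a fixed small scale converge pointwise along a
  subsequence, hence in \<open>L\<^sup>2\<close> on balls by dominated convergence; the functions differ from their
  averages by a small amount in \<open>L\<^sup>2\<close>, uniformly in \<open>j\<close>. So the subsequence is Cauchy in \<open>L\<^sup>2\<close> on balls.
\<close>
lemma gagliardo_compactness:
  fixes v :: "nat \<Rightarrow> real ^ 'n::finite \<Rightarrow> real" and \<Omega>s :: "nat \<Rightarrow> (real ^ 'n) set" and K p s :: real
  assumes s: "0 < s" and p: "1 \<le> p"
    and v[measurable]: "\<And>j. v j \<in> borel_measurable borel"
    and \<Omega>[measurable]: "\<And>j. \<Omega>s j \<in> sets borel"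
    and sat: "\<And>k j. cube_saturated (1 / real (Suc k)) (\<Omega>s j)"
    and off: "\<And>j x. x \<notin> \<Omega>s j \<Longrightarrow> v j x = 0"
    and m: "\<And>j. mass p (\<Omega>s j) (v j) \<le> 1"
    and K: "\<And>j. gagliardo s (\<Omega>s j) (v j) \<le> ennreal K"
  obtains r :: "nat \<Rightarrow> nat" and w where "strict_mono r" "w \<in> borel_measurable borel"
    "AE x in lborel. (\<lambda>j. v (r j) x) \<longlonglongrightarrow> w x"
    "\<And>l \<epsilon>. 0 < \<epsilon> \<Longrightarrow> \<forall>\<^sub>F j in sequentially. (\<integral>\<^sup>+x\<in>cball 0 (real l). ennreal ((v (r j) x - w x)\<^sup>2) \<partial>lborel) \<le> ennreal \<epsilon>"
proof -
  have mU: "mass p UNIV (v j) \<le> 1" for j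
    using mass_le_if_vanishing_off[of UNIV "\<Omega>s j" "v j" p] off m[of j] by (meson order.trans)
  obtain r1 where r1: "strict_mono (r1 :: nat \<Rightarrow> nat)"
    and cv: "\<And>k x. convergent (\<lambda>j. average (1 / real (Suc k)) (v (r1 j)) x)"
    by (rule subsequence_convergent_averages[OF p v mU]) (rule that)
  define B :: "nat \<Rightarrow> (real ^ 'n) set" where "B l = cball 0 (real l)" for l
  have [measurable]: "B l \<in> sets borel" for l by (simp add: B_def)
  have Bfin: "emeasure lborel (B l) < \<infinity>" for l
    unfolding B_def by (rule emeasure_bounded_finite) simp
  let ?D = "\<lambda>l f g. (\<integral>\<^sup>+x\<in>B l. ennreal ((f x - g x)\<^sup>2) \<partial>lborel)"
  define V where "V j = v (r1 j)" for j
  have [measurable]: "V j \<in> borel_measurable borel" for j by (simp add: V_def)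
  define N where "N = real CARD('n)"
  have lim0: "(\<lambda>k. N powr (N + 2 * s) * (1 / real (Suc k)) powr (2 * s) * max K 0) \<longlonglongrightarrow> 0"
  proof -
    have "(\<lambda>k. (1 / real (Suc k)) powr (2 * s)) \<longlonglongrightarrow> 0 powr (2 * s)"
      by (rule tendsto_powr'[OF LIMSEQ_Suc[OF lim_1_over_n] tendsto_const]) (use s in auto)
    then have "(\<lambda>k. (1 / real (Suc k)) powr (2 * s)) \<longlonglongrightarrow> 0" using s by simp
    from tendsto_mult[OF tendsto_mult[OF tendsto_const this] tendsto_const]
    show ?thesis by simp
  qed
  have approx: "\<exists>h N. h \<in> borel_measurable borel \<and> (\<forall>i\<ge>N. ?D l (V i) h \<le> ennreal \<epsilon>)"
    if eps: "0 < \<epsilon>" for l \<epsilon>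
  proof -
    have "eventually (\<lambda>k. N powr (N + 2 * s) * (1 / real (Suc k)) powr (2 * s) * max K 0 < \<epsilon> / 4) sequentially"
      by (rule order_tendstoD(2)[OF lim0]) (use eps in simp)
    then obtain k where k: "N powr (N + 2 * s) * (1 / real (Suc k)) powr (2 * s) * max K 0 < \<epsilon> / 4"
      by (auto simp: eventually_sequentially)
    define \<rho> where "\<rho> = 1 / real (Suc k)"
    have \<rho>: "\<rho> > 0" by (simp add: \<rho>_def)
    define h where "h x = lim (\<lambda>j. average \<rho> (V j) x)" for x
    have hm[measurable]: "h \<in> borel_measurable borel" unfolding h_def by measurable
    have hl: "(\<lambda>j. average \<rho> (V j) x) \<longlonglongrightarrow> h x" for x
      unfolding h_def using cv[of k x] by (simp add: convergent_LIMSEQ_iff \<rho>_def V_def)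
    define T where "T = 2 * \<rho> powr (- (N / p))"
    have ab: "\<bar>average \<rho> (V j) x\<bar> \<le> T" for j x
      unfolding T_def N_def V_def by (rule average_bound[OF p v _ mU \<rho>]) auto
    have hb: "\<bar>h x\<bar> \<le> T" for x
      using LIMSEQ_le_const2[OF tendsto_rabs[OF hl[of x]]] ab by blast
    have "(\<lambda>j. ?D l (average \<rho> (V j)) h) \<longlonglongrightarrow> (\<integral>\<^sup>+x. (0::ennreal) \<partial>(lborel :: (real ^ 'n) measure))"
    proof (rule nn_integral_dominated_convergence[where w = "\<lambda>x. ennreal ((2 * T)\<^sup>2) * indicator (B l) x"])
      show "AE x in lborel. ennreal ((average \<rho> (V j) x - h x)\<^sup>2) * indicator (B l) x \<le> ennreal ((2 * T)\<^sup>2) * indicator (B l) x" for j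
      proof (intro AE_I2 mult_right_mono ennreal_leI)
        fix x
        have "\<bar>average \<rho> (V j) x - h x\<bar> \<le> 2 * T" using ab[of j x] hb[of x] by linarith
        then show "(average \<rho> (V j) x - h x)\<^sup>2 \<le> (2 * T)\<^sup>2" by (rule power2_le_iff_abs_le[THEN iffD2, rotated]) (use ab[of j x] in linarith)
      qed simp
      show "(\<integral>\<^sup>+x. ennreal ((2 * T)\<^sup>2) * indicator (B l) x \<partial>lborel) < \<infinity>"
        using Bfin[of l] by (simp add: nn_integral_cmult_indicator ennreal_mult_less_top)
      show "AE x in lborel. (\<lambda>j. ennreal ((average \<rho> (V j) x - h x)\<^sup>2) * indicator (B l) x) \<longlonglongrightarrow> 0"
      proof (intro AE_I2)
        fix x
        have "(\<lambda>j. (average \<rho> (V j) x - h x)\<^sup>2) \<longlonglongrightarrow> (h x - h x)\<^sup>2"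
          by (intro tendsto_intros hl)
        then have "(\<lambda>j. ennreal ((average \<rho> (V j) x - h x)\<^sup>2)) \<longlonglongrightarrow> ennreal 0"
          by (intro tendsto_ennrealI) simp
        then show "(\<lambda>j. ennreal ((average \<rho> (V j) x - h x)\<^sup>2) * indicator (B l) x) \<longlonglongrightarrow> 0"
          by (cases "x \<in> B l") auto
      qed
    qed auto
    then have "(\<lambda>j. ?D l (average \<rho> (V j)) h) \<longlonglongrightarrow> 0" by simp
    from order_tendstoD(2)[OF this, of "ennreal (\<epsilon> / 4)"] eps
    obtain M where M: "\<And>j. j \<ge> M \<Longrightarrow> ?D l (average \<rho> (V j)) h < ennreal (\<epsilon> / 4)"
      by (auto simp: eventually_sequentially)
    have osc: "?D l (V j) (average \<rho> (V j)) \<le> ennreal (\<epsilon> / 4)" for j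
    proof -
      have "?D l (V j) (average \<rho> (V j)) \<le> (\<integral>\<^sup>+x. ennreal ((V j x - average \<rho> (V j) x)\<^sup>2) \<partial>lborel)"
        by (intro nn_integral_mono) (auto simp: indicator_def)
      also have "\<dots> \<le> ennreal (N powr (N + 2 * s) * \<rho> powr (2 * s)) * gagliardo s (\<Omega>s (r1 j)) (v (r1 j))"
        unfolding V_def N_def
        by (rule L2_distance_average_le[OF s p v \<Omega> _ \<rho> off order.strict_trans1[OF m]])
          (use sat in \<open>auto simp: \<rho>_def\<close>)
      also have "\<dots> \<le> ennreal (N powr (N + 2 * s) * \<rho> powr (2 * s)) * ennreal (max K 0)"
        by (intro mult_left_mono order.trans[OF K] ennreal_leI) auto
      also have "\<dots> = ennreal (N powr (N + 2 * s) * \<rho> powr (2 * s) * max K 0)"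
        by (rule ennreal_mult[symmetric]) auto
      also have "\<dots> \<le> ennreal (\<epsilon> / 4)" using k by (intro ennreal_leI) (simp add: \<rho>_def)
      finally show ?thesis .
    qed
    have "?D l (V j) h \<le> ennreal \<epsilon>" if "j \<ge> M" for j
    proof -
      have "?D l (V j) h \<le>
          2 * ?D l (V j) (average \<rho> (V j))
          + 2 * ?D l (average \<rho> (V j)) h"
        by (rule nn_integral_square_diff_le) auto
      also have "\<dots> \<le> 2 * ennreal (\<epsilon> / 4) + 2 * ennreal (\<epsilon> / 4)"
        by (intro add_mono mult_left_mono osc less_imp_le[OF M[OF that]]) auto
      also have "\<dots> = ennreal \<epsilon>"
        using eps by (simp add: ennreal_mult[symmetric] ennreal_plus[symmetric] flip: ennreal_numeral del: ennreal_plus)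
      finally show ?thesis .
    qed
    with hm show ?thesis by blast
  qed
  have cauchy: "\<exists>N. \<forall>i\<ge>N. \<forall>j\<ge>N. ?D l (V i) (V j) \<le> ennreal \<epsilon>"
    if eps: "0 < \<epsilon>" for l \<epsilon>
  proof -
    obtain h M where h[measurable]: "h \<in> borel_measurable borel"
      and M: "\<And>i. i \<ge> M \<Longrightarrow> ?D l (V i) h \<le> ennreal (\<epsilon> / 4)"
      using approx[of "\<epsilon> / 4" l] eps by auto
    have "?D l (V i) (V j) \<le> ennreal \<epsilon>" if "i \<ge> M" "j \<ge> M" for i j
    proof -
      have "?D l (V i) (V j) \<le>
          2 * ?D l (V i) h
          + 2 * ?D l h (V j)"
        by (rule nn_integral_square_diff_le) auto
      also have "?D l h (V j) = ?D l (V j) h"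
        by (simp add: power2_commute)
      also have "2 * ?D l (V i) h + 2 * ?D l (V j) h
         \<le> 2 * ennreal (\<epsilon> / 4) + 2 * ennreal (\<epsilon> / 4)"
        by (intro add_mono mult_left_mono M that) auto
      also have "\<dots> = ennreal \<epsilon>"
        using eps by (simp add: ennreal_mult[symmetric] ennreal_plus[symmetric] flip: ennreal_numeral del: ennreal_plus)
      finally show ?thesis .
    qed
    then show ?thesis by blast
  qed
  have un: "(\<Union>l. B l) = UNIV"
  proof (intro equalityI subsetI UNIV_I)
    fix x :: "real ^ 'n"
    obtain l :: nat where "norm x \<le> real l" using real_arch_simple by blast
    then show "x \<in> (\<Union>l. B l)" by (auto simp: B_def)
  qed
  have inc: "incseq B" by (auto simp: B_def incseq_def)
  have "\<exists>r. strict_mono (r :: nat \<Rightarrow> nat) \<and> (AE x in lborel. convergent (\<lambda>j. V (r j) x))"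
    by (rule AE_convergent_subsequence_of_Cauchy_L2[of V lborel B]) (use cauchy un inc in auto)
  then obtain r2 where r2: "strict_mono (r2 :: nat \<Rightarrow> nat)" and c2: "AE x in lborel. convergent (\<lambda>j. V (r2 j) x)"
    by blast
  define w where "w x = lim (\<lambda>j. V (r2 j) x)" for x
  have w[measurable]: "w \<in> borel_measurable borel" unfolding w_def by measurable
  have lim: "AE x in lborel. (\<lambda>j. V (r2 j) x) \<longlonglongrightarrow> w x"
    using c2 by eventually_elim (simp add: w_def convergent_LIMSEQ_iff)
  have L2: "\<forall>\<^sub>F j in sequentially. ?D l (V (r2 j)) w \<le> ennreal \<epsilon>"
    if eps: "0 < \<epsilon>" for l \<epsilon>
  proof -
    obtain M where M: "\<And>i j. i \<ge> M \<Longrightarrow> j \<ge> M \<Longrightarrow> ?D l (V i) (V j) \<le> ennreal \<epsilon>"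
      using cauchy[OF eps] by blast
    have "?D l (V (r2 i)) w \<le> ennreal \<epsilon>" if i: "i \<ge> M" for i
    proof -
      have "?D l (V (r2 i)) w
          = (\<integral>\<^sup>+x. liminf (\<lambda>j. ennreal ((V (r2 i) x - V (r2 j) x)\<^sup>2) * indicator (B l) x) \<partial>lborel)"
      proof (rule nn_integral_cong_AE, use lim in eventually_elim)
        case (elim x)
        have "(\<lambda>j. (V (r2 i) x - V (r2 j) x)\<^sup>2) \<longlonglongrightarrow> (V (r2 i) x - w x)\<^sup>2"
          by (intro tendsto_intros elim)
        then have "(\<lambda>j. ennreal ((V (r2 i) x - V (r2 j) x)\<^sup>2) * indicator (B l) x) \<longlonglongrightarrow> ennreal ((V (r2 i) x - w x)\<^sup>2) * indicator (B l) x"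
          by (cases "x \<in> B l") auto
        then show ?case by (intro lim_imp_Liminf[symmetric]) auto
      qed
      also have "\<dots> \<le> liminf (\<lambda>j. \<integral>\<^sup>+x\<in>B l. ennreal ((V (r2 i) x - V (r2 j) x)\<^sup>2) \<partial>lborel)"
        by (intro nn_integral_liminf) auto
      also have "\<dots> \<le> ennreal \<epsilon>"
      proof (rule Liminf_le)
        have "r2 j \<ge> M" if "j \<ge> M" for j using that seq_suble[OF r2, of j] by simp
        then show "\<forall>\<^sub>F j in sequentially. ?D l (V (r2 i)) (V (r2 j)) \<le> ennreal \<epsilon>"
          using i by (intro eventually_sequentiallyI[of M] M) auto
      qed simp
      finally show ?thesis .
    qed
    then show ?thesis by (intro eventually_sequentiallyI[of M])
  qed
  show ?thesis
  proof (rule that[of "r1 \<circ> r2" w])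
    show "strict_mono (r1 \<circ> r2)" using r1 r2 by (rule strict_mono_o)
  qed (use w lim L2 in \<open>auto simp: V_def B_def\<close>)
qed

text \<open>
  Convergence almost everywhere alone could lose the average; \<open>L\<^sup>2\<close> convergence on a ball around the
  unit cube keeps it.
\<close>
lemma limit_nonzero_of_average:
  fixes v :: "nat \<Rightarrow> real ^ 'n::finite \<Rightarrow> real"
  assumes v[measurable]: "\<And>j. v j \<in> borel_measurable borel"
    and L2: "\<And>l \<epsilon>. 0 < \<epsilon> \<Longrightarrow> \<forall>\<^sub>F j in sequentially. (\<integral>\<^sup>+x\<in>cball 0 (real l). ennreal ((v j x - w x)\<^sup>2) \<partial>lborel) \<le> ennreal \<epsilon>"
    and c: "0 < c" "\<And>j. c \<le> \<bar>LINT x:cube 1 1|lborel. v j x\<bar>"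
  shows "\<not> (AE x in lborel. w x = 0)"
proof
  assume w0: "AE x in lborel. w x = 0"
  define U :: "(real ^ 'n) set" where "U = cube 1 1"
  have [measurable]: "U \<in> sets borel" by (simp add: U_def)
  obtain l :: nat where l: "norm (1 :: real ^ 'n) + real CARD('n) \<le> real l" using real_arch_simple by blast
  have Ul: "U \<subseteq> cball 0 (real l)"
  proof
    fix x assume "x \<in> U"
    then have "norm (1 - x) \<le> real CARD('n)" using norm_diff_cube_le[of 1 x 1] by (simp add: U_def)
    moreover have "norm x \<le> norm (1 :: real ^ 'n) + norm (1 - x)"
      using norm_triangle_ineq4[of 1 "1 - x"] by simp
    ultimately show "x \<in> cball 0 (real l)" using l by simp
  qed
  let ?D = "\<lambda>j. (\<integral>\<^sup>+x\<in>cball 0 (real l). ennreal ((v j x - w x)\<^sup>2) \<partial>lborel)"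
  have "\<forall>\<^sub>F j in sequentially. ?D j \<le> ennreal (c\<^sup>2 / 2)"
    using c by (intro L2) auto
  then obtain j where j: "?D j \<le> ennreal (c\<^sup>2 / 2)"
    by (auto simp: eventually_sequentially)
  let ?I = "\<integral>\<^sup>+x. ennreal \<bar>v j x\<bar> * indicator U x \<partial>lborel"
  have "ennreal c \<le> ennreal \<bar>LINT x:U|lborel. v j x\<bar>" using c(2)[of j] by (intro ennreal_leI) (simp add: U_def)
  also have "\<dots> \<le> ?I"
  proof (cases "integrable lborel (\<lambda>x. indicator U x *\<^sub>R v j x)")
    case True
    have "ennreal \<bar>LINT x:U|lborel. v j x\<bar> \<le> (\<integral>\<^sup>+x. ennreal (norm (indicator U x *\<^sub>R v j x)) \<partial>lborel)"
      unfolding set_lebesgue_integral_def real_norm_def[symmetric]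
      by (rule integral_norm_bound_ennreal[OF True])
    also have "\<dots> = ?I"
      by (intro nn_integral_cong) (auto simp: indicator_def)
    finally show ?thesis .
  qed (simp add: set_lebesgue_integral_def not_integrable_integral_eq)
  finally have "(ennreal c)\<^sup>2 \<le> ?I\<^sup>2"
    by (rule power_mono) simp
  also have "\<dots> \<le> (\<integral>\<^sup>+x. (ennreal \<bar>v j x\<bar> * indicator U x)\<^sup>2 \<partial>lborel) * (\<integral>\<^sup>+x. (indicator U x)\<^sup>2 \<partial>lborel)"
  proof -
    have "?I = (\<integral>\<^sup>+x. (ennreal \<bar>v j x\<bar> * indicator U x) * indicator U x \<partial>lborel)"
      by (intro nn_integral_cong) (auto simp: indicator_def)
    then show ?thesis by (simp only:) (rule Cauchy_Schwarz_nn_integral; measurable)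
  qed
  also have "(\<integral>\<^sup>+x. (indicator U x)\<^sup>2 \<partial>lborel) = (\<integral>\<^sup>+x. indicator U x \<partial>lborel)"
    by (intro nn_integral_cong) (auto simp: indicator_def)
  also have "\<dots> = 1" using emeasure_cube[of 1 "1 :: real ^ 'n"] by (simp add: U_def)
  also have "(\<integral>\<^sup>+x. (ennreal \<bar>v j x\<bar> * indicator U x)\<^sup>2 \<partial>lborel) \<le> ?D j"
  proof (rule nn_integral_mono_AE, use w0 in eventually_elim)
    case (elim x)
    then show ?case using Ul by (auto simp: indicator_def ennreal_power)
  qed
  also note j
  finally have "ennreal (c\<^sup>2) \<le> ennreal (c\<^sup>2 / 2)" using c by (simp add: ennreal_power mult_right_mono)
  then show False using c by simp
qed

section \<open>The best constant\<close>

lemma mass_cmult: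
  fixes u :: "real ^ 'n::finite \<Rightarrow> real"
  assumes [measurable]: "u \<in> borel_measurable borel" "\<Omega> \<in> sets borel"
  shows "mass p \<Omega> (\<lambda>x. c * u x) = ennreal (\<bar>c\<bar> powr p) * mass p \<Omega> u"
proof -
  have "mass p \<Omega> (\<lambda>x. c * u x) = (\<integral>\<^sup>+x. ennreal (\<bar>c\<bar> powr p) * (ennreal (\<bar>u x\<bar> powr p) * indicator \<Omega> x) \<partial>lborel)"
    unfolding mass_def by (intro nn_integral_cong) (simp add: abs_mult powr_mult ennreal_mult mult.assoc)
  also have "\<dots> = ennreal (\<bar>c\<bar> powr p) * mass p \<Omega> u"
    unfolding mass_def by (rule nn_integral_cmult) auto
  finally show ?thesis .
qed

lemma gagliardo_cmult:
  fixes u :: "real ^ 'n::finite \<Rightarrow> real"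
  assumes [measurable]: "u \<in> borel_measurable borel" "\<Omega> \<in> sets borel"
  shows "gagliardo s \<Omega> (\<lambda>x. c * u x) = ennreal (c\<^sup>2) * gagliardo s \<Omega> u"
proof -
  let ?k = "\<lambda>u x y. (u x - u y)\<^sup>2 / norm (x - y) powr (real CARD('n) + 2 * s)"
  have "difference_energy s \<Omega> (\<lambda>x. c * u x) x = ennreal (c\<^sup>2) * difference_energy s \<Omega> u x" for x
  proof -
    have "difference_energy s \<Omega> (\<lambda>x. c * u x) x =
       (\<integral>\<^sup>+y. ennreal (c\<^sup>2) * (ennreal (?k u x y) * indicator \<Omega> y) \<partial>lborel)"
      unfolding difference_energy_def
    proof (intro nn_integral_cong)
      fix y
      have "?k (\<lambda>x. c * u x) x y
          = c\<^sup>2 * (?k u x y)"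
        by (simp add: right_diff_distrib[symmetric] power_mult_distrib)
      then show "ennreal (?k (\<lambda>x. c * u x) x y) * indicator \<Omega> y =
         ennreal (c\<^sup>2) * (ennreal (?k u x y) * indicator \<Omega> y)"
        by (simp only: mult.assoc[symmetric]) (subst ennreal_mult; simp)
    qed
    also have "\<dots> = ennreal (c\<^sup>2) * difference_energy s \<Omega> u x"
      unfolding difference_energy_def by (rule nn_integral_cmult) auto
    finally show ?thesis .
  qed
  then have "gagliardo s \<Omega> (\<lambda>x. c * u x) = (\<integral>\<^sup>+x. ennreal (c\<^sup>2) * (difference_energy s \<Omega> u x * indicator \<Omega> x) \<partial>lborel)"
    unfolding gagliardo_def by (simp add: mult.assoc)
  also have "\<dots> = ennreal (c\<^sup>2) * gagliardo s \<Omega> u"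
    unfolding gagliardo_def by (rule nn_integral_cmult) auto
  finally show ?thesis .
qed

lemma mass_cong: "(\<And>x. x \<in> \<Omega> \<Longrightarrow> u x = v x) \<Longrightarrow> mass p \<Omega> u = mass p \<Omega> v"
  unfolding mass_def by (intro nn_integral_cong) (auto simp: indicator_def)

lemma gagliardo_cong: "(\<And>x. x \<in> \<Omega> \<Longrightarrow> u x = v x) \<Longrightarrow> gagliardo s \<Omega> u = gagliardo s \<Omega> v"
  unfolding gagliardo_def difference_energy_def
  by (auto intro!: nn_integral_cong simp: indicator_def)

text \<open>
  The normalized competitors. They are total Borel functions that vanish off \<open>\<Omega>\<close>, so that sequences
  with varying domains can be compared pointwise.
\<close>
definition admissible :: "real \<Rightarrow> (real ^ 'n::finite) set \<Rightarrow> (real ^ 'n \<Rightarrow> real) set"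
  where "admissible s \<Omega> = {u \<in> borel_measurable borel. (\<forall>x. x \<notin> \<Omega> \<longrightarrow> u x = 0) \<and>
     mass (crit_exp CARD('n) s) \<Omega> u = 1 \<and> gagliardo s \<Omega> u < \<infinity>}"

definition best_constant :: "real \<Rightarrow> (real ^ 'n::finite) set \<Rightarrow> real"
  where "best_constant s \<Omega> = (INF u\<in>admissible s \<Omega>. enn2real (gagliardo s \<Omega> u))"

lemma best_constant_le: "u \<in> admissible s \<Omega> \<Longrightarrow> best_constant s \<Omega> \<le> enn2real (gagliardo s \<Omega> u)"
  unfolding best_constant_def by (rule cINF_lower) (auto intro!: bdd_belowI[of _ 0])

lemma normalized_admissible:
  fixes f :: "real ^ 'n::finite \<Rightarrow> real"
  assumes s: "0 < s" "2 * s < real CARD('n)"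
    and f[measurable]: "f \<in> borel_measurable borel" and \<Omega>[measurable]: "\<Omega> \<in> sets borel"
  defines "p \<equiv> crit_exp CARD('n) s"
  assumes m: "mass p \<Omega> f = ennreal m" "0 < m" and g: "gagliardo s \<Omega> f = ennreal g" "0 \<le> g"
  obtains u where "u \<in> admissible s \<Omega>" "gagliardo s \<Omega> u = ennreal (g / m powr (2 / p))"
proof -
  note ce = crit_exp_facts[OF s, folded p_def]
  define c where "c = m powr (- (1 / p))"
  define u where "u x = c * (indicator \<Omega> x * f x)" for x
  have [measurable]: "u \<in> borel_measurable borel" unfolding u_def by measurable
  have c: "c > 0" using m by (simp add: c_def)
  have "- (1 / p) * p = - 1" using ce(1) by simp
  then have cp: "c powr p = 1 / m" unfolding c_def powr_powr using m by (simp add: powr_minus divide_simps)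
  have c2: "c\<^sup>2 = 1 / m powr (2 / p)"
    using m by (simp add: c_def power2_eq_square powr_add[symmetric] powr_minus divide_simps)
  have "mass p \<Omega> u = mass p \<Omega> (\<lambda>x. c * f x)" by (rule mass_cong) (simp add: u_def)
  also have "\<dots> = ennreal (1 / m) * ennreal m" using c by (simp add: mass_cmult cp m)
  also have "\<dots> = 1" using m by (simp add: ennreal_mult[symmetric])
  finally have mu: "mass p \<Omega> u = 1" .
  have "gagliardo s \<Omega> u = gagliardo s \<Omega> (\<lambda>x. c * f x)" by (rule gagliardo_cong) (simp add: u_def)
  also have "\<dots> = ennreal (1 / m powr (2 / p)) * ennreal g" by (simp add: gagliardo_cmult c2 g)
  also have "\<dots> = ennreal (g / m powr (2 / p))" using g by (simp add: ennreal_mult[symmetric])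
  finally have gu: "gagliardo s \<Omega> u = ennreal (g / m powr (2 / p))" .
  have "u \<in> admissible s \<Omega>"
    using mu gu by (simp add: admissible_def p_def u_def[abs_def])
  then show ?thesis using gu by (rule that)
qed

lemma best_constant_sobolev:
  fixes f :: "real ^ 'n::finite \<Rightarrow> real"
  assumes s: "0 < s" "2 * s < real CARD('n)"
    and f[measurable]: "f \<in> borel_measurable borel" and \<Omega>[measurable]: "\<Omega> \<in> sets borel"
  defines "p \<equiv> crit_exp CARD('n) s"
  assumes m: "mass p \<Omega> f < \<infinity>" and g: "gagliardo s \<Omega> f < \<infinity>"
  shows "best_constant s \<Omega> * enn2real (mass p \<Omega> f) powr (2 / p) \<le> enn2real (gagliardo s \<Omega> f)"
proof (cases "enn2real (mass p \<Omega> f) = 0")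
  case False
  define m' g' where "m' = enn2real (mass p \<Omega> f)" and "g' = enn2real (gagliardo s \<Omega> f)"
  have "m' > 0" using False enn2real_nonneg[of "mass p \<Omega> f"] unfolding m'_def by linarith
  moreover have "mass p \<Omega> f = ennreal m'" "gagliardo s \<Omega> f = ennreal g'" "g' \<ge> 0"
    using m g by (auto simp: m'_def g'_def)
  ultimately obtain u where u: "u \<in> admissible s \<Omega>" "gagliardo s \<Omega> u = ennreal (g' / m' powr (2 / p))"
    using normalized_admissible[OF s f \<Omega>, folded p_def, of m' g'] by metis
  have "best_constant s \<Omega> \<le> g' / m' powr (2 / p)"
    using best_constant_le[OF u(1)] u(2) \<open>g' \<ge> 0\<close> by simp
  then show ?thesis using \<open>m' > 0\<close> by (simp add: field_simps flip: m'_def g'_def)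
qed simp

section \<open>A function of finite energy\<close>

lemma cball_measure_scale:
  fixes r :: real
  assumes r: "0 < r"
  shows "emeasure lborel (cball (0 :: 'a::euclidean_space) r) = ennreal (r ^ DIM('a)) * emeasure lborel (cball (0 :: 'a) 1)"
proof -
  have "emeasure lborel (cball (0 :: 'a) r) = (\<integral>\<^sup>+x. indicator (cball (0 :: 'a) r) x \<partial>lborel)" by simp
  also have "\<dots> = ennreal (\<bar>r\<bar> ^ DIM('a)) * (\<integral>\<^sup>+x. indicator (cball (0 :: 'a) r) (0 + r *\<^sub>R x) \<partial>lborel)"
    by (rule nn_integral_lborel_affine) (use r in \<open>auto intro!: borel_measurable_indicator borel_closed\<close>)
  also have "(\<integral>\<^sup>+x. indicator (cball (0 :: 'a) r) (0 + r *\<^sub>R x) \<partial>lborel) = (\<integral>\<^sup>+x. indicator (cball (0 :: 'a) 1) x \<partial>lborel)"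
    by (intro nn_integral_cong) (use r in \<open>auto simp: indicator_def\<close>)
  finally show ?thesis using r by simp
qed

lemma dyadic_bracket:
  fixes x :: real
  assumes "1 \<le> x"
  obtains m :: nat where "2 ^ m \<le> x" "x \<le> 2 ^ Suc m"
proof -
  obtain N :: nat where N: "x < 2 ^ N" using real_arch_pow[of 2 x] by auto
  define M where "M = (LEAST N. x < 2 ^ N)"
  have M: "x < 2 ^ M" unfolding M_def by (rule LeastI[of _ N]) (rule N)
  have "M \<noteq> 0" using M assms by (cases M) auto
  then obtain m where m: "M = Suc m" by (cases M) auto
  have "\<not> x < 2 ^ m" using not_less_Least[of m "\<lambda>N. x < 2 ^ N"] m by (simp add: M_def)
  then show ?thesis using M m by (intro that[of m]) auto
qed

text \<open>
  On the shell \<open>2 ^ m \<le> \<bar>z\<bar> \<le> 2 ^ (m + 1)\<close> and on its mirror image inside the unit ball, the integrand is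
  at most a constant, and these constants times the volumes of balls form geometric series, with
  ratios \<open>2 powr (- 2 s)\<close> at infinity and \<open>2 powr (2 s - 2)\<close> at the origin.
\<close>
lemma truncated_kernel_integrable:
  fixes s :: real
  assumes s: "0 < s" "s < 1"
  shows "(\<integral>\<^sup>+z. ennreal (min 1 ((norm z)\<^sup>2) / norm z powr (real DIM('a) + 2 * s)) \<partial>(lborel :: 'a::euclidean_space measure)) < \<infinity>"
proof -
  define n where "n = DIM('a)"
  define k where "k z = min 1 ((norm z)\<^sup>2) / norm z powr (real n + 2 * s)" for z :: 'a
  define a where "a m = (2 ^ m) powr (- (real n + 2 * s))" for m :: nat
  define b where "b m = (1 / 2 ^ m)\<^sup>2 * (2 ^ Suc m) powr (real n + 2 * s)" for m :: nat
  define A :: "nat \<Rightarrow> 'a \<Rightarrow> ennreal" where "A m z = ennreal (a m) * indicator (cball 0 (2 ^ Suc m)) z" for m z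
  define B :: "nat \<Rightarrow> 'a \<Rightarrow> ennreal" where "B m z = ennreal (b m) * indicator (cball 0 (1 / 2 ^ m)) z" for m z
  have [measurable]: "cball (0 :: 'a) r \<in> sets borel" for r by (intro borel_closed closed_cball)
  have [measurable]: "A m \<in> borel_measurable borel" "B m \<in> borel_measurable borel" for m
    unfolding A_def B_def by measurable
  define V where "V = emeasure lborel (cball (0 :: 'a) 1)"
  have V: "V < \<infinity>" unfolding V_def by (rule emeasure_bounded_finite) simp
  have kAB: "ennreal (k z) \<le> (\<Sum>m. A m z) + (\<Sum>m. B m z)" for z
  proof (cases "norm z \<ge> 1")
    case True
    then obtain m where m: "2 ^ m \<le> norm z" "norm z \<le> 2 ^ Suc m" by (rule dyadic_bracket)
    have "k z \<le> 1 / norm z powr (real n + 2 * s)" unfolding k_def by (intro divide_right_mono) auto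
    also have "\<dots> = norm z powr (- (real n + 2 * s))" by (rule powr_minus_divide[symmetric])
    also have "\<dots> \<le> a m" unfolding a_def using m s by (intro powr_mono2') auto
    finally have "ennreal (k z) \<le> A m z" using m by (simp add: A_def ennreal_leI)
    also have "A m z \<le> (\<Sum>m. A m z)" using sum_le_suminf[of "\<lambda>m. A m z" "{m}"] by simp
    finally show ?thesis by (simp add: add_increasing2)
  next
    case False
    show ?thesis
    proof (cases "z = 0")
      case False
      then have z: "0 < norm z" "norm z < 1" using \<open>\<not> norm z \<ge> 1\<close> by auto
      then have "1 \<le> 1 / norm z" by simp
      then obtain m where m: "2 ^ m \<le> 1 / norm z" "1 / norm z \<le> 2 ^ Suc m" by (rule dyadic_bracket)
      have m1: "norm z \<le> 1 / 2 ^ m" using m(1) z by (simp add: field_simps)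
      have "k z \<le> (1 / 2 ^ m)\<^sup>2 / norm z powr (real n + 2 * s)" unfolding k_def
        using power_mono[OF m1, of 2] by (intro divide_right_mono) (auto simp: min_le_iff_disj)
      also have "\<dots> = (1 / 2 ^ m)\<^sup>2 * (1 / norm z) powr (real n + 2 * s)" using z by (simp add: powr_divide)
      also have "\<dots> \<le> b m" unfolding b_def using m s z by (intro mult_left_mono powr_mono2) auto
      finally have "ennreal (k z) \<le> B m z" using m1 by (simp add: B_def ennreal_leI)
      also have "B m z \<le> (\<Sum>m. B m z)" using sum_le_suminf[of "\<lambda>m. B m z" "{m}"] by simp
      finally show ?thesis by (simp add: add_increasing)
    qed (simp add: k_def)
  qed
  have two: "(2::real) ^ m = 2 powr real m" for m by (simp add: powr_realpow)
  have pw: "(2 powr c) ^ m = 2 powr (c * real m)" for c :: real and m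
  proof -
    have "(2 powr c) powr real m = (2 powr c) ^ m" by (rule powr_realpow) simp
    then show ?thesis by (simp only: powr_powr)
  qed
  have iA: "(\<integral>\<^sup>+z. A m z \<partial>lborel) = ennreal (2 ^ n * (2 powr (- 2 * s)) ^ m) * V" for m
  proof -
    have "(\<integral>\<^sup>+z. A m z \<partial>lborel) = ennreal (a m) * (ennreal ((2 ^ Suc m) ^ n) * V)"
      unfolding A_def V_def n_def
      by (subst cball_measure_scale[symmetric], simp, rule nn_integral_cmult_indicator) simp
    also have "\<dots> = ennreal (a m * (2 ^ Suc m) ^ n) * V"
      by (simp add: ennreal_mult a_def mult.assoc)
    also have "a m * (2 ^ Suc m) ^ n = 2 ^ n * (2 powr (- 2 * s)) ^ m"
    proof -
      have "a m = 2 powr (real m * (- (real n + 2 * s)))" by (simp only: a_def two powr_powr)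
      moreover have "(2 ^ Suc m :: real) ^ n = 2 powr (real (Suc m) * real n)" by (simp only: two pw)
      ultimately have "a m * (2 ^ Suc m) ^ n = 2 powr (real m * (- (real n + 2 * s)) + real (Suc m) * real n)"
        by (simp only: powr_add)
      also have "real m * (- (real n + 2 * s)) + real (Suc m) * real n = real n + (- 2 * s) * real m"
        by (simp add: algebra_simps)
      also have "2 powr (real n + (- 2 * s) * real m) = 2 ^ n * (2 powr (- 2 * s)) ^ m"
        by (simp only: powr_add pw two)
      finally show ?thesis .
    qed
    finally show ?thesis .
  qed
  have iB: "(\<integral>\<^sup>+z. B m z \<partial>lborel) = ennreal (2 powr (real n + 2 * s) * (2 powr (2 * s - 2)) ^ m) * V" for m
  proof -
    have "(\<integral>\<^sup>+z. B m z \<partial>lborel) = ennreal (b m) * (ennreal ((1 / 2 ^ m) ^ n) * V)"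
      unfolding B_def V_def n_def
      by (subst cball_measure_scale[symmetric], simp, rule nn_integral_cmult_indicator) simp
    also have "\<dots> = ennreal (b m * (1 / 2 ^ m) ^ n) * V"
      by (simp add: ennreal_mult b_def mult.assoc)
    also have "b m * (1 / 2 ^ m) ^ n = 2 powr (real n + 2 * s) * (2 powr (2 * s - 2)) ^ m"
    proof -
      have i: "1 / 2 ^ m = 2 powr (- real m)" by (simp add: two powr_minus_divide)
      have "(1 / 2 ^ m :: real)\<^sup>2 = 2 powr ((- real m) * real 2)" by (simp only: i pw)
      moreover have "(2 ^ Suc m :: real) powr (real n + 2 * s) = 2 powr (real (Suc m) * (real n + 2 * s))"
        by (simp only: two powr_powr)
      moreover have "(1 / 2 ^ m :: real) ^ n = 2 powr ((- real m) * real n)" by (simp only: i pw)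
      ultimately have "b m * (1 / 2 ^ m) ^ n = 2 powr ((- real m) * real 2 + real (Suc m) * (real n + 2 * s) + (- real m) * real n)"
        by (simp only: b_def powr_add)
      also have "(- real m) * real 2 + real (Suc m) * (real n + 2 * s) + (- real m) * real n
          = (real n + 2 * s) + (2 * s - 2) * real m"
        by (simp add: algebra_simps)
      also have "2 powr ((real n + 2 * s) + (2 * s - 2) * real m) = 2 powr (real n + 2 * s) * (2 powr (2 * s - 2)) ^ m"
        by (simp only: powr_add[of 2 "real n + 2 * s"] pw)
      finally show ?thesis .
    qed
    finally show ?thesis .
  qed
  have geo: "(\<Sum>m. ennreal (C * q ^ m) * V) < \<infinity>" if "0 \<le> C" "0 < q" "q < 1" for C q
  proof -
    have "(\<Sum>m. ennreal (C * q ^ m) * V) = (\<Sum>m. ennreal (C * q ^ m)) * V" by simp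
    also have "(\<Sum>m. ennreal (C * q ^ m)) = ennreal (\<Sum>m. C * q ^ m)"
      by (rule suminf_ennreal2) (use that in \<open>auto intro!: summable_mult summable_geometric\<close>)
    finally show ?thesis using V by (simp add: ennreal_mult_less_top)
  qed
  have "(\<integral>\<^sup>+z. ennreal (k z) \<partial>lborel) \<le> (\<integral>\<^sup>+z. (\<Sum>m. A m z) + (\<Sum>m. B m z) \<partial>lborel)"
    by (intro nn_integral_mono kAB)
  also have "\<dots> = (\<Sum>m. \<integral>\<^sup>+z. A m z \<partial>lborel) + (\<Sum>m. \<integral>\<^sup>+z. B m z \<partial>lborel)"
    by (subst nn_integral_add) (auto simp: nn_integral_suminf)
  also have "\<dots> < \<infinity>"
  proof -
    have "(2::real) powr (- 2 * s) < 2 powr 0" "(2::real) powr (2 * s - 2) < 2 powr 0"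
      by (rule powr_less_mono; use s in simp)+
    then have "(\<Sum>m. \<integral>\<^sup>+z. A m z \<partial>lborel) < \<infinity>" "(\<Sum>m. \<integral>\<^sup>+z. B m z \<partial>lborel) < \<infinity>"
      unfolding iA iB by (intro geo; simp)+
    then show ?thesis by simp
  qed
  finally show ?thesis by (simp add: k_def n_def)
qed

text \<open>
  The cone \<open>max 0 (1 - \<bar>x\<bar>)\<close> is bounded by 1, Lipschitz with constant 1 and supported in the unit ball,
  so its energy is at most twice the volume of the ball times the integral of the truncated kernel.
\<close>
lemma bump_admissible:
  fixes s :: real
  assumes s: "0 < s" "s < 1" "2 * s < real CARD('n)"
  shows "admissible s (UNIV :: (real ^ 'n::finite) set) \<noteq> {}"
proof -
  define p where "p = crit_exp CARD('n) s"
  note ce = crit_exp_facts[OF s(1,3), folded p_def]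
  define B :: "(real ^ 'n) set" where "B = cball 0 1"
  have Bm[measurable]: "B \<in> sets borel" unfolding B_def by (intro borel_closed closed_cball)
  have Bfin: "emeasure lborel B < \<infinity>" unfolding B_def by (rule emeasure_bounded_finite) simp
  define \<phi> :: "real ^ 'n \<Rightarrow> real" where "\<phi> x = max 0 (1 - norm x)" for x
  have \<phi>[measurable]: "\<phi> \<in> borel_measurable borel" unfolding \<phi>_def by measurable
  define k :: "real ^ 'n \<Rightarrow> real" where "k z = min 1 ((norm z)\<^sup>2) / norm z powr (real CARD('n) + 2 * s)" for z
  have [measurable]: "k \<in> borel_measurable borel" unfolding k_def by measurable
  define J where "J = (\<integral>\<^sup>+z. ennreal (k z) \<partial>lborel)"
  have J: "J < \<infinity>" using truncated_kernel_integrable[OF s(1,2), where 'a = "real ^ 'n"]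
    by (simp add: J_def k_def)
  have k0: "k z \<ge> 0" for z by (simp add: k_def)
  have Jx: "(\<integral>\<^sup>+y. ennreal (k (x - y)) \<partial>lborel) = J" for x
    unfolding J_def by (subst nn_integral_lborel_affine[of _ "-1" x]) auto
  have Jy: "(\<integral>\<^sup>+x. ennreal (k (x - y)) \<partial>lborel) = J" for y
    unfolding J_def by (subst nn_integral_lborel_affine[of _ "1" "- y"]) auto
  have bd: "(\<phi> x - \<phi> y)\<^sup>2 \<le> min 1 ((norm (x - y))\<^sup>2) * (indicator B x + indicator B y)" for x y
  proof (cases "x \<in> B \<or> y \<in> B")
    case True
    have "0 \<le> \<phi> z" "\<phi> z \<le> 1" for z by (auto simp: \<phi>_def)
    from this[of x] this[of y] have 1: "\<bar>\<phi> x - \<phi> y\<bar> \<le> 1" by linarith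
    have "\<bar>\<phi> x - \<phi> y\<bar> \<le> \<bar>norm x - norm y\<bar>" unfolding \<phi>_def by (auto simp: max_def)
    also have "\<dots> \<le> norm (x - y)" by (rule norm_triangle_ineq3)
    finally have 2: "\<bar>\<phi> x - \<phi> y\<bar> \<le> norm (x - y)" .
    have "(\<phi> x - \<phi> y)\<^sup>2 \<le> min 1 ((norm (x - y))\<^sup>2)"
      using power_mono[OF 1, of 2] power_mono[OF 2, of 2] by simp
    also have "\<dots> * 1 \<le> \<dots> * (indicator B x + indicator B y)"
      using True by (intro mult_left_mono) (auto simp: indicator_def)
    finally show ?thesis by simp
  next
    case False
    then show ?thesis by (simp add: \<phi>_def B_def)
  qed
  let ?k = "\<lambda>x y. ennreal (k (x - y))"
  have "gagliardo s UNIV \<phi> \<le> (\<integral>\<^sup>+x. (\<integral>\<^sup>+y. ?k x y * indicator B x + ?k x y * indicator B y \<partial>lborel) \<partial>lborel)"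
    unfolding gagliardo_def difference_energy_def
  proof (simp, intro nn_integral_mono)
    fix x y
    have "(\<phi> x - \<phi> y)\<^sup>2 / norm (x - y) powr (real CARD('n) + 2 * s) \<le>
        min 1 ((norm (x - y))\<^sup>2) * (indicator B x + indicator B y) / norm (x - y) powr (real CARD('n) + 2 * s)"
      by (intro divide_right_mono bd) simp
    also have "\<dots> = k (x - y) * indicator B x + k (x - y) * indicator B y"
      by (simp add: k_def add_divide_distrib distrib_left)
    finally show "ennreal ((\<phi> x - \<phi> y)\<^sup>2 / norm (x - y) powr (real CARD('n) + 2 * s)) \<le>
        ?k x y * indicator B x + ?k x y * indicator B y"
      using k0[of "x - y"] bd[of x y] by (auto simp: indicator_def ennreal_plus[symmetric] simp del: ennreal_plus intro: ennreal_leI)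
  qed
  also have "\<dots> = (\<integral>\<^sup>+x. (\<integral>\<^sup>+y. ?k x y * indicator B x \<partial>lborel) \<partial>lborel)
      + (\<integral>\<^sup>+x. (\<integral>\<^sup>+y. ?k x y * indicator B y \<partial>lborel) \<partial>lborel)"
    by (simp add: nn_integral_add)
  also have "(\<integral>\<^sup>+x. (\<integral>\<^sup>+y. ?k x y * indicator B y \<partial>lborel) \<partial>lborel)
      = (\<integral>\<^sup>+y. (\<integral>\<^sup>+x. ?k x y * indicator B y \<partial>lborel) \<partial>lborel)"
    by (rule lborel_pair.Fubini'[symmetric]) measurable
  also have "(\<integral>\<^sup>+x. (\<integral>\<^sup>+y. ?k x y * indicator B x \<partial>lborel) \<partial>lborel) = J * emeasure lborel B"
    by (simp add: nn_integral_multc Jx nn_integral_cmult_indicator)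
  also have "(\<integral>\<^sup>+y. (\<integral>\<^sup>+x. ?k x y * indicator B y \<partial>lborel) \<partial>lborel) = J * emeasure lborel B"
    by (simp add: nn_integral_multc Jy nn_integral_cmult_indicator)
  also have "J * emeasure lborel B + J * emeasure lborel B < \<infinity>"
    using J Bfin by (simp add: ennreal_mult_less_top)
  finally have gfin: "gagliardo s UNIV \<phi> < \<infinity>" .
  have "mass p UNIV \<phi> \<le> (\<integral>\<^sup>+x. indicator B x \<partial>lborel)"
    unfolding mass_def
  proof (intro nn_integral_mono)
    fix x
    have "\<bar>\<phi> x\<bar> powr p \<le> 1" using ce(1) by (intro powr_le1) (auto simp: \<phi>_def)
    then show "ennreal (\<bar>\<phi> x\<bar> powr p) * indicator UNIV x \<le> indicator B x"
      using ennreal_leI[of "\<bar>\<phi> x\<bar> powr p" 1] by (auto simp: B_def indicator_def \<phi>_def)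
  qed
  then have mfin: "mass p UNIV \<phi> < \<infinity>" using Bfin by (simp add: order.strict_trans1)
  define r where "r = 1 / (2 * real CARD('n))"
  have r: "r > 0" by (simp add: r_def)
  have "mass p UNIV \<phi> \<ge> (\<integral>\<^sup>+x. ennreal ((1 / 2) powr p) * indicator (cube r (0 :: real ^ 'n)) x \<partial>lborel)"
    unfolding mass_def
  proof (intro nn_integral_mono)
    fix x :: "real ^ 'n"
    have "ennreal ((1 / 2) powr p) \<le> ennreal (\<bar>\<phi> x\<bar> powr p)" if "x \<in> cube r 0"
    proof -
      have "norm x \<le> 1 / 2" using norm_diff_cube_le[OF r that] by (simp add: r_def)
      then show ?thesis using ce(1) by (intro ennreal_leI powr_mono2) (auto simp: \<phi>_def)
    qed
    then show "ennreal ((1 / 2) powr p) * indicator (cube r 0) x \<le> ennreal (\<bar>\<phi> x\<bar> powr p) * indicator UNIV x"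
      by (simp add: indicator_def)
  qed
  moreover have "(\<integral>\<^sup>+x. ennreal ((1 / 2) powr p) * indicator (cube r (0 :: real ^ 'n)) x \<partial>lborel) = ennreal ((1 / 2) powr p * r ^ CARD('n))"
    by (simp add: nn_integral_cmult_indicator emeasure_cube[OF r] ennreal_mult[symmetric] less_imp_le[OF r])
  ultimately have "mass p UNIV \<phi> \<ge> ennreal ((1 / 2) powr p * r ^ CARD('n))" by simp
  moreover have "(1 / 2) powr p * r ^ CARD('n) > 0" using r by simp
  ultimately have mpos: "mass p UNIV \<phi> > 0" by (meson ennreal_less_zero_iff less_le_trans)
  obtain u where "u \<in> admissible s (UNIV :: (real ^ 'n) set)"
    by (rule normalized_admissible[OF s(1,3) \<phi>, of UNIV "enn2real (mass p UNIV \<phi>)" "enn2real (gagliardo s UNIV \<phi>)"])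
      (use gfin mfin mpos in \<open>auto simp: p_def enn2real_positive_iff\<close>)
  then show ?thesis by blast
qed

section \<open>Scaling and positivity of the best constant\<close>

lemma rescale_admissible:
  fixes u :: "real ^ 'n::finite \<Rightarrow> real"
  assumes s: "0 < s" "2 * s < real CARD('n)" and \<Omega>: "\<Omega> \<in> sets borel" and c: "c \<noteq> 0"
    and u: "u \<in> admissible s \<Omega>"
  shows "rescale s b c u \<in> admissible s {z. b + c *\<^sub>R z \<in> \<Omega>}"
    "gagliardo s {z. b + c *\<^sub>R z \<in> \<Omega>} (rescale s b c u) = gagliardo s \<Omega> u"
proof -
  have m[measurable]: "u \<in> borel_measurable borel" and u': "mass (crit_exp CARD('n) s) \<Omega> u = 1" "\<And>x. x \<notin> \<Omega> \<Longrightarrow> u x = 0"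
      "gagliardo s \<Omega> u < \<infinity>"
    using u by (auto simp: admissible_def)
  show g: "gagliardo s {z. b + c *\<^sub>R z \<in> \<Omega>} (rescale s b c u) = gagliardo s \<Omega> u"
    by (rule gagliardo_rescale[OF c m \<Omega>])
  show "rescale s b c u \<in> admissible s {z. b + c *\<^sub>R z \<in> \<Omega>}"
    unfolding admissible_def mem_Collect_eq g
    using u' mass_rescale[OF s c m \<Omega>, of b] by (auto simp: rescale_def measurable_rescale[OF m])
qed

lemma best_constant_rescale:
  fixes \<Omega> :: "(real ^ 'n::finite) set"
  assumes s: "0 < s" "2 * s < real CARD('n)" and \<Omega>[measurable]: "\<Omega> \<in> sets borel" and c: "c \<noteq> 0"
  shows "best_constant s {z. b + c *\<^sub>R z \<in> \<Omega>} = best_constant s \<Omega>"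
proof -
  define \<Omega>' where "\<Omega>' = {z. b + c *\<^sub>R z \<in> \<Omega>}"
  have dm: "\<Omega>' \<in> sets borel" unfolding \<Omega>'_def by measurable
  \<comment> \<open>The inverse affine map brings \<open>\<Omega>'\<close> back to \<open>\<Omega>\<close>, so each inclusion is an instance of
    \<open>rescale_admissible\<close>.\<close>
  have inv: "{z. - (b /\<^sub>R c) + (1 / c) *\<^sub>R z \<in> \<Omega>'} = \<Omega>"
    using c by (auto simp: \<Omega>'_def algebra_simps)
  have "(\<lambda>u. enn2real (gagliardo s \<Omega>' u)) ` admissible s \<Omega>' = (\<lambda>u. enn2real (gagliardo s \<Omega> u)) ` admissible s \<Omega>"
  proof (intro equalityI subsetI)
    fix y assume "y \<in> (\<lambda>u. enn2real (gagliardo s \<Omega>' u)) ` admissible s \<Omega>'"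
    then obtain u where u: "u \<in> admissible s \<Omega>'" "y = enn2real (gagliardo s \<Omega>' u)" by blast
    have "1 / c \<noteq> 0" using c by simp
    from rescale_admissible[OF s dm this u(1), of "- (b /\<^sub>R c)", unfolded inv]
    show "y \<in> (\<lambda>u. enn2real (gagliardo s \<Omega> u)) ` admissible s \<Omega>" by (metis u(2) image_eqI)
  next
    fix y assume "y \<in> (\<lambda>u. enn2real (gagliardo s \<Omega> u)) ` admissible s \<Omega>"
    then obtain u where u: "u \<in> admissible s \<Omega>" "y = enn2real (gagliardo s \<Omega> u)" by blast
    from rescale_admissible[OF s \<Omega> c u(1), of b, folded \<Omega>'_def]
    show "y \<in> (\<lambda>u. enn2real (gagliardo s \<Omega>' u)) ` admissible s \<Omega>'" by (metis u(2) image_eqI)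
  qed
  then show ?thesis unfolding best_constant_def \<Omega>'_def[symmetric] by simp
qed

text \<open>
  If all weighted averages were at most \<open>c\<close>, the refined Sobolev inequality would give mass at most
  \<open>1 / 2\<close>.
\<close>
lemma nonvanishing_average:
  fixes \<Omega> :: "(real ^ 'n::finite) set"
  assumes s: "0 < s" "2 * s < real CARD('n)" and \<Omega>[measurable]: "\<Omega> \<in> sets borel"
    and sat: "\<And>r. 0 < r \<Longrightarrow> cube_saturated r \<Omega>"
  obtains c where "0 < c" "\<And>u. u \<in> admissible s \<Omega> \<Longrightarrow> gagliardo s \<Omega> u \<le> ennreal K \<Longrightarrow>
    \<exists>x\<in>\<Omega>. \<exists>r>0. c < r powr (real CARD('n) / 2 - s) * \<bar>average r u x\<bar>"
proof -
  define p where "p = crit_exp CARD('n) s"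
  define \<alpha> where "\<alpha> = real CARD('n) / 2 - s"
  define A where "A = sqrt (real CARD('n) powr (real CARD('n) + 2 * s))"
  note ce = crit_exp_facts[OF s, folded p_def]
  define K' where "K' = max K 0 + 1"
  have K': "K' > 0" by (simp add: K'_def)
  have A: "(A + 1) powr p > 0"
  proof -
    have "A \<ge> 0" by (simp add: A_def)
    then have "A + 1 \<noteq> 0" by linarith
    then show ?thesis by simp
  qed
  \<comment> \<open>With this \<open>c\<close> the bound on the mass is \<open>1 / 2\<close>.\<close>
  define c where "c = (1 / (2 * (A + 1) powr p * K')) powr (1 / (p - 2))"
  have c: "c > 0" using A K' by (simp add: c_def)
  have cp: "c powr (p - 2) = 1 / (2 * (A + 1) powr p * K')"
    using ce(1) A K' by (simp add: c_def powr_powr)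
  show ?thesis
  proof (rule that[OF c], rule ccontr)
    fix u assume u: "u \<in> admissible s \<Omega>" and g: "gagliardo s \<Omega> u \<le> ennreal K"
      and neg: "\<not> (\<exists>x\<in>\<Omega>. \<exists>r>0. c < r powr (real CARD('n) / 2 - s) * \<bar>average r u x\<bar>)"
    have um: "u \<in> borel_measurable borel" and m1: "mass p \<Omega> u = 1"
      using u by (auto simp: admissible_def p_def)
    have av: "\<bar>average r u x\<bar> \<le> c * r powr (- \<alpha>)" if "0 < r" "x \<in> \<Omega>" for r x
    proof -
      have "r powr \<alpha> * \<bar>average r u x\<bar> \<le> c" using neg that unfolding \<alpha>_def by (meson not_le)
      then show ?thesis using that(1) by (simp add: powr_minus field_simps)
    qed
    have "mass p \<Omega> u \<le> ennreal ((A + 1) powr p * c powr (p - 2)) * gagliardo s \<Omega> u"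
      unfolding p_def A_def
      by (rule mass_le_average_gagliardo[OF s um \<Omega> sat _ c]) (use m1 av in \<open>auto simp: p_def \<alpha>_def\<close>)
    also have "\<dots> \<le> ennreal ((A + 1) powr p * c powr (p - 2)) * ennreal K'"
      by (intro mult_left_mono order.trans[OF g] ennreal_leI) (auto simp: K'_def)
    also have "\<dots> = ennreal ((A + 1) powr p * c powr (p - 2) * K')"
      using K' by (intro ennreal_mult[symmetric]) auto
    also have "(A + 1) powr p * c powr (p - 2) * K' = 1 / 2"
      using A K' by (simp add: cp)
    finally have "ennreal 1 \<le> ennreal (1 / 2)" using m1 by simp
    then show False by (subst (asm) ennreal_le_iff) auto
  qed
qed

lemma best_constant_pos:
  fixes \<Omega> :: "(real ^ 'n::finite) set"
  assumes s: "0 < s" "2 * s < real CARD('n)" and \<Omega>[measurable]: "\<Omega> \<in> sets borel"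
    and sat: "\<And>r. 0 < r \<Longrightarrow> cube_saturated r \<Omega>" and ne: "admissible s \<Omega> \<noteq> {}"
  shows "0 < best_constant s \<Omega>"
proof -
  define p where "p = crit_exp CARD('n) s"
  define A where "A = sqrt (real CARD('n) powr (real CARD('n) + 2 * s))"
  note ce = crit_exp_facts[OF s, folded p_def]
  define C where "C = (A + 1) powr p * 2 powr (p - 2)"
  have C: "C > 0"
  proof -
    have "A \<ge> 0" by (simp add: A_def)
    then have "A + 1 \<noteq> 0" by linarith
    then show ?thesis by (simp add: C_def)
  qed
  have "1 / C \<le> enn2real (gagliardo s \<Omega> u)" if u: "u \<in> admissible s \<Omega>" for u
  proof -
    have um: "u \<in> borel_measurable borel" and m1: "mass p \<Omega> u = 1" and fin: "gagliardo s \<Omega> u < \<infinity>"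
      using u by (auto simp: admissible_def p_def)
    have av: "\<bar>average r u x\<bar> \<le> 2 * r powr (- (real CARD('n) / 2 - s))" if "0 < r" "x \<in> \<Omega>" for r x
      using average_bound[OF _ um \<Omega> _ that(1), of p x] m1 ce(1) sat[OF that(1)] that(2)
      by (simp add: ce(4) cube_saturated_def)
    have "mass p \<Omega> u \<le> ennreal C * gagliardo s \<Omega> u"
      unfolding C_def p_def A_def
      by (rule mass_le_average_gagliardo[OF s um \<Omega> sat]) (use m1 av in \<open>auto simp: p_def\<close>)
    also have "gagliardo s \<Omega> u = ennreal (enn2real (gagliardo s \<Omega> u))" using fin by simp
    also have "ennreal C * \<dots> = ennreal (C * enn2real (gagliardo s \<Omega> u))"
      using C by (intro ennreal_mult[symmetric]) auto
    finally have "ennreal 1 \<le> ennreal (C * enn2real (gagliardo s \<Omega> u))" by (simp add: m1)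
    then have "1 \<le> C * enn2real (gagliardo s \<Omega> u)" using C by (subst (asm) ennreal_le_iff) auto
    then show ?thesis using C by (simp add: field_simps)
  qed
  then have "1 / C \<le> best_constant s \<Omega>"
    unfolding best_constant_def by (intro cINF_greatest ne)
  then show ?thesis using C by (meson less_le_trans zero_less_divide_1_iff)
qed

section \<open>Minimizers on the whole space\<close>

lemma powr_concave_gap:
  fixes a \<theta> :: real
  assumes "0 < a" "a < 1" "0 < \<theta>" "\<theta> < 1"
  shows "1 < a powr \<theta> + (1 - a) powr \<theta>"
proof -
  have "a powr 1 < a powr \<theta>" "(1 - a) powr 1 < (1 - a) powr \<theta>"
    by (rule powr_less_mono'; use assms in simp)+
  then show ?thesis using assms by simp
qed

text \<open>
  Compactness provides the limit \<open>w0\<close>; the averages over the unit cube make it nonzero, and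
  \<open>profile_splitting\<close> gives the final inequality. The limit is set to \<open>0\<close> off \<open>\<Omega>\<close>, where all members of
  the sequence vanish.
\<close>
lemma profile_extraction:
  fixes v :: "nat \<Rightarrow> real ^ 'n::finite \<Rightarrow> real" and \<Omega>s :: "nat \<Rightarrow> (real ^ 'n) set" and \<Omega> :: "(real ^ 'n) set"
  assumes s: "0 < s" "2 * s < real CARD('n)"
    and \<Omega>s[measurable]: "\<And>j. \<Omega>s j \<in> sets borel" and \<Omega>[measurable]: "\<Omega> \<in> sets borel"
    and sat: "\<And>k j. cube_saturated (1 / real (Suc k)) (\<Omega>s j)"
    and sub: "\<And>j. \<Omega>s j \<subseteq> \<Omega>"
    and ev: "\<And>x. x \<in> \<Omega> \<Longrightarrow> eventually (\<lambda>j. x \<in> \<Omega>s j) sequentially"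
    and v: "\<And>j. v j \<in> admissible s (\<Omega>s j)"
    and eL: "(\<lambda>j. enn2real (gagliardo s (\<Omega>s j) (v j))) \<longlonglongrightarrow> L"
    and L: "\<And>j. best_constant s (\<Omega>s j) = L"
    and c: "0 < c" "\<And>j. c \<le> \<bar>LINT x:cube 1 1|lborel. v j x\<bar>"
  defines "p \<equiv> crit_exp CARD('n) s"
  obtains w a where "w \<in> borel_measurable borel" "\<And>x. x \<notin> \<Omega> \<Longrightarrow> w x = 0"
    "mass p \<Omega> w = ennreal a" "0 < a" "a \<le> 1" "gagliardo s \<Omega> w < \<infinity>"
    "enn2real (gagliardo s \<Omega> w) + L * (1 - a) powr (2 / p) \<le> L"
proof -
  note ce = crit_exp_facts[OF s, folded p_def]
  have vm[measurable]: "v j \<in> borel_measurable borel" and off: "\<And>x. x \<notin> \<Omega>s j \<Longrightarrow> v j x = 0"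
    and m1: "mass p (\<Omega>s j) (v j) = 1" and gf: "gagliardo s (\<Omega>s j) (v j) < \<infinity>" for j
    using v[of j] by (auto simp: admissible_def p_def)
  define e where "e j = enn2real (gagliardo s (\<Omega>s j) (v j))" for j
  have e: "gagliardo s (\<Omega>s j) (v j) = ennreal (e j)" for j using gf[of j] by (simp add: e_def)
  have e0: "0 \<le> e j" for j by (simp add: e_def)
  have "\<exists>K. \<forall>j. e j \<le> K"
    using convergent_imp_Bseq[OF convergentI[OF eL]] by (auto simp: Bseq_def abs_le_iff e_def)
  then obtain K where K: "\<And>j. e j \<le> K" by blast
  have gK: "gagliardo s (\<Omega>s j) (v j) \<le> ennreal K" for j unfolding e by (intro ennreal_leI K)
  have p1: "1 \<le> p" using ce(1) by simp
  have m1': "mass p (\<Omega>s j) (v j) \<le> 1" for j by (simp add: m1)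
  obtain r w0 where r: "strict_mono r" and w0[measurable]: "w0 \<in> borel_measurable borel"
    and ae: "AE x in lborel. (\<lambda>j. v (r j) x) \<longlonglongrightarrow> w0 x"
    and L2: "\<And>l \<epsilon>. 0 < \<epsilon> \<Longrightarrow> \<forall>\<^sub>F j in sequentially. (\<integral>\<^sup>+x\<in>cball 0 (real l). ennreal ((v (r j) x - w0 x)\<^sup>2) \<partial>lborel) \<le> ennreal \<epsilon>"
    by (rule gagliardo_compactness[where v = v and \<Omega>s = \<Omega>s, OF s(1) p1 vm \<Omega>s sat _ m1' gK])
      (rule off, assumption, rule that)
  have nz: "\<not> (AE x in lborel. w0 x = 0)"
    by (rule limit_nonzero_of_average[of "\<lambda>j. v (r j)", OF _ L2 c(1)]) (use c(2) in auto)
  define w where "w x = indicator \<Omega> x * w0 x" for x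
  have w[measurable]: "w \<in> borel_measurable borel" unfolding w_def by measurable
  have woff: "w x = 0" if "x \<notin> \<Omega>" for x using that by (simp add: w_def)
  have voff: "v j x = 0" if "x \<notin> \<Omega>" for x j using that off sub by blast
  have w0off: "AE x in lborel. x \<notin> \<Omega> \<longrightarrow> w0 x = 0"
    using ae
  proof eventually_elim
    case (elim x)
    then show ?case using voff by (auto simp: LIMSEQ_const_iff)
  qed
  have aew: "AE x in lborel. (\<lambda>j. v (r j) x) \<longlonglongrightarrow> w x"
    using ae w0off by eventually_elim (auto simp: w_def indicator_def)
  have evr: "eventually (\<lambda>j. x \<in> \<Omega>s (r j)) sequentially" if "x \<in> \<Omega>" for x
    using eventually_subseq[OF r ev[OF that]] .
  have eLr: "(\<lambda>j. e (r j)) \<longlonglongrightarrow> L"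
    using LIMSEQ_subseq_LIMSEQ[OF eL r] by (simp add: e_def comp_def)
  have p0: "0 < p" using p1 by simp
  have sob: "L * enn2real (mass p (\<Omega>s (r j)) f) powr (2 / p) \<le> enn2real (gagliardo s (\<Omega>s (r j)) f)"
    if "f \<in> borel_measurable borel" "mass p (\<Omega>s (r j)) f < \<infinity>" "gagliardo s (\<Omega>s (r j)) f < \<infinity>" for j f
    using best_constant_sobolev[OF s that(1) \<Omega>s, of "r j"] that(2,3) by (simp add: L p_def)
  have ps: "mass p \<Omega> w \<le> 1" "gagliardo s \<Omega> w < \<infinity>"
    "enn2real (gagliardo s \<Omega> w) + L * (1 - enn2real (mass p \<Omega> w)) powr (2 / p) \<le> L"
    by (rule profile_splitting[where p = p and v = "\<lambda>j. v (r j)" and w = w and \<Omega>s = "\<lambda>j. \<Omega>s (r j)"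
        and \<Omega> = \<Omega> and s = s and e = "\<lambda>j. e (r j)" and L = L,
      OF p0 vm w \<Omega>s \<Omega> sub evr m1 e0 e eLr aew sob]; assumption)+
  define a where "a = enn2real (mass p \<Omega> w)"
  have ma: "mass p \<Omega> w = ennreal a" using order.strict_trans1[OF ps(1)] by (simp add: a_def)
  have "a \<noteq> 0"
  proof
    assume "a = 0"
    then have "mass p \<Omega> w = 0" by (simp add: ma)
    then have "AE x in lborel. ennreal (\<bar>w x\<bar> powr p) * indicator \<Omega> x = 0"
      unfolding mass_def by (subst (asm) nn_integral_0_iff_AE) auto
    then have "AE x in lborel. w0 x = 0"
      using w0off
    proof eventually_elim
      case (elim x)
      show ?case
      proof (cases "x \<in> \<Omega>")
        case True
        then show ?thesis using elim(1) by (auto simp: w_def ennreal_eq_0_iff powr_eq_0_iff dest: antisym[OF _ powr_ge_zero])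
      qed (use elim in auto)
    qed
    with nz show False by blast
  qed
  then have a0: "0 < a" using enn2real_nonneg[of "mass p \<Omega> w"] unfolding a_def by linarith
  have "ennreal a \<le> ennreal 1" using ps(1) by (simp add: ma)
  then have a1: "a \<le> 1" by (subst (asm) ennreal_le_iff) auto
  show ?thesis
    using that[OF w woff ma a0 a1 ps(2) ps(3)[folded a_def]] .
qed

text \<open>
  The inequality from \<open>profile_extraction\<close> and the Sobolev inequality for the profile together say
  \<open>a powr (2 / p) + (1 - a) powr (2 / p) \<le> 1\<close>, which for \<open>0 < a \<le> 1\<close> holds only if \<open>a = 1\<close>. No mass is lost,
  so the profile is a minimizer.
\<close>
lemma attained_of_nonvanishing:
  fixes v :: "nat \<Rightarrow> real ^ 'n::finite \<Rightarrow> real" and \<Omega> :: "(real ^ 'n) set"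
  assumes s: "0 < s" "2 * s < real CARD('n)"
    and \<Omega>[measurable]: "\<Omega> \<in> sets borel"
    and sat: "\<And>k. cube_saturated (1 / real (Suc k)) \<Omega>"
    and v: "\<And>j. v j \<in> admissible s \<Omega>"
    and lim: "(\<lambda>j. enn2real (gagliardo s \<Omega> (v j))) \<longlonglongrightarrow> best_constant s \<Omega>"
    and pos: "0 < best_constant s \<Omega>"
    and c: "0 < c" "\<And>j. c \<le> \<bar>LINT x:cube 1 1|lborel. v j x\<bar>"
  obtains w where "w \<in> admissible s \<Omega>" "enn2real (gagliardo s \<Omega> w) = best_constant s \<Omega>"
proof -
  define p where "p = crit_exp CARD('n) s"
  note ce = crit_exp_facts[OF s, folded p_def]
  define L where "L = best_constant s \<Omega>"
  have L: "L > 0" using pos by (simp add: L_def)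
  have th: "0 < 2 / p" "2 / p < 1" using ce(1) by auto
  obtain w a where w: "w \<in> borel_measurable borel" "\<And>x. x \<notin> \<Omega> \<Longrightarrow> w x = 0"
    and m: "mass p \<Omega> w = ennreal a" "0 < a" "a \<le> 1" and g: "gagliardo s \<Omega> w < \<infinity>"
    and sp: "enn2real (gagliardo s \<Omega> w) + L * (1 - a) powr (2 / p) \<le> L"
    unfolding p_def
    by (rule profile_extraction[where \<Omega>s = "\<lambda>_. \<Omega>" and v = v and \<Omega> = \<Omega> and L = L and c = c,
          OF s \<Omega> \<Omega> sat _ _ v _ _ c]) (use lim in \<open>auto simp: L_def\<close>)
  have "L * a powr (2 / p) \<le> enn2real (gagliardo s \<Omega> w)"
    using best_constant_sobolev[OF s w(1) \<Omega>, folded p_def] m g by (simp add: L_def)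
  with sp have "L * (a powr (2 / p) + (1 - a) powr (2 / p)) \<le> L * 1" by (simp add: algebra_simps)
  then have "a powr (2 / p) + (1 - a) powr (2 / p) \<le> 1" using L by (simp only: mult_le_cancel_left_pos)
  then have a1: "a = 1" using powr_concave_gap[OF m(2) _ th] m(3) by force
  then have adm: "w \<in> admissible s \<Omega>" using w m g by (auto simp: admissible_def p_def)
  have "enn2real (gagliardo s \<Omega> w) \<le> L" using sp a1 by simp
  with best_constant_le[OF adm] have "enn2real (gagliardo s \<Omega> w) = best_constant s \<Omega>" by (simp add: L_def)
  with adm show ?thesis by (rule that)
qed

lemma minimizing_sequence:
  fixes \<Omega> :: "(real ^ 'n::finite) set"
  assumes ne: "admissible s \<Omega> \<noteq> {}"
  obtains u :: "nat \<Rightarrow> real ^ 'n \<Rightarrow> real" where "\<And>j. u j \<in> admissible s \<Omega>"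
    "(\<lambda>j. enn2real (gagliardo s \<Omega> (u j))) \<longlonglongrightarrow> best_constant s \<Omega>"
    "\<And>j. enn2real (gagliardo s \<Omega> (u j)) \<le> best_constant s \<Omega> + 1"
proof -
  have "\<exists>u\<in>admissible s \<Omega>. enn2real (gagliardo s \<Omega> u) < best_constant s \<Omega> + 1 / real (Suc j)" for j
  proof (rule ccontr)
    assume "\<not> ?thesis"
    then have "best_constant s \<Omega> + 1 / real (Suc j) \<le> (INF u\<in>admissible s \<Omega>. enn2real (gagliardo s \<Omega> u))"
      by (intro cINF_greatest ne) (auto simp: not_less)
    then show False by (simp add: best_constant_def[symmetric] divide_le_0_iff)
  qed
  then obtain u where u: "\<And>j. u j \<in> admissible s \<Omega>"
    and lt: "\<And>j. enn2real (gagliardo s \<Omega> (u j)) < best_constant s \<Omega> + 1 / real (Suc j)"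
    by metis
  have "(\<lambda>j. enn2real (gagliardo s \<Omega> (u j))) \<longlonglongrightarrow> best_constant s \<Omega>"
  proof (rule tendsto_sandwich[of "\<lambda>_. best_constant s \<Omega>" _ _ "\<lambda>j. best_constant s \<Omega> + 1 / real (Suc j)"])
    show "(\<lambda>j. best_constant s \<Omega> + 1 / real (Suc j)) \<longlonglongrightarrow> best_constant s \<Omega>"
      using tendsto_add[OF tendsto_const LIMSEQ_Suc[OF lim_1_over_n]] by simp
    show "\<forall>\<^sub>F j in sequentially. best_constant s \<Omega> \<le> enn2real (gagliardo s \<Omega> (u j))"
      by (intro always_eventually allI best_constant_le u)
    show "\<forall>\<^sub>F j in sequentially. enn2real (gagliardo s \<Omega> (u j)) \<le> best_constant s \<Omega> + 1 / real (Suc j)"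
      by (intro always_eventually allI less_imp_le lt)
  qed simp
  moreover have "enn2real (gagliardo s \<Omega> (u j)) \<le> best_constant s \<Omega> + 1" for j
  proof -
    have "1 / real (Suc j) \<le> 1" by simp
    then show ?thesis using lt[of j] by linarith
  qed
  ultimately show ?thesis using u that by blast
qed

text \<open>
  Each member of a minimizing sequence has a cube with a substantial weighted average; the member is
  rescaled so that this cube becomes the unit cube. The domain changes accordingly.
\<close>
lemma normalized_minimizing_sequence:
  fixes \<Omega> :: "(real ^ 'n::finite) set"
  assumes s: "0 < s" "2 * s < real CARD('n)" and \<Omega>[measurable]: "\<Omega> \<in> sets borel"
    and sat: "\<And>r. 0 < r \<Longrightarrow> cube_saturated r \<Omega>" and ne: "admissible s \<Omega> \<noteq> {}"
  obtains c x r v where "0 < c" "\<And>j::nat. x j \<in> \<Omega>" "\<And>j. 0 < r j"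
    "\<And>j. v j \<in> admissible s {z. lower_corner (r j) (x j) + r j *\<^sub>R z \<in> \<Omega>}"
    "(\<lambda>j. enn2real (gagliardo s {z. lower_corner (r j) (x j) + r j *\<^sub>R z \<in> \<Omega>} (v j)))
       \<longlonglongrightarrow> best_constant s \<Omega>"
    "\<And>j. c \<le> \<bar>LINT z:cube 1 1|lborel. v j z\<bar>"
proof -
  obtain u where u: "\<And>j::nat. u j \<in> admissible s \<Omega>"
    and lim: "(\<lambda>j. enn2real (gagliardo s \<Omega> (u j))) \<longlonglongrightarrow> best_constant s \<Omega>"
    and bd: "\<And>j. enn2real (gagliardo s \<Omega> (u j)) \<le> best_constant s \<Omega> + 1"
    using minimizing_sequence[OF ne] by metis
  obtain c where c: "0 < c" and nv: "\<And>u. u \<in> admissible s \<Omega> \<Longrightarrow> gagliardo s \<Omega> u \<le> ennreal (best_constant s \<Omega> + 1) \<Longrightarrow>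
    \<exists>x\<in>\<Omega>. \<exists>r>0. c < r powr (real CARD('n) / 2 - s) * \<bar>average r u x\<bar>"
    using nonvanishing_average[OF s \<Omega> sat, of "best_constant s \<Omega> + 1"] by metis
  have "gagliardo s \<Omega> (u j) \<le> ennreal (best_constant s \<Omega> + 1)" for j
  proof -
    have "gagliardo s \<Omega> (u j) = ennreal (enn2real (gagliardo s \<Omega> (u j)))"
      using u[of j] by (simp add: admissible_def)
    also have "\<dots> \<le> ennreal (best_constant s \<Omega> + 1)" by (intro ennreal_leI bd)
    finally show ?thesis .
  qed
  then have "\<exists>x r. x \<in> \<Omega> \<and> r > 0 \<and> c < r powr (real CARD('n) / 2 - s) * \<bar>average r (u j) x\<bar>" for j
    using nv[OF u] by blast
  then obtain x r where x: "\<And>j. x j \<in> \<Omega>" and r: "\<And>j. 0 < r j"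
    and xr: "\<And>j. c < r j powr (real CARD('n) / 2 - s) * \<bar>average (r j) (u j) (x j)\<bar>"
    by metis
  define v where "v j = rescale s (lower_corner (r j) (x j)) (r j) (u j)" for j
  have r0: "r j \<noteq> 0" for j using r[of j] by simp
  have um: "u j \<in> borel_measurable borel" for j using u[of j] by (simp add: admissible_def)
  show ?thesis
  proof (rule that[of c x r v, OF c x r])
    show "v j \<in> admissible s {z. lower_corner (r j) (x j) + r j *\<^sub>R z \<in> \<Omega>}" for j unfolding v_def by (rule rescale_admissible(1)[OF s \<Omega> r0 u])
    show "(\<lambda>j. enn2real (gagliardo s {z. lower_corner (r j) (x j) + r j *\<^sub>R z \<in> \<Omega>} (v j))) \<longlonglongrightarrow> best_constant s \<Omega>"
      unfolding v_def rescale_admissible(2)[OF s \<Omega> r0 u] by (rule lim)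
    show "c \<le> \<bar>LINT z:cube 1 1|lborel. v j z\<bar>" for j
      unfolding v_def using xr[of j] r[of j]
      by (simp add: integral_unit_cube_rescale[OF r um] abs_mult)
  qed
qed

theorem whole_space_minimizer:
  assumes s: "0 < s" "s < 1" "2 * s < real CARD('n)"
  obtains w where "w \<in> admissible s (UNIV :: (real ^ 'n::finite) set)"
    "enn2real (gagliardo s UNIV w) = best_constant s (UNIV :: (real ^ 'n) set)"
proof -
  note ne = bump_admissible[OF s]
  have sat: "cube_saturated r (UNIV :: (real ^ 'n) set)" for r by (simp add: cube_saturated_def)
  have U: "(UNIV :: (real ^ 'n) set) \<in> sets borel" by simp
  obtain c x r v where c: "0 < c"
    and v: "\<And>j::nat. v j \<in> admissible s (UNIV :: (real ^ 'n) set)"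
    and lim: "(\<lambda>j. enn2real (gagliardo s (UNIV :: (real ^ 'n) set) (v j))) \<longlonglongrightarrow> best_constant s (UNIV :: (real ^ 'n) set)"
    and av: "\<And>j. c \<le> \<bar>LINT z:cube 1 1|lborel. v j z\<bar>"
    by (rule normalized_minimizing_sequence[OF s(1,3) U sat ne]) (simp, rule that)
  show ?thesis
    by (rule attained_of_nonvanishing[OF s(1,3) U sat v lim best_constant_pos[OF s(1,3) U sat ne] c av])
      (rule that)
qed

section \<open>The strict inequality\<close>

definition shifted_half_space :: "'n::finite \<Rightarrow> real \<Rightarrow> (real ^ 'n) set"
  where "shifted_half_space k t = {x. - t < x $ k}"

lemma shifted_half_space_0: "shifted_half_space k 0 = half_space k"
  by (simp add: shifted_half_space_def half_space_def)

lemma shifted_half_space_borel [measurable]: "shifted_half_space k t \<in> sets borel"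
proof -
  have "{x \<in> space borel. - t < x $ k} \<in> sets borel" by measurable
  then show ?thesis by (simp add: shifted_half_space_def)
qed

lemma half_space_borel [measurable]: "half_space k \<in> sets borel"
  using shifted_half_space_borel[of k 0] by (simp add: shifted_half_space_0)

lemma shifted_half_space_translate:
  "{z. axis k t + 1 *\<^sub>R z \<in> shifted_half_space k t'} = shifted_half_space k (t' + t)"
  by (auto simp: shifted_half_space_def axis_def)

text \<open>
  The boundary hyperplane consists of faces of the grid, because \<open>t\<close> is a multiple of \<open>r\<close>.
\<close>
lemma cube_saturated_shifted_half_space:
  assumes r: "0 < r" and t: "t = r * of_int m"
  shows "cube_saturated r (shifted_half_space k t)"
proof -
  have *: "x \<in> shifted_half_space k t \<longleftrightarrow> - m < \<lceil>x $ k / r\<rceil>" for x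
    using r by (simp add: shifted_half_space_def less_ceiling_iff t field_simps)
  show ?thesis by (auto simp: cube_saturated_def cube_def *)
qed

lemma AE_off_hyperplane: "AE x in lborel. x $ k \<noteq> (t :: real)"
proof -
  have "{x :: real ^ 'a. x $ k = t} = {x. x \<bullet> axis k 1 = t}" by (simp add: inner_axis)
  moreover have "negligible {x :: real ^ 'a. x \<bullet> axis k 1 = t}"
    by (rule negligible_standard_hyperplane) (simp add: axis_in_Basis_iff)
  ultimately have "{x :: real ^ 'a. x $ k = t} \<in> null_sets lebesgue"
    by (simp add: negligible_iff_null_sets)
  moreover have "{x \<in> space borel. (x :: real ^ 'a) $ k = t} \<in> sets borel" by measurable
  ultimately have "{x :: real ^ 'a. x $ k = t} \<in> null_sets lborel"
    by (simp add: null_sets_completion_iff)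
  then show ?thesis by (rule AE_I') auto
qed

text \<open>
  The mass of \<open>{x. t < x $ k}\<close> is continuous in \<open>t\<close>, because hyperplanes are null sets, and it tends to 1
  and to 0 at the two ends; the intermediate value theorem applies.
\<close>
lemma mass_bisection:
  fixes w :: "real ^ 'n::finite \<Rightarrow> real" and k :: 'n
  assumes w[measurable]: "w \<in> borel_measurable borel" and m1: "mass p UNIV w = 1"
  obtains t where "mass p {x. t < x $ k} w = ennreal (1 / 2)"
proof -
  define W where "W x = \<bar>w x\<bar> powr p" for x
  have [measurable]: "W \<in> borel_measurable borel" unfolding W_def by measurable
  have W0: "W x \<ge> 0" for x by (simp add: W_def)
  have n1: "(\<integral>\<^sup>+x. ennreal (W x) \<partial>lborel) = 1" using m1 by (simp add: mass_def W_def)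
  have iW: "integrable lborel W"
    by (rule integrableI_bounded) (use n1 W0 in auto)
  have L1: "(LINT x|lborel. W x) = 1"
    using nn_integral_eq_integral[OF iW] W0 n1 by simp
  define F where "F t = (LINT x|lborel. indicator {x. t < x $ k} x * W x)" for t
  have [measurable]: "{x :: real ^ 'n. t < x $ k} \<in> sets borel" for t
    using shifted_half_space_borel[of k "- t"] by (simp add: shifted_half_space_def)
  have iF: "integrable lborel (\<lambda>x. indicator {x. t < x $ k} x * W x)" for t
    by (rule Bochner_Integration.integrable_bound[OF iW]) (auto simp: indicator_def W0)
  have dom: "(\<lambda>j. F (ts j)) \<longlonglongrightarrow> (LINT x|lborel. g x * W x)"
    if "AE x in lborel. (\<lambda>j. indicator {x. ts j < x $ k} x) \<longlonglongrightarrow> g x" "g \<in> borel_measurable borel"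
    for ts and g :: "real ^ 'n \<Rightarrow> real"
    unfolding F_def
  proof (rule integral_dominated_convergence[where w = W])
    show "AE x in lborel. (\<lambda>j. indicator {x. ts j < x $ k} x * W x) \<longlonglongrightarrow> g x * W x"
      using that(1) by eventually_elim (intro tendsto_intros)
  qed (use iW that(2) in \<open>auto simp: indicator_def W0\<close>)
  have cont: "isCont F t" for t
    unfolding continuous_at_sequentially
  proof (intro allI impI)
    fix ts assume ts: "ts \<longlonglongrightarrow> t"
    have "AE x in lborel. (\<lambda>j. indicator {x. ts j < x $ k} x :: real) \<longlonglongrightarrow> indicator {x. t < x $ k} x"
      using AE_off_hyperplane[of k t]
    proof eventually_elim
      case (elim x)
      show ?case
      proof (rule tendsto_eventually, cases "t < x $ k")
        case True
        show "\<forall>\<^sub>F j in sequentially. (indicator {x. ts j < x $ k} x :: real) = indicator {x. t < x $ k} x"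
          using order_tendstoD(2)[OF ts True] by eventually_elim (use True in simp)
      next
        case False
        then have "x $ k < t" using elim by simp
        show "\<forall>\<^sub>F j in sequentially. (indicator {x. ts j < x $ k} x :: real) = indicator {x. t < x $ k} x"
          using order_tendstoD(1)[OF ts \<open>x $ k < t\<close>] by eventually_elim (use False in simp)
      qed
    qed
    from dom[OF this] show "(F \<circ> ts) \<longlonglongrightarrow> F t" by (simp add: F_def comp_def)
  qed
  have "(\<lambda>j. F (real j)) \<longlonglongrightarrow> (LINT x|lborel. 0 * W x)"
  proof (rule dom, intro AE_I2 tendsto_eventually)
    fix x :: "real ^ 'n"
    obtain N :: nat where "x $ k \<le> real N" using real_arch_simple by blast
    then show "\<forall>\<^sub>F j in sequentially. (indicator {x. real j < x $ k} x :: real) = 0"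
      by (intro eventually_sequentiallyI[of N]) auto
  qed simp
  then have "(\<lambda>j. F (real j)) \<longlonglongrightarrow> 0" by simp
  from order_tendstoD(2)[OF this, of "1/2"] obtain j1 :: nat where j1: "F (real j1) < 1 / 2"
    by (auto simp: eventually_sequentially)
  have "(\<lambda>j. F (- real j)) \<longlonglongrightarrow> (LINT x|lborel. 1 * W x)"
  proof (rule dom, intro AE_I2 tendsto_eventually)
    fix x :: "real ^ 'n"
    obtain N :: nat where "- (x $ k) < real N" using reals_Archimedean2 by blast
    then show "\<forall>\<^sub>F j in sequentially. (indicator {x. - real j < x $ k} x :: real) = 1"
      by (intro eventually_sequentiallyI[of N]) auto
  qed simp
  then have "(\<lambda>j. F (- real j)) \<longlonglongrightarrow> 1" by (simp add: L1)
  from order_tendstoD(1)[OF this, of "1/2"] obtain j2 :: nat where j2: "1 / 2 < F (- real j2)"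
    by (auto simp: eventually_sequentially)
  obtain t where t: "F t = 1 / 2"
    using IVT2[of F "real j1" "1/2" "- real j2"] j1 j2 cont by fastforce
  have "mass p {x. t < x $ k} w = (\<integral>\<^sup>+x. ennreal (indicator {x. t < x $ k} x * W x) \<partial>lborel)"
    unfolding mass_def W_def by (intro nn_integral_cong) (auto simp: indicator_def)
  also have "\<dots> = ennreal (F t)"
    unfolding F_def by (rule nn_integral_eq_integral[OF iF]) (simp add: W0)
  finally show ?thesis using t that by simp
qed

lemma bisected_translate:
  fixes k :: "'n::finite"
  assumes s: "0 < s" "2 * s < real CARD('n)" and w: "w \<in> admissible s (UNIV :: (real ^ 'n) set)"
  obtains v where "v \<in> admissible s UNIV" "gagliardo s UNIV v = gagliardo s UNIV w"
    "mass (crit_exp CARD('n) s) (half_space k) v = ennreal (1 / 2)"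
proof -
  define p where "p = crit_exp CARD('n) s"
  have wm: "w \<in> borel_measurable borel" and w1: "mass p UNIV w = 1"
    using w by (auto simp: admissible_def p_def)
  obtain t where t: "mass p {x. t < x $ k} w = ennreal (1 / 2)" by (rule mass_bisection[OF wm w1])
  have ht: "{x :: real ^ 'n. t < x $ k} = shifted_half_space k (- t)" by (simp add: shifted_half_space_def)
  show ?thesis
  proof (rule that)
    show "rescale s (axis k t) 1 w \<in> admissible s UNIV"
      "gagliardo s UNIV (rescale s (axis k t) 1 w) = gagliardo s UNIV w"
      using rescale_admissible[OF s _ _ w, of 1 "axis k t"] by simp_all
    show "mass (crit_exp CARD('n) s) (half_space k) (rescale s (axis k t) 1 w) = ennreal (1 / 2)"
      using mass_rescale[OF s _ wm shifted_half_space_borel, of 1 "axis k t" k "- t"] t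
      unfolding shifted_half_space_translate ht by (simp add: p_def shifted_half_space_0)
  qed
qed

text \<open>
  A cone is invariant under dilation by 2, so its measure \<open>m\<close> satisfies \<open>m = 2 ^ n * m\<close>.
\<close>
lemma emeasure_cone:
  fixes M :: "'a::euclidean_space set"
  assumes [measurable]: "M \<in> sets borel" and cone: "\<And>z. 2 *\<^sub>R z \<in> M \<longleftrightarrow> z \<in> M"
  shows "emeasure lborel M = 0 \<or> emeasure lborel M = \<infinity>"
proof (rule ccontr)
  assume neg: "\<not> ?thesis"
  define m where "m = enn2real (emeasure lborel M)"
  have em: "emeasure lborel M = ennreal m" using neg by (simp add: m_def less_top)
  have m: "m > 0" using neg by (auto simp: m_def enn2real_positive_iff less_top zero_less_iff_neq_zero)
  have "emeasure lborel M = (\<integral>\<^sup>+x. indicator M x \<partial>lborel)" by simp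
  also have "\<dots> = ennreal (\<bar>2\<bar> ^ DIM('a)) * (\<integral>\<^sup>+x. indicator M (0 + 2 *\<^sub>R x) \<partial>lborel)"
    by (rule nn_integral_lborel_affine) auto
  also have "(\<integral>\<^sup>+x. indicator M (0 + 2 *\<^sub>R x) \<partial>lborel) = (\<integral>\<^sup>+x. indicator M x \<partial>lborel)"
    by (intro nn_integral_cong) (simp add: indicator_def cone)
  finally have "ennreal m = ennreal (2 ^ DIM('a) * m)" by (simp add: em ennreal_mult m less_imp_le)
  then have "m = 2 ^ DIM('a) * m" using m by simp
  then have "(2::real) ^ DIM('a) = 1" using m by simp
  moreover have "(2::real) ^ DIM('a) > 1" by (rule one_less_power) auto
  ultimately show False by simp
qed

text \<open>
  A bisected whole-space minimizer \<open>v\<close> has energies \<open>A\<close> and \<open>B\<close> on the two half-spaces and an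
  interaction \<open>X\<close> with \<open>A + B + X \<le> S\<close>. If \<open>X\<close> were \<open>0\<close>, \<open>v\<close> would be almost everywhere constant on one
  half-space, whose measure is \<open>0\<close> or \<open>\<infinity>\<close>, and it could not have mass \<open>1 / 2\<close> there. So \<open>A\<close> or \<open>B\<close> is
  less than \<open>S / 2\<close>; reflection reduces the second case to the first.
\<close>
theorem best_constant_half_space_less:
  fixes k :: "'n::finite"
  assumes s: "0 < s" "s < 1" "2 * s < real CARD('n)"
  shows "best_constant s (half_space k) < 2 powr (- (2 * s / real CARD('n))) * best_constant s (UNIV :: (real ^ 'n) set)"
proof -
  define p where "p = crit_exp CARD('n) s"
  define S where "S = best_constant s (UNIV :: (real ^ 'n) set)"
  obtain w where w: "w \<in> admissible s (UNIV :: (real ^ 'n) set)" and gw: "enn2real (gagliardo s UNIV w) = S"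
    using whole_space_minimizer[OF s] unfolding S_def by blast
  obtain v where va: "v \<in> admissible s UNIV" and vg: "gagliardo s UNIV v = gagliardo s UNIV w"
    and vh: "mass p (half_space k) v = ennreal (1 / 2)"
    by (rule bisected_translate[OF s(1,3) w, of k, folded p_def]) (rule that)
  have vm[measurable]: "v \<in> borel_measurable borel" and v1: "mass p UNIV v = 1"
    using va by (auto simp: admissible_def p_def)
  have v: "gagliardo s UNIV v = ennreal S"
    using gw w by (auto simp: vg admissible_def)
  define P M :: "(real ^ 'n) set" where "P = half_space k" and "M = {x. x $ k < 0}"
  have [measurable]: "P \<in> sets borel" by (simp add: P_def)
  have [measurable]: "M \<in> sets borel"
  proof -
    have "{x \<in> space borel. (x :: real ^ 'n) $ k < 0} \<in> sets borel" by measurable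
    then show ?thesis by (simp add: M_def)
  qed
  have mP: "mass p P v = ennreal (1 / 2)" using vh by (simp add: P_def)
  have mM: "mass p M v = ennreal (1 / 2)"
  proof -
    have "mass p UNIV v = (\<integral>\<^sup>+x. ennreal (\<bar>v x\<bar> powr p) * indicator P x + ennreal (\<bar>v x\<bar> powr p) * indicator M x \<partial>lborel)"
      unfolding mass_def
      by (rule nn_integral_cong_AE, use AE_off_hyperplane[of k 0] in eventually_elim)
        (auto simp: indicator_def P_def M_def half_space_def)
    also have "\<dots> = mass p P v + mass p M v" unfolding mass_def by (rule nn_integral_add) auto
    finally have eq: "1 = ennreal (1 / 2) + mass p M v" by (simp add: v1 mP)
    then have "mass p M v \<noteq> \<infinity>" by (auto simp: ennreal_add_eq_top)
    then obtain y where y: "mass p M v = ennreal y" "y \<ge> 0" by (cases "mass p M v") auto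
    have "ennreal 1 = ennreal (1 / 2 + y)" using eq y by (simp add: ennreal_plus)
    then have "1 = 1 / 2 + y" using y by (subst (asm) ennreal_inj) auto
    then have "y = 1 / 2" by simp
    then show ?thesis by (simp only: y)
  qed
  define A B X where "A = gagliardo s P v" and "B = gagliardo s M v"
    and "X = (\<integral>\<^sup>+x\<in>P. difference_energy s M v x \<partial>lborel)"
  let ?k = "\<lambda>x y. (v x - v y)\<^sup>2 / norm (x - y) powr (real CARD('n) + 2 * s)"
  have split: "A + B + X \<le> ennreal S"
  proof -
    have de: "difference_energy s P v x + difference_energy s M v x \<le> difference_energy s UNIV v x" for x
    proof -
      have "difference_energy s P v x + difference_energy s M v x =
         (\<integral>\<^sup>+y. ennreal (?k x y) * indicator P y +
               ennreal (?k x y) * indicator M y \<partial>lborel)"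
        unfolding difference_energy_def by (rule nn_integral_add[symmetric]) auto
      also have "\<dots> \<le> difference_energy s UNIV v x"
        unfolding difference_energy_def
        by (intro nn_integral_mono) (auto simp: indicator_def P_def M_def half_space_def)
      finally show ?thesis .
    qed
    have "A + B + X = (\<integral>\<^sup>+x. difference_energy s P v x * indicator P x + difference_energy s M v x * indicator M x
        + difference_energy s M v x * indicator P x \<partial>lborel)"
      unfolding A_def B_def X_def gagliardo_def by (simp add: nn_integral_add)
    also have "\<dots> \<le> gagliardo s UNIV v"
      unfolding gagliardo_def
    proof (intro nn_integral_mono)
      fix x
      have "difference_energy s M v x \<le> difference_energy s UNIV v x"
        using order.trans[OF _ de[of x]] by (simp add: add_increasing)
      then show "difference_energy s P v x * indicator P x + difference_energy s M v x * indicator M x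
        + difference_energy s M v x * indicator P x \<le> difference_energy s UNIV v x * indicator UNIV x"
        using de[of x] by (auto simp: indicator_def P_def M_def half_space_def)
    qed
    finally show ?thesis by (simp add: v)
  qed
  have cone: "emeasure lborel M = 0 \<or> emeasure lborel M = \<infinity>"
    by (rule emeasure_cone) (auto simp: M_def mult_less_0_iff)
  have X0: "X \<noteq> 0"
  proof
    assume "X = 0"
    then have ae: "AE x in lborel. difference_energy s M v x * indicator P x = 0"
      unfolding X_def by (subst (asm) nn_integral_0_iff_AE) auto
    have "\<exists>x\<in>P. difference_energy s M v x = 0"
    proof (rule ccontr)
      assume "\<not> ?thesis"
      with ae have "AE x in lborel. x \<notin> P" by (auto elim!: AE_mp simp: indicator_def)
      then have "mass p P v = (\<integral>\<^sup>+x. 0 \<partial>(lborel :: (real ^ 'n) measure))"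
        unfolding mass_def by (intro nn_integral_cong_AE, eventually_elim) simp
      then show False by (simp add: mP)
    qed
    then obtain x where x: "x \<in> P" "difference_energy s M v x = 0" by blast
    have "AE y in lborel. ennreal (?k x y) * indicator M y = 0"
      using x(2) unfolding difference_energy_def by (subst (asm) nn_integral_0_iff_AE) auto
    then have "AE y in lborel. ennreal (\<bar>v y\<bar> powr p) * indicator M y = ennreal (\<bar>v x\<bar> powr p) * indicator M y"
    proof eventually_elim
      case (elim y)
      show ?case
      proof (cases "y \<in> M")
        case True
        then have "x \<noteq> y" using x(1) by (auto simp: P_def M_def half_space_def)
        then have "norm (x - y) powr (real CARD('n) + 2 * s) > 0" by simp
        moreover have "?k x y \<le> 0"
          using elim True by (simp add: ennreal_eq_0_iff)
        ultimately have "(v x - v y)\<^sup>2 \<le> 0" by (simp add: divide_le_0_iff)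
        then show ?thesis by simp
      qed simp
    qed
    then have "mass p M v = (\<integral>\<^sup>+y. ennreal (\<bar>v x\<bar> powr p) * indicator M y \<partial>lborel)"
      unfolding mass_def by (rule nn_integral_cong_AE)
    also have "\<dots> = ennreal (\<bar>v x\<bar> powr p) * emeasure lborel M"
      by (rule nn_integral_cmult_indicator) auto
    finally have "ennreal (1 / 2) = ennreal (\<bar>v x\<bar> powr p) * emeasure lborel M" by (simp add: mM)
    then show False using cone by (auto simp: ennreal_mult_top split: if_splits)
  qed
  have S0: "S \<ge> 0" using gw enn2real_nonneg by metis
  have "A + B \<le> ennreal S" using split by (meson add_increasing2 order.trans order_refl zero_le)
  then have fin: "A < \<infinity>" "B < \<infinity>" by (auto simp: less_top[symmetric] top_unique)
  define a b where "a = enn2real A" and "b = enn2real B"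
  have ab: "A = ennreal a" "B = ennreal b" "a \<ge> 0" "b \<ge> 0" using fin by (auto simp: a_def b_def)
  have "a + b < S"
  proof (rule ccontr)
    assume "\<not> a + b < S"
    then have "ennreal S \<le> A + B" using ab by (simp add: ennreal_plus[symmetric] ennreal_leI del: ennreal_plus)
    then have "A + B + X \<le> A + B" using split by (rule order.trans[rotated])
    then have "A + B + X = A + B + 0" by (intro antisym) (auto simp: add_increasing2)
    then have "X = 0" using fin by (subst (asm) ennreal_add_left_cancel) auto
    with X0 show False ..
  qed
  let ?q = "2 powr (- (2 * s / real CARD('n)))"
  have bound: "best_constant s P < ?q * S"
    if f[measurable]: "f \<in> borel_measurable borel" and mf: "mass p P f = ennreal (1 / 2)"
      and g: "gagliardo s P f = ennreal c" "0 \<le> c" "c < S / 2" for f c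
  proof -
    have "mass p P f < \<infinity>" unfolding mf infinity_ennreal_def by (rule ennreal_less_top)
    moreover have "gagliardo s P f < \<infinity>" by (simp add: g(1))
    ultimately have "best_constant s P * enn2real (mass p P f) powr (2 / p) \<le> enn2real (gagliardo s P f)"
      unfolding p_def by (intro best_constant_sobolev[OF s(1,3) f]) auto
    moreover have "enn2real (mass p P f) = 1 / 2" unfolding mf by (rule enn2real_ennreal) simp
    ultimately have "best_constant s P * (1 / 2) powr (2 / p) \<le> c" using g by simp
    then have "best_constant s P * (1 / 2) powr (2 / p) < S * (1 / 2) powr 1" using g by simp
    then have "best_constant s P < S * (1 / 2) powr 1 / (1 / 2) powr (2 / p)"
      by (simp add: field_simps)
    also have "\<dots> = S * (1 / 2) powr (1 - 2 / p)" by (simp only: powr_diff) simp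
    also have "1 - 2 / p = 2 * s / real CARD('n)"
      using s by (simp add: p_def crit_exp_def field_simps)
    also have "(1 / 2) powr (2 * s / real CARD('n)) = ?q"
      by (simp add: powr_minus powr_divide divide_simps)
    finally show ?thesis by (simp add: mult.commute)
  qed
  have "a < S / 2 \<or> b < S / 2" using \<open>a + b < S\<close> by linarith
  then have "best_constant s P < ?q * S"
  proof
    assume "a < S / 2"
    show ?thesis by (rule bound[OF vm mP _ ab(3) \<open>a < S / 2\<close>]) (simp add: ab(1)[symmetric] A_def)
  next
    assume "b < S / 2"
    \<comment> \<open>The point reflection carries the lower half-space to the upper one.\<close>
    define v' where "v' = rescale s 0 (-1) v"
    have MP: "{z. 0 + (-1) *\<^sub>R z \<in> M} = P" by (auto simp: M_def P_def half_space_def)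
    have 1: "mass p P v' = ennreal (1 / 2)"
      using mass_rescale[OF s(1,3), of "-1" v M 0, folded p_def] mM unfolding MP by (simp add: v'_def)
    have 2: "gagliardo s P v' = ennreal b"
      using gagliardo_rescale[of "-1" v M s 0] ab(2) unfolding MP by (simp add: v'_def B_def)
    show ?thesis by (rule bound[OF _ 1 2 ab(4) \<open>b < S / 2\<close>]) (simp add: v'_def)
  qed
  then show ?thesis by (simp add: P_def S_def)
qed

section \<open>Minimizers on the half-space\<close>

lemma best_constant_shifted_half_space:
  fixes k :: "'n::finite"
  assumes s: "0 < s" "2 * s < real CARD('n)"
  shows "best_constant s (shifted_half_space k t) = best_constant s (half_space k)"
  using best_constant_rescale[OF s shifted_half_space_borel[of k 0], of 1 "axis k t"]
  unfolding shifted_half_space_translate by (simp add: shifted_half_space_0)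

lemma half_space_admissible:
  fixes k :: "'n::finite"
  assumes s: "0 < s" "s < 1" "2 * s < real CARD('n)"
  shows "admissible s (half_space k) \<noteq> {}"
proof -
  define P where "P = half_space k"
  have Pm[measurable]: "P \<in> sets borel" by (simp add: P_def)
  obtain w where w: "w \<in> admissible s (UNIV :: (real ^ 'n) set)" using bump_admissible[OF s] by blast
  obtain v where v: "v \<in> admissible s UNIV"
    and m: "mass (crit_exp CARD('n) s) P v = ennreal (1 / 2)"
    by (rule bisected_translate[OF s(1,3) w, of k, folded P_def]) (rule that)
  have vm: "v \<in> borel_measurable borel" using v by (simp add: admissible_def)
  have "gagliardo s P v \<le> gagliardo s UNIV v"
    unfolding gagliardo_def difference_energy_def
    by (intro nn_integral_mono mult_mono) (auto simp: indicator_def)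
  also have "\<dots> < \<infinity>" using v by (simp add: admissible_def)
  finally have g: "gagliardo s P v = ennreal (enn2real (gagliardo s P v))" by simp
  obtain u where "u \<in> admissible s P"
    by (rule normalized_admissible[OF s(1,3) vm Pm m _ g]) (use that in auto)
  then show ?thesis unfolding P_def by blast
qed

text \<open>
  The domains of the normalized sequence are half-spaces at integer depth \<open>t j\<close>. If a depth recurs
  infinitely often, \<open>attained_of_nonvanishing\<close> applies on that half-space and the minimizer is
  translated back. Otherwise the depth tends to infinity and the profile is defined on the whole space,
  where its energy is governed by the larger constant \<open>S\<close>; concavity then gives a contradiction.
\<close>
theorem half_space_minimizer:
  fixes k :: "'n::finite"
  assumes s: "0 < s" "s < 1" "2 * s < real CARD('n)"
  obtains w where "w \<in> admissible s (half_space k)"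
    "enn2real (gagliardo s (half_space k) w) = best_constant s (half_space k)"
proof -
  define p where "p = crit_exp CARD('n) s"
  note ce = crit_exp_facts[OF s(1,3), folded p_def]
  define H where "H = shifted_half_space k"
  have Hm[measurable]: "H t \<in> sets borel" for t by (simp add: H_def)
  have H0: "H 0 = half_space k" by (simp add: H_def shifted_half_space_0)
  define P L where "P = half_space k" and "L = best_constant s (half_space k)"
  have Pm[measurable]: "P \<in> sets borel" by (simp add: P_def)
  have HL: "best_constant s (H t) = L" for t
    unfolding H_def L_def by (rule best_constant_shifted_half_space[OF s(1,3)])
  have satP: "cube_saturated r P" if "0 < r" for r
    using cube_saturated_shifted_half_space[OF that, of 0 0 k] by (simp add: P_def shifted_half_space_0)
  have satH: "cube_saturated (1 / real (Suc m)) (H (real t))" for m t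
    unfolding H_def by (rule cube_saturated_shifted_half_space[where m = "int t * int (Suc m)"]) auto
  have ne: "admissible s P \<noteq> {}" unfolding P_def by (rule half_space_admissible[OF s])
  have L0: "L > 0" unfolding L_def P_def[symmetric] by (rule best_constant_pos[OF s(1,3) Pm satP ne])
  obtain c x r v where c: "0 < c" and x: "\<And>j::nat. x j \<in> P" and r: "\<And>j. 0 < r j"
    and v: "\<And>j. v j \<in> admissible s {z. lower_corner (r j) (x j) + r j *\<^sub>R z \<in> P}"
    and lim: "(\<lambda>j. enn2real (gagliardo s {z. lower_corner (r j) (x j) + r j *\<^sub>R z \<in> P} (v j)))
       \<longlonglongrightarrow> best_constant s P"
    and av: "\<And>j. c \<le> \<bar>LINT z:cube 1 1|lborel. v j z\<bar>"
    by (rule normalized_minimizing_sequence[OF s(1,3) Pm _ ne]) (rule satP, assumption, rule that)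
  \<comment> \<open>The number of grid cells between the distinguished cube and the boundary; the ceiling is at
    least 1 because \<open>x j\<close> lies in the open half-space.\<close>
  define t where "t j = nat (\<lceil>x j $ k / r j\<rceil> - 1)" for j
  have dom: "{z. lower_corner (r j) (x j) + r j *\<^sub>R z \<in> P} = H (real (t j))" for j
  proof -
    have "0 < x j $ k / r j" using x[of j] r[of j] by (simp add: P_def half_space_def)
    then have "\<lceil>x j $ k / r j\<rceil> \<ge> 1" by simp
    then have tj: "real (t j) = of_int \<lceil>x j $ k / r j\<rceil> - 1" by (simp add: t_def)
    have "0 < r j * (of_int \<lceil>x j $ k / r j\<rceil> - 1) + r j * z \<longleftrightarrow> - real (t j) < z" for z
    proof -
      have "r j * (of_int \<lceil>x j $ k / r j\<rceil> - 1) + r j * z = r j * (real (t j) + z)"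
        by (simp only: tj distrib_left)
      then show ?thesis using r[of j] by (auto simp: zero_less_mult_iff)
    qed
    then show ?thesis by (simp add: P_def half_space_def H_def shifted_half_space_def lower_corner_def)
  qed
  note v = v[unfolded dom] and lim = lim[unfolded dom, unfolded P_def, folded L_def]
  show ?thesis
  proof (cases "\<exists>T. infinite {j. t j = T}")
    case True
    then obtain T where "infinite {j. t j = T}" by blast
    then obtain q where q: "strict_mono (q :: nat \<Rightarrow> nat)" and "\<And>j. q j \<in> {j. t j = T}"
      using infinite_enumerate by blast
    then have tq: "t (q j) = T" for j by simp
    have vq: "v (q j) \<in> admissible s (H (real T))" for j using v[of "q j"] by (simp add: tq)
    have limq: "(\<lambda>j. enn2real (gagliardo s (H (real T)) (v (q j)))) \<longlonglongrightarrow> best_constant s (H (real T))"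
      using LIMSEQ_subseq_LIMSEQ[OF lim q] by (simp add: comp_def tq HL)
    obtain w where w: "w \<in> admissible s (H (real T))" and gw: "enn2real (gagliardo s (H (real T)) w) = L"
      using attained_of_nonvanishing[OF s(1,3) Hm satH vq limq _ c av] L0 unfolding HL by blast
    have tr: "{z. axis k (- real T) + 1 *\<^sub>R z \<in> H (real T)} = half_space k"
      unfolding H_def shifted_half_space_translate by (simp add: shifted_half_space_0)
    show ?thesis
      using that[of "rescale s (axis k (- real T)) 1 w"] gw
        rescale_admissible[OF s(1,3) Hm _ w, of 1 "axis k (- real T)", unfolded tr]
      by (simp add: L_def)
  next
    case False
    define S where "S = best_constant s (UNIV :: (real ^ 'n) set)"
    have S0: "S > 0"
      unfolding S_def by (rule best_constant_pos[OF s(1,3) _ _ bump_admissible[OF s]]) (auto simp: cube_saturated_def)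
    have "L < 2 powr (- (2 * s / real CARD('n))) * S"
      unfolding L_def S_def by (rule best_constant_half_space_less[OF s])
    also have "\<dots> \<le> 2 powr 0 * S" using s S0 by (intro mult_right_mono powr_mono) auto
    finally have LS: "L < S" by simp
    have ev: "eventually (\<lambda>j. x \<in> H (real (t j))) sequentially" for x :: "real ^ 'n"
    proof -
      obtain N :: nat where N: "- (x $ k) < real N" using reals_Archimedean2 by blast
      have "finite (\<Union>T\<in>{..N}. {j. t j = T})" using False by auto
      moreover have "{j. \<not> x \<in> H (real (t j))} \<subseteq> (\<Union>T\<in>{..N}. {j. t j = T})"
        using N by (auto simp: H_def shifted_half_space_def)
      ultimately have "finite {j. \<not> x \<in> H (real (t j))}" by (rule finite_subset[rotated])
      then show ?thesis by (simp add: eventually_cofinite[symmetric] cofinite_eq_sequentially[symmetric])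
    qed
    have U: "(UNIV :: (real ^ 'n) set) \<in> sets borel" by simp
    obtain w :: "real ^ 'n \<Rightarrow> real" and a where w: "w \<in> borel_measurable borel"
      and m: "mass p UNIV w = ennreal a" "0 < a" "a \<le> 1" and g: "gagliardo s UNIV w < \<infinity>"
      and sp: "enn2real (gagliardo s UNIV w) + L * (1 - a) powr (2 / p) \<le> L"
      by (rule profile_extraction[where \<Omega>s = "\<lambda>j. H (real (t j))" and v = v and \<Omega> = "UNIV" and L = L and c = c,
            OF s(1,3) Hm U satH _ ev v lim HL c av, folded p_def]) (rule subset_UNIV, rule that)
    have "S * a powr (2 / p) \<le> enn2real (gagliardo s UNIV w)"
      using best_constant_sobolev[OF s(1,3) w U, folded p_def] m g by (simp add: S_def)
    moreover have "L * a powr (2 / p) < S * a powr (2 / p)" using LS m(2) by simp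
    ultimately have "L * (a powr (2 / p) + (1 - a) powr (2 / p)) < L * 1" using sp by (simp add: algebra_simps)
    then have lt: "a powr (2 / p) + (1 - a) powr (2 / p) < 1" using L0 by (simp only: mult_less_cancel_left_pos)
    have th: "0 < 2 / p" "2 / p < 1" using ce(1) by auto
    have False
    proof (cases "a = 1")
      case True
      then show False using lt by simp
    next
      case False
      then show False using powr_concave_gap[OF m(2) _ th] m(3) lt by simp
    qed
    then show ?thesis ..
  qed
qed

section \<open>From Borel to Lebesgue measurable functions\<close>

lemma borel_representative:
  fixes u :: "real ^ 'n::finite \<Rightarrow> real"
  assumes u: "u \<in> borel_measurable (lebesgue_on \<Omega>)" and \<Omega>[measurable]: "\<Omega> \<in> sets borel"
  obtains v where "v \<in> borel_measurable borel" "AE x in lborel. x \<in> \<Omega> \<longrightarrow> u x = v x"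
proof -
  have "(\<lambda>x. indicator \<Omega> x *\<^sub>R u x) \<in> borel_measurable lebesgue"
    using u by (subst (asm) borel_measurable_restrict_space_iff) auto
  then obtain v where "v \<in> borel_measurable lborel" "AE x in lborel. indicator \<Omega> x *\<^sub>R u x = v x"
    using completion_ex_borel_measurable_real by blast
  then show ?thesis
    by (intro that[of v]) (auto elim!: AE_mp simp: indicator_def)
qed

context
  fixes u v :: "real ^ 'n::finite \<Rightarrow> real" and \<Omega> :: "(real ^ 'n) set"
  assumes u: "u \<in> borel_measurable (lebesgue_on \<Omega>)" and v[measurable]: "v \<in> borel_measurable borel"
    and \<Omega>[measurable]: "\<Omega> \<in> sets borel" and eq: "AE x in lborel. x \<in> \<Omega> \<longrightarrow> u x = v x"
begin

lemma nn_integral_lebesgue_on_eq_mass: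
  "(\<integral>\<^sup>+x. ennreal (\<bar>u x\<bar> powr p) \<partial>lebesgue_on \<Omega>) = mass p \<Omega> v"
proof -
  have "(\<integral>\<^sup>+x. ennreal (\<bar>u x\<bar> powr p) \<partial>lebesgue_on \<Omega>) = (\<integral>\<^sup>+x. ennreal (\<bar>u x\<bar> powr p) * indicator \<Omega> x \<partial>lebesgue)"
    by (rule nn_integral_restrict_space) simp
  also have "\<dots> = (\<integral>\<^sup>+x. ennreal (\<bar>v x\<bar> powr p) * indicator \<Omega> x \<partial>lebesgue)"
    by (rule nn_integral_cong_AE, use AE_completion[OF eq] in eventually_elim) (auto simp: indicator_def)
  also have "\<dots> = mass p \<Omega> v" unfolding mass_def by (simp add: nn_integral_completion)
  finally show ?thesis .
qed

lemma frac_energy_eq_gagliardo: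
  "frac_energy s u (\<Omega> \<times> \<Omega>) = ennreal (frac_const CARD('n) s / 2) * gagliardo s \<Omega> v"
proof -
  have "(\<integral>\<^sup>+ (x, y) \<in> \<Omega> \<times> \<Omega>. ennreal ((u x - u y)\<^sup>2 / norm (x - y) powr (real CARD('n) + 2 * s)) \<partial>lebesgue)
      = (\<integral>\<^sup>+z. ennreal (\<bar>difference_quotient s \<Omega> v z\<bar> powr 2) \<partial>lebesgue)"
  proof (rule nn_integral_cong_AE)
    show "AE z in lebesgue. (case z of (x, y) \<Rightarrow> ennreal ((u x - u y)\<^sup>2 / norm (x - y) powr (real CARD('n) + 2 * s))) * indicator (\<Omega> \<times> \<Omega>) z
        = ennreal (\<bar>difference_quotient s \<Omega> v z\<bar> powr 2)"
      using AE_completion[OF AE_lborel_pair[OF eq eq, unfolded lborel_prod]]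
    proof eventually_elim
      case (elim z)
      obtain x y where z: "z = (x, y)" by (cases z)
      have "(norm (x - y) powr (real CARD('n) / 2 + s))\<^sup>2 = norm (x - y) powr (real CARD('n) + 2 * s)"
        by (simp add: power2_eq_square powr_add[symmetric])
      then show ?case using elim
        by (auto simp: z difference_quotient_def indicator_def power_divide)
    qed
  qed
  also have "\<dots> = (\<integral>\<^sup>+z. ennreal (\<bar>difference_quotient s \<Omega> v z\<bar> powr 2) \<partial>lborel)"
    by (simp add: nn_integral_completion)
  also have "\<dots> = gagliardo s \<Omega> v"
    by (simp only: gagliardo_eq_difference_quotient[OF v \<Omega>] lborel_prod)
  finally show ?thesis unfolding frac_energy_def by simp
qed

lemma measurable_abs_powr: "(\<lambda>x. \<bar>u x\<bar> powr p) \<in> borel_measurable (lebesgue_on \<Omega>)"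
  using u by measurable

lemma Lp_space_iff_mass: "u \<in> Lp_space p \<Omega> \<longleftrightarrow> mass p \<Omega> v < \<infinity>"
  using u measurable_abs_powr[of p] nn_integral_lebesgue_on_eq_mass[of p]
  by (simp add: Lp_space_def integrable_iff_bounded)

lemma Lp_norm_eq_mass: "Lp_norm p \<Omega> u = enn2real (mass p \<Omega> v) powr (1 / p)"
  using integral_eq_nn_integral[OF measurable_abs_powr[of p]] nn_integral_lebesgue_on_eq_mass[of p]
  by (simp add: Lp_norm_def)

lemma zero_ae_iff_mass: "zero_ae \<Omega> u \<longleftrightarrow> mass p \<Omega> v = 0"
proof -
  have "mass p \<Omega> v = 0 \<longleftrightarrow> (AE x in lebesgue_on \<Omega>. ennreal (\<bar>u x\<bar> powr p) = 0)"
    unfolding nn_integral_lebesgue_on_eq_mass[symmetric]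
    by (rule nn_integral_0_iff_AE) (use measurable_abs_powr[of p] in measurable)
  also have "\<dots> \<longleftrightarrow> zero_ae \<Omega> u"
    unfolding zero_ae_def by (intro AE_cong) (auto simp: ennreal_eq_0_iff dest: antisym[OF _ powr_ge_zero])
  finally show ?thesis ..
qed

end

lemma frac_const_pos:
  assumes "0 < s" "s < 1" "0 < n"
  shows "0 < frac_const n s"
  using assms by (auto simp: frac_const_def intro!: divide_pos_pos mult_pos_pos Gamma_real_pos)

lemma borel_measurable_lebesgue_on_borel:
  fixes w :: "real ^ 'n::finite \<Rightarrow> real"
  assumes "w \<in> borel_measurable borel"
  shows "w \<in> borel_measurable (lebesgue_on \<Omega>)"
  by (intro measurable_restrict_space1 measurable_completion) (use assms in simp)

text \<open>
  Every competitor in the infimum has a Borel representative, to which the homogeneous form of the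
  inequality applies; the given minimizer shows that the bound is attained.
\<close>
theorem sobolev_const_eq_best_constant:
  fixes \<Omega> :: "(real ^ 'n::finite) set"
  assumes s: "0 < s" "s < 1" "2 * s < real CARD('n)" and \<Omega>[measurable]: "\<Omega> \<in> sets borel"
    and w: "w \<in> admissible s \<Omega>" and gw: "enn2real (gagliardo s \<Omega> w) = best_constant s \<Omega>"
  shows "sobolev_const s \<Omega> = ennreal (frac_const CARD('n) s / 2 * best_constant s \<Omega>)"
    and "w \<in> frac_space s \<Omega>" and "\<not> zero_ae \<Omega> w"
    and "frac_energy s w (\<Omega> \<times> \<Omega>) = sobolev_const s \<Omega> * ennreal ((Lp_norm (crit_exp CARD('n) s) \<Omega> w)\<^sup>2)"
proof -
  define p where "p = crit_exp CARD('n) s"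
  note ce = crit_exp_facts[OF s(1,3), folded p_def]
  define C where "C = frac_const CARD('n) s / 2"
  have C: "C > 0" using frac_const_pos[OF s(1,2), of "CARD('n)"] by (simp add: C_def)
  have wm: "w \<in> borel_measurable borel" and w1: "mass p \<Omega> w = 1" and wg: "gagliardo s \<Omega> w < \<infinity>"
    using w by (auto simp: admissible_def p_def)
  have wl: "w \<in> borel_measurable (lebesgue_on \<Omega>)" by (rule borel_measurable_lebesgue_on_borel[OF wm])
  have ww: "AE x in lborel. x \<in> \<Omega> \<longrightarrow> w x = w x" by simp
  note link = wl wm \<Omega> ww
  have b0: "best_constant s \<Omega> \<ge> 0" using gw by (metis enn2real_nonneg)
  have gb: "gagliardo s \<Omega> w = ennreal (best_constant s \<Omega>)" using wg by (simp add: gw[symmetric])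
  have energy: "frac_energy s w (\<Omega> \<times> \<Omega>) = ennreal (C * best_constant s \<Omega>)"
    using C b0 by (simp add: frac_energy_eq_gagliardo[OF link] C_def[symmetric] gb ennreal_mult)
  have norm: "Lp_norm p \<Omega> w = 1" by (simp add: Lp_norm_eq_mass[OF link] w1)
  show fs: "w \<in> frac_space s \<Omega>"
    using energy by (simp add: frac_space_def p_def[symmetric] Lp_space_iff_mass[OF link] w1)
  show nz: "\<not> zero_ae \<Omega> w" by (simp add: zero_ae_iff_mass[OF link, of p] w1)
  show sc: "sobolev_const s \<Omega> = ennreal (frac_const CARD('n) s / 2 * best_constant s \<Omega>)"
    unfolding C_def[symmetric]
  proof (rule antisym)
    have "sobolev_const s \<Omega> \<le> frac_energy s w (\<Omega> \<times> \<Omega>) / ennreal ((Lp_norm p \<Omega> w)\<^sup>2)"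
      unfolding sobolev_const_def p_def by (rule INF_lower) (use fs nz in simp)
    then show "sobolev_const s \<Omega> \<le> ennreal (C * best_constant s \<Omega>)"
      using divide_ennreal[of "C * best_constant s \<Omega>" 1] C b0 by (simp add: norm energy)
    show "ennreal (C * best_constant s \<Omega>) \<le> sobolev_const s \<Omega>"
      unfolding sobolev_const_def p_def[symmetric]
    proof (rule INF_greatest)
      fix u assume "u \<in> {u \<in> frac_space s \<Omega>. \<not> zero_ae \<Omega> u}"
      then have uL: "u \<in> Lp_space p \<Omega>" and ue: "frac_energy s u (\<Omega> \<times> \<Omega>) < \<infinity>" and unz: "\<not> zero_ae \<Omega> u"
        by (auto simp: frac_space_def p_def)
      have ul: "u \<in> borel_measurable (lebesgue_on \<Omega>)" using uL by (simp add: Lp_space_def)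
      obtain v where v: "v \<in> borel_measurable borel" and uv: "AE x in lborel. x \<in> \<Omega> \<longrightarrow> u x = v x"
        by (rule borel_representative[OF ul \<Omega>])
      note link = ul v \<Omega> uv
      define m g where "m = enn2real (mass p \<Omega> v)" and "g = enn2real (gagliardo s \<Omega> v)"
      have mf: "mass p \<Omega> v < \<infinity>" using uL by (simp add: Lp_space_iff_mass[OF link])
      have "mass p \<Omega> v \<noteq> 0" using unz by (simp add: zero_ae_iff_mass[OF link, of p])
      then have m: "m > 0" using mf by (simp add: m_def enn2real_positive_iff zero_less_iff_neq_zero)
      have gf: "gagliardo s \<Omega> v < \<infinity>"
        using ue C by (auto simp: frac_energy_eq_gagliardo[OF link] C_def[symmetric] ennreal_mult_less_top)
      have g: "gagliardo s \<Omega> v = ennreal g" "g \<ge> 0" using gf by (auto simp: g_def)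
      have sob: "best_constant s \<Omega> * m powr (2 / p) \<le> g"
        unfolding m_def g_def p_def by (rule best_constant_sobolev[OF s(1,3) v \<Omega>]) (use mf gf in \<open>auto simp: p_def\<close>)
      have "(Lp_norm p \<Omega> u)\<^sup>2 = m powr (2 / p)"
        by (simp add: Lp_norm_eq_mass[OF link] m_def power2_eq_square powr_add[symmetric])
      moreover have "frac_energy s u (\<Omega> \<times> \<Omega>) = ennreal (C * g)"
        using C g by (simp add: frac_energy_eq_gagliardo[OF link] C_def[symmetric] ennreal_mult)
      ultimately have "frac_energy s u (\<Omega> \<times> \<Omega>) / ennreal ((Lp_norm p \<Omega> u)\<^sup>2) = ennreal (C * g / m powr (2 / p))"
        using C g m by (simp add: divide_ennreal)
      moreover have "C * best_constant s \<Omega> \<le> C * g / m powr (2 / p)"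
        using sob m C by (simp add: pos_le_divide_eq mult.assoc)
      ultimately show "ennreal (C * best_constant s \<Omega>) \<le> frac_energy s u (\<Omega> \<times> \<Omega>) / ennreal ((Lp_norm p \<Omega> u)\<^sup>2)"
        by (simp add: ennreal_leI)
    qed
  qed
  show "frac_energy s w (\<Omega> \<times> \<Omega>) = sobolev_const s \<Omega> * ennreal ((Lp_norm (crit_exp CARD('n) s) \<Omega> w)\<^sup>2)"
    unfolding sc p_def[symmetric] norm energy by (simp add: C_def)
qed

theorem theorem1p1:
  fixes s :: real and k :: "'n::finite"
  assumes "0 < s" and "s < 1" and "real CARD('n) > 2 * s"
  shows "sobolev_const s (half_space k)
           < ennreal (2 powr (- (2 * s / real CARD('n))))
               * sobolev_const s (UNIV :: (real ^ 'n) set) \<and>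
         (\<exists>u \<in> frac_space s (half_space k).
            \<not> zero_ae (half_space k) u \<and>
            frac_energy s u (half_space k \<times> half_space k)
              = sobolev_const s (half_space k)
                * ennreal ((Lp_norm (crit_exp CARD('n) s) (half_space k) u)\<^sup>2))"
proof -
  note s = assms
  obtain w where w: "w \<in> admissible s (UNIV :: (real ^ 'n) set)"
    "enn2real (gagliardo s UNIV w) = best_constant s (UNIV :: (real ^ 'n) set)"
    using whole_space_minimizer[OF s] by blast
  have U: "(UNIV :: (real ^ 'n) set) \<in> sets borel" by simp
  obtain u where u: "u \<in> admissible s (half_space k)"
    "enn2real (gagliardo s (half_space k) u) = best_constant s (half_space k)"
    using half_space_minimizer[OF s, of k] by blast
  note W = sobolev_const_eq_best_constant[OF s U w]
  note H = sobolev_const_eq_best_constant[OF s half_space_borel u]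
  define C where "C = frac_const CARD('n) s / 2"
  have C: "C > 0" using frac_const_pos[OF s(1,2), of "CARD('n)"] by (simp add: C_def)
  let ?S = "best_constant s (UNIV :: (real ^ 'n) set)"
  have b0: "?S \<ge> 0" using w(2) by (metis enn2real_nonneg)
  have h0: "best_constant s (half_space k) \<ge> 0" using u(2) by (metis enn2real_nonneg)
  let ?q = "2 powr (- (2 * s / real CARD('n))) :: real"
  have "C * best_constant s (half_space k)
      < C * (?q * ?S)"
    by (intro mult_strict_left_mono best_constant_half_space_less s C)
  then have "ennreal (C * best_constant s (half_space k))
      < ennreal (?q * (C * ?S))"
    using C h0 by (intro ennreal_lessI) (auto simp: mult_ac intro: le_less_trans[rotated])
  also have "\<dots> = ennreal (?q) * ennreal (C * ?S)"
    using C b0 by (intro ennreal_mult) auto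
  finally have "sobolev_const s (half_space k)
           < ennreal (?q) * sobolev_const s (UNIV :: (real ^ 'n) set)"
    unfolding W(1) H(1) C_def .
  then show ?thesis using H(2-4) by blast
qed

end
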